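(* Let $(R,\mathfrak m,k)$ be a Noetherian local ring, let $M$ be a nonzero finitely generated $R$-module of dimension $D\geq1$, and let $J_1,\ldots,J_s$ be proper ideals with $\operatorname{ht}_M(J_\ell)>0$ for every $\ell$. For $1\leq i\leq D$ and $\boldsymbol\alpha\in\mathbb N^s$ with $|\boldsymbol\alpha|=i-1$, $$c_{i,\boldsymbol\alpha}^{\Delta}(J_1|\cdots|J_s;M)=\sum_{j=1}^{s}c^{(j)}\bigl(J_1^{[\alpha_1]},\ldots,J_j^{[\alpha_j+1]},\ldots,J_s^{[\alpha_s]};M\bigr).$$
   Context: $\mathbb N=\{0,1,2,\ldots\}$; $\lambda_R$ denotes length. $\operatorname{ht}_M(I)$ is the height of $(I+\operatorname{Ann}_R(M))/\operatorname{Ann}_R(M)$ in $R/\operatorname{Ann}_R(M)$. For $\mathbf u\in\mathbb N^s$ put $J^{\mathbf u}=J_1^{u_1}\cdots J_s^{u_s}$, $|\mathbf u|=u_1+\cdots+u_s$; $\mathbf e_j$ is the $j$-th standard basis vector and $\mathbf 1=(1,\ldots,1)$. Directional mixed multiplicities: for $r$ and all coordinates of $\mathbf u$ sufficiently large, $H^{(j)}_{\mathbf J,M}(r,\mathbf u)=\lambda_R\bigl(J^{\mathbf u}M/(\mathfrak m^{r+1}J^{\mathbf u}M+J^{\mathbf u+\mathbf e_j}M)\bigr)$ agrees with a polynomial of total degree at most $D-1$, whose homogeneous component of degree $D-1$ (zero if the degree is smaller) is $$\sum_{1\leq|\mathbf d|\leq D,\ d_j>0}\frac{c^{(j)}(J_1^{[d_1]},\ldots,J_s^{[d_s]};M)}{(D-|\mathbf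 d|)!\,(d_j-1)!\prod_{\ell\ne j}d_\ell!}\,r^{D-|\mathbf d|}u_j^{d_j-1}\prod_{\ell\neq j}u_\ell^{d_\ell};$$ this defines the nonnegative integers $c^{(j)}(J_1^{[d_1]},\ldots,J_s^{[d_s]};M)$ for $1\le|\mathbf d|\le D$, $d_j>0$. $J_\ell^{[d_\ell]}$ is repetition notation, not a power. Diagonal mixed multiplicities: using the diagonal multiform module $\bigoplus_{\mathbf u}J^{\mathbf u}M/J^{\mathbf u+\mathbf 1}M$, for $r$ and all coordinates of $\mathbf u$ sufficiently large the function $\lambda_R\bigl(J^{\mathbf u}M/(\mathfrak m^{r+1}J^{\mathbf u}M+J^{\mathbf u+\mathbf1}M)\bigr)$ agrees with a polynomial of total degree at most $D-1$, whose homogeneous component of degree $D-1$ is $$\sum_{i=1}^{D}\sum_{|\boldsymbol\alpha|=i-1}\frac{c^{\Delta}_{i,\boldsymbol\alpha}(J_1|\cdots|J_s;M)}{(D-i)!\,\alpha_1!\cdots\alpha_s!}\,r^{D-i}u_1^{\alpha_1}\cdots u_s^{\alpha_s};$$ this defines $c^{\Delta}_{i,\boldsymbol\alpha}(J_1|\cdots|J_s;M)$ (codimension indexing). *)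

theory Defs
  imports "HOL-Algebra.Module" "HOL-Algebra.QuotRing" "HOL-Algebra.Ideal_Product"
    "HOL-Algebra.Ring_Divisibility" "HOL-Library.Extended_Nat"
begin

section \<open>Local rings, dimension and height\<close>

locale local_ring = cring R for R (structure) +
  fixes \<mm> :: "'a set"
  assumes maximalideal_max: "maximalideal \<mm> R"
    and maximalideal_unique: "maximalideal I R \<Longrightarrow> I = \<mm>"

definition prime_chain :: "('a, 'r) ring_scheme \<Rightarrow> nat \<Rightarrow> (nat \<Rightarrow> 'a set) \<Rightarrow> bool" where
  "prime_chain R n P \<longleftrightarrow> (\<forall>i\<le>n. primeideal (P i) R) \<and> (\<forall>i<n. P i \<subset> P (Suc i))"

definition krull_dim :: "('a, 'r) ring_scheme \<Rightarrow> enat" where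
  "krull_dim R = Sup {enat n | n. \<exists>P. prime_chain R n P}"

definition prime_height :: "('a, 'r) ring_scheme \<Rightarrow> 'a set \<Rightarrow> enat" where
  "prime_height R Q = Sup {enat n | n. \<exists>P. prime_chain R n P \<and> P n = Q}"

definition ideal_height :: "('a, 'r) ring_scheme \<Rightarrow> 'a set \<Rightarrow> enat" where
  "ideal_height R I = (INF Q \<in> {Q. primeideal Q R \<and> I \<subseteq> Q}. prime_height R Q)"

definition annihilator :: "('a, 'r) ring_scheme \<Rightarrow> ('a, 'b, 'm) module_scheme \<Rightarrow> 'a set" where
  "annihilator R M = {a \<in> carrier R. \<forall>x\<in>carrier M. a \<odot>\<^bsub>M\<^esub> x = \<zero>\<^bsub>M\<^esub>}"

definition module_dim :: "('a, 'r) ring_scheme \<Rightarrow> ('a, 'b, 'm) module_scheme \<Rightarrow> enat" where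
  "module_dim R M = krull_dim (R Quot annihilator R M)"

text \<open>The image in \<open>R Quot Ann M\<close> of an ideal containing \<open>Ann M\<close> is the set of its cosets.\<close>

definition module_height ::
    "('a, 'r) ring_scheme \<Rightarrow> ('a, 'b, 'm) module_scheme \<Rightarrow> 'a set \<Rightarrow> enat" where
  "module_height R M I =
     ideal_height (R Quot annihilator R M)
       ((\<lambda>a. annihilator R M +>\<^bsub>R\<^esub> a) ` (I <+>\<^bsub>R\<^esub> annihilator R M))"

section \<open>Submodules, quotient modules and length\<close>

definition module_span ::
    "('a, 'r) ring_scheme \<Rightarrow> ('a, 'b, 'm) module_scheme \<Rightarrow> 'b set \<Rightarrow> 'b set" where
  "module_span R M S = \<Inter>{N. submodule N R M \<and> S \<subseteq> N}"

definition finitely_generated_module ::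
    "('a, 'r) ring_scheme \<Rightarrow> ('a, 'b, 'm) module_scheme \<Rightarrow> bool" where
  "finitely_generated_module R M \<longleftrightarrow>
     (\<exists>S\<subseteq>carrier M. finite S \<and> carrier M = module_span R M S)"

definition ideal_smult ::
    "('a, 'r) ring_scheme \<Rightarrow> ('a, 'b, 'm) module_scheme \<Rightarrow> 'a set \<Rightarrow> 'b set \<Rightarrow> 'b set" where
  "ideal_smult R M I N = module_span R M {a \<odot>\<^bsub>M\<^esub> x | a x. a \<in> I \<and> x \<in> N}"

text \<open>The record type of modules extends that of rings; its fields \<open>mult\<close> and \<open>one\<close> play no role
  for modules and are left unspecified.\<close>

definition quotient_module :: "('a, 'b, 'm) module_scheme \<Rightarrow> 'b set \<Rightarrow> ('a, 'b set) module" where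
  "quotient_module M N =
     \<lparr>carrier = a_rcosets\<^bsub>M\<^esub> N, monoid.mult = undefined, one = undefined, ring.zero = N, ring.add = set_add M,
      smult = (\<lambda>a A. \<Union>x\<in>A. N +>\<^bsub>M\<^esub> (a \<odot>\<^bsub>M\<^esub> x))\<rparr>"

definition module_length :: "('a, 'r) ring_scheme \<Rightarrow> ('a, 'b, 'm) module_scheme \<Rightarrow> enat" where
  "module_length R M =
     Sup {enat n | n. \<exists>C. (\<forall>i\<le>n. submodule (C i) R M) \<and> (\<forall>i<n. C i \<subset> C (Suc i))}"

section \<open>Hilbert functions\<close>

text \<open>A family \<open>J\<^sub>1, \<dots>, J\<^sub>s\<close> is indexed by a finite type with \<open>s\<close> elements, and a vector
  in \<open>\<nat>\<^sup>s\<close> is a function on that type.\<close>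

definition vsize :: "('s::finite \<Rightarrow> nat) \<Rightarrow> nat" where
  "vsize u = (\<Sum>l\<in>UNIV. u l)"

definition basis_vec :: "'s \<Rightarrow> 's \<Rightarrow> nat" where
  "basis_vec j = (\<lambda>l. if l = j then 1 else 0)"

definition multi_power ::
    "('a, 'r) ring_scheme \<Rightarrow> ('s::finite \<Rightarrow> 'a set) \<Rightarrow> ('s \<Rightarrow> nat) \<Rightarrow> 'a set" where
  "multi_power R J u =
     (\<Otimes>\<^bsub>ideals_set R\<^esub>l\<in>UNIV. J l [^]\<^bsub>ideals_set R\<^esub> u l)"

text \<open>The length of \<open>J\<^sup>u M / (\<mm>\<^sup>r\<^sup>+\<^sup>1 J\<^sup>u M + J\<^sup>u\<^sup>+\<^sup>v M)\<close>, for a shift vector \<open>v\<close>.\<close>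

definition hilbert_fun ::
    "('a, 'r) ring_scheme \<Rightarrow> 'a set \<Rightarrow> ('s::finite \<Rightarrow> 'a set) \<Rightarrow> ('a, 'b, 'm) module_scheme
      \<Rightarrow> ('s \<Rightarrow> nat) \<Rightarrow> nat \<Rightarrow> ('s \<Rightarrow> nat) \<Rightarrow> enat" where
  "hilbert_fun R \<mm> J M v r u =
     (let JM = (\<lambda>w. ideal_smult R M (multi_power R J w) (carrier M))
      in module_length R
           (quotient_module (M\<lparr>carrier := JM u\<rparr>)
              (ideal_smult R M (\<mm> [^]\<^bsub>ideals_set R\<^esub> (r + 1)) (JM u)
                 <+>\<^bsub>M\<^esub> JM (\<lambda>l. u l + v l))))"

text \<open>A polynomial in \<open>(r, u)\<close> is given by its coefficients: \<open>p a \<beta>\<close> is the coefficient of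
  \<open>r\<^sup>a u\<^sup>\<beta>\<close>.\<close>

definition hom_component ::
    "(nat \<Rightarrow> ('s::finite \<Rightarrow> nat) \<Rightarrow> rat) \<Rightarrow> nat \<Rightarrow> nat \<Rightarrow> ('s \<Rightarrow> nat) \<Rightarrow> rat" where
  "hom_component p n r u =
     (\<Sum>(a, \<beta>) \<in> {(a, \<beta>). a + vsize \<beta> = n}.
        p a \<beta> * of_nat r ^ a * (\<Prod>l\<in>UNIV. of_nat (u l) ^ \<beta> l))"

definition eventually_poly ::
    "(nat \<Rightarrow> ('s::finite \<Rightarrow> nat) \<Rightarrow> enat) \<Rightarrow> nat \<Rightarrow> (nat \<Rightarrow> ('s \<Rightarrow> nat) \<Rightarrow> rat) \<Rightarrow> bool" where
  "eventually_poly H n p \<longleftrightarrow>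
     (\<exists>N. \<forall>r u. r \<ge> N \<and> (\<forall>l. u l \<ge> N) \<longrightarrow>
        (\<exists>h. H r u = enat h \<and> of_nat h = (\<Sum>k\<le>n. hom_component p k r u)))"

section \<open>Mixed multiplicities\<close>

text \<open>The multiplicities are determined by their defining polynomial identities only on the stated
  index sets; outside these the families are normalised to be zero, which makes them unique.\<close>

definition is_directional_mm ::
    "('a, 'r) ring_scheme \<Rightarrow> 'a set \<Rightarrow> ('s::finite \<Rightarrow> 'a set) \<Rightarrow> ('a, 'b, 'm) module_scheme
      \<Rightarrow> 's \<Rightarrow> (('s \<Rightarrow> nat) \<Rightarrow> rat) \<Rightarrow> bool" where
  "is_directional_mm R \<mm> J M j c \<longleftrightarrow>
     (let D = the_enat (module_dim R M);
          E = {d. 1 \<le> vsize d \<and> vsize d \<le> D \<and> d j > 0}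
      in (\<forall>d. d \<notin> E \<longrightarrow> c d = 0) \<and>
         (\<exists>p. eventually_poly (hilbert_fun R \<mm> J M (basis_vec j)) (D - 1) p \<and>
           (\<forall>r u. hom_component p (D - 1) r u =
             (\<Sum>d\<in>E. c d / (fact (D - vsize d) * fact (d j - 1) * (\<Prod>l\<in>UNIV - {j}. fact (d l)))
                * of_nat r ^ (D - vsize d) * of_nat (u j) ^ (d j - 1)
                * (\<Prod>l\<in>UNIV - {j}. of_nat (u l) ^ d l)))))"

definition directional_mm ::
    "('a, 'r) ring_scheme \<Rightarrow> 'a set \<Rightarrow> ('s::finite \<Rightarrow> 'a set) \<Rightarrow> ('a, 'b, 'm) module_scheme
      \<Rightarrow> 's \<Rightarrow> ('s \<Rightarrow> nat) \<Rightarrow> rat" where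
  "directional_mm R \<mm> J M j = (THE c. is_directional_mm R \<mm> J M j c)"

definition is_diagonal_mm ::
    "('a, 'r) ring_scheme \<Rightarrow> 'a set \<Rightarrow> ('s::finite \<Rightarrow> 'a set) \<Rightarrow> ('a, 'b, 'm) module_scheme
      \<Rightarrow> (nat \<Rightarrow> ('s \<Rightarrow> nat) \<Rightarrow> rat) \<Rightarrow> bool" where
  "is_diagonal_mm R \<mm> J M c \<longleftrightarrow>
     (let D = the_enat (module_dim R M)
      in (\<forall>i \<alpha>. \<not> (1 \<le> i \<and> i \<le> D \<and> vsize \<alpha> = i - 1) \<longrightarrow> c i \<alpha> = 0) \<and>
         (\<exists>p. eventually_poly (hilbert_fun R \<mm> J M (\<lambda>_. 1)) (D - 1) p \<and>
           (\<forall>r u. hom_component p (D - 1) r u =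
             (\<Sum>i=1..D. \<Sum>\<alpha>\<in>{\<alpha>. vsize \<alpha> = i - 1}.
                c i \<alpha> / (fact (D - i) * (\<Prod>l\<in>UNIV. fact (\<alpha> l)))
                * of_nat r ^ (D - i) * (\<Prod>l\<in>UNIV. of_nat (u l) ^ \<alpha> l)))))"

definition diagonal_mm ::
    "('a, 'r) ring_scheme \<Rightarrow> 'a set \<Rightarrow> ('s::finite \<Rightarrow> 'a set) \<Rightarrow> ('a, 'b, 'm) module_scheme
      \<Rightarrow> nat \<Rightarrow> ('s \<Rightarrow> nat) \<Rightarrow> rat" where
  "diagonal_mm R \<mm> J M = (THE c. is_diagonal_mm R \<mm> J M c)"

end

theory Submission
  imports Defs "HOL-Computational_Algebra.Polynomial" "HOL-Library.Fun_Lexorder"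
begin

text \<open>For a shift vector \<open>v\<close> let \<open>H\<^sub>v(r, u)\<close> be the length of
\<open>J\<^sup>u M / (\<mm>\<^sup>r\<^sup>+\<^sup>1 J\<^sup>u M + J\<^sup>u\<^sup>+\<^sup>v M)\<close>. The directional functions are those with \<open>v\<close> a unit vector, and the
diagonal one has \<open>v\<close> equal to the sum of all unit vectors, so it is enough to see that the leading
form of \<open>H\<^sub>v\<close> is additive in \<open>v\<close>. Inserting \<open>J\<^sup>u\<^sup>+\<^sup>v M\<close> between \<open>J\<^sup>u M\<close> and \<open>J\<^sup>u\<^sup>+\<^sup>v\<^sup>+\<^sup>v' M\<close> splits \<open>H\<^sub>v\<^sub>+\<^sub>v'(r, u)\<close> into
\<open>H\<^sub>v(r, u)\<close> and the length of the quotient of \<open>J\<^sup>u\<^sup>+\<^sup>v M\<close> by the sum of \<open>J\<^sup>u\<^sup>+\<^sup>v\<^sup>+\<^sup>v' M\<close> and the submodule which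
\<open>\<mm>\<^sup>r\<^sup>+\<^sup>1 J\<^sup>u M\<close> induces on it.
By a form of the Artin-Rees lemma (\<open>artin_rees\<close>) this induced filtration differs from the
\<open>\<mm>\<close>-adic one by a shift \<open>c\<close> independent of \<open>u\<close>, so the second piece lies between \<open>H\<^sub>v'(r - c, u + v)\<close>
and \<open>H\<^sub>v'(r, u + v)\<close> (\<open>hilb_two_step\<close>). Translating the arguments of a polynomial does not change
its leading form, hence leading forms add (\<open>leading_form_add\<close>, \<open>leading_form_sum\<close>), and comparing
coefficients gives the formula.

The multiplicities are defined by description, so the formula also rests on their existence: every
\<open>H\<^sub>v\<close> has to agree with a polynomial of degree at most \<open>D - 1\<close>.

Polynomiality comes from a lexicographic filtration. Fix generators of \<open>\<mm>\<close> and of the ideals \<open>J\<^sub>l\<close>,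
and filter \<open>\<mm>\<^sup>k J\<^sup>u M\<close> by the monomials in these generators. The successive quotients have the form
\<open>M / Q\<^sub>\<beta>\<close>, where \<open>\<beta>\<close> runs over the exponents of multidegree \<open>(k, u)\<close> and \<open>Q\<^sub>\<beta>\<close> grows when \<open>\<beta>\<close> grows
(\<open>interval_length_lex_filtration\<close>). So \<open>H\<^sub>v\<close> is a sum of an antitone function with values in the
natural numbers over all exponents of a given multidegree. Such a function depends only on the
exponents truncated at a fixed bound (\<open>monotone_determined_by_cap\<close>), and then the sum is eventually
a polynomial (\<open>antitone_monomial_sum_separable\<close>). Applied to the leading coefficient modules of a
family of submodules, the same filtration yields Artin-Rees: the family is generated in bounded
degree (\<open>stable_generated_in_bounded_degree\<close>).

For the degree, prime avoidance and induction on the dimension bound the length of \<open>M / \<mm>\<^sup>k M\<close> by a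
multiple of \<open>(k + 1)\<^sup>D\<close> (\<open>length_growth_le_dimension\<close>). Iterating Artin-Rees from \<open>M\<close> down to \<open>J\<^sup>u M\<close>
one unit vector at a time costs a shift linear in \<open>u\<close>; therefore the length \<open>F(r, u)\<close> of
\<open>J\<^sup>u M / \<mm>\<^sup>r\<^sup>+\<^sup>1 J\<^sup>u M\<close> is bounded by a multiple of \<open>(r + 2 + c |u|)\<^sup>D\<close> and is eventually a polynomial of
degree at most \<open>D\<close> (\<open>hilb0_eventually_poly\<close>). Finally \<open>H\<^sub>v(r, u)\<close> lies between
\<open>F(r, u) - F(r, u + v)\<close> and \<open>F(r, u) - F(r - c, u + v)\<close> (\<open>hilb_sandwich\<close>), two differences in which the
forms of degree \<open>D\<close> cancel.

Polynomials in \<open>(r, u)\<close> are compared along rays: substituting \<open>(n r - c, n u + v)\<close> gives a polynomial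
in \<open>n\<close> whose coefficient at the top degree is the leading form at \<open>(r, u)\<close>, whatever \<open>c\<close> and \<open>v\<close> are.\<close>

section \<open>Monomial sums of antitone functions\<close>

text \<open>Exponent vectors in \<open>n\<close> variables are functions vanishing from \<open>n\<close> on. Adding a variable is then
a function update, and all numbers of variables share one type.\<close>

definition monomials :: "nat \<Rightarrow> (nat \<Rightarrow> nat) set" where
  "monomials n = {\<beta>. \<forall>i\<ge>n. \<beta> i = 0}"

text \<open>Variable \<open>i\<close> has as its degree the unit vector in direction \<open>dir i\<close>.\<close>

definition mdeg :: "(nat \<Rightarrow> 't) \<Rightarrow> nat \<Rightarrow> (nat \<Rightarrow> nat) \<Rightarrow> 't \<Rightarrow> nat" where
  "mdeg dir n \<beta> d = (\<Sum>i | i < n \<and> dir i = d. \<beta> i)"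

lemma monomials_0: "monomials 0 = {\<lambda>_. 0}"
  by (auto simp: monomials_def)

lemma monomials_Suc_upd: "\<beta> \<in> monomials n \<Longrightarrow> \<beta>(n := t) \<in> monomials (Suc n)"
  by (auto simp: monomials_def)

lemma monomials_Suc_restrict: "\<beta> \<in> monomials (Suc n) \<Longrightarrow> \<beta>(n := 0) \<in> monomials n"
  unfolding monomials_def by (simp add: Suc_le_eq)

lemma monomials_le: "\<beta> \<in> monomials n \<Longrightarrow> (\<And>i. \<gamma> i \<le> \<beta> i) \<Longrightarrow> \<gamma> \<in> monomials n"
  by (auto simp: monomials_def) (metis le_zero_eq)

lemma monomials_add: "\<beta> \<in> monomials n \<Longrightarrow> \<gamma> \<in> monomials n \<Longrightarrow> (\<lambda>i. \<beta> i + \<gamma> i) \<in> monomials n"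
  by (auto simp: monomials_def)

lemma mdeg_add: "mdeg dir n (\<lambda>i. \<beta> i + \<gamma> i) d = mdeg dir n \<beta> d + mdeg dir n \<gamma> d"
  by (simp add: mdeg_def sum.distrib)

lemma mdeg_zero [simp]: "mdeg dir n (\<lambda>_. 0) = (\<lambda>_. 0)"
  by (simp add: mdeg_def fun_eq_iff)

lemma finite_bounded_monomials: "finite {\<beta> \<in> monomials n. \<forall>i<n. \<beta> i \<le> b i}"
proof (rule finite_subset)
  show "{\<beta> \<in> monomials n. \<forall>i<n. \<beta> i \<le> b i} \<subseteq> (\<lambda>g i. if i < n then g i else 0) ` (PiE {..<n} (\<lambda>i. {..b i}))"
  proof
    fix \<beta> assume "\<beta> \<in> {\<beta> \<in> monomials n. \<forall>i<n. \<beta> i \<le> b i}"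
    hence "\<beta> = (\<lambda>i. if i < n then restrict \<beta> {..<n} i else 0)" "restrict \<beta> {..<n} \<in> PiE {..<n} (\<lambda>i. {..b i})"
      by (auto simp: monomials_def fun_eq_iff)
    thus "\<beta> \<in> (\<lambda>g i. if i < n then g i else 0) ` (PiE {..<n} (\<lambda>i. {..b i}))" by blast
  qed
  show "finite ((\<lambda>g i. if i < n then g i else (0::nat)) ` (PiE {..<n} (\<lambda>i. {..b i})))"
    by (intro finite_imageI finite_PiE) auto
qed

lemma le_mdeg: "i < n \<Longrightarrow> \<beta> i \<le> mdeg dir n \<beta> (dir i)"
  unfolding mdeg_def by (rule member_le_sum) auto

lemma finite_monomials_mdeg: "finite {\<beta> \<in> monomials n. mdeg dir n \<beta> = w}"
  by (rule finite_subset[OF _ finite_bounded_monomials[of n "\<lambda>i. w (dir i)"]]) (use le_mdeg in fastforce)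

lemma mdeg_Suc:
  assumes "\<beta> \<in> monomials n"
  shows "mdeg dir (Suc n) (\<beta>(n := t)) = (mdeg dir n \<beta>)(dir n := mdeg dir n \<beta> (dir n) + t)"
proof
  fix d
  have "{i. i < Suc n \<and> dir i = d} = {i. i < n \<and> dir i = d} \<union> (if dir n = d then {n} else {})"
    by (auto simp: less_Suc_eq)
  hence "mdeg dir (Suc n) (\<beta>(n := t)) d
      = (\<Sum>i | i < n \<and> dir i = d. (\<beta>(n := t)) i) + (if dir n = d then t else 0)"
    unfolding mdeg_def by (simp add: sum.union_disjoint)
  also have "(\<Sum>i | i < n \<and> dir i = d. (\<beta>(n := t)) i) = mdeg dir n \<beta> d"
    unfolding mdeg_def by (rule sum.cong) auto
  finally show "mdeg dir (Suc n) (\<beta>(n := t)) d = ((mdeg dir n \<beta>)(dir n := mdeg dir n \<beta> (dir n) + t)) d"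
    by (simp del: fun_upd_apply) (simp add: fun_upd_def)
qed

lemma wf_mono_stabilizes:
  assumes "wf r" and "\<And>s t. s \<le> t \<Longrightarrow> g s = g t \<or> (g t, g s) \<in> r"
  shows "\<exists>T::nat. \<forall>t\<ge>T. g t = g T"
proof -
  obtain z where z: "z \<in> range g" "\<And>y. (y, z) \<in> r \<Longrightarrow> y \<notin> range g"
    using wfE_min[OF assms(1), of "g 0" "range g"] by auto
  then obtain T where "z = g T" by auto
  with z(2) assms(2) show ?thesis by (metis rangeI)
qed

text \<open>This plays the role of Dickson's lemma: a monotone function from \<open>\<nat>\<^sup>n\<close> into an order with the
ascending chain condition only sees exponents truncated at some bound. By induction on \<open>n\<close>, the
limit in the last coordinate has a bound; only finitely many truncated points matter for the
speed of convergence to that limit, and the remaining finitely many slices have bounds of their own.\<close>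

lemma monotone_determined_by_cap:
  fixes f :: "(nat \<Rightarrow> nat) \<Rightarrow> 'x"
  assumes "wf r" and "\<And>\<beta> \<gamma>. (\<And>i. \<beta> i \<le> \<gamma> i) \<Longrightarrow> f \<beta> = f \<gamma> \<or> (f \<gamma>, f \<beta>) \<in> r"
  shows "\<exists>N. \<forall>\<beta>\<in>monomials n. \<forall>N'\<ge>N. f \<beta> = f (\<lambda>i. min (\<beta> i) N')"
  using assms(2)
proof (induction n arbitrary: f)
  case 0
  then show ?case by (auto simp: monomials_0)
next
  case (Suc n)
  have mono: "f \<beta> = f \<gamma> \<or> (f \<gamma>, f \<beta>) \<in> r" if "\<And>i. \<beta> i \<le> \<gamma> i" for \<beta> \<gamma>
    using Suc.prems that by blast
  have squeeze: "f y = f x" if "\<And>i. x i \<le> y i" "\<And>i. y i \<le> z i" "f x = f z" for x y z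
    using mono[of x y] mono[of y z] that wf_asym[OF assms(1)] by metis
  have "\<exists>T. \<forall>t\<ge>T. f (\<beta>(n := t)) = f (\<beta>(n := T))" for \<beta>
    by (rule wf_mono_stabilizes[OF assms(1)], rule mono) auto
  then obtain T where T: "\<And>\<beta> t. t \<ge> T \<beta> \<Longrightarrow> f (\<beta>(n := t)) = f (\<beta>(n := T \<beta>))" by metis
  \<comment> \<open>the limit of \<open>f\<close> in the last coordinate\<close>
  define F where "F \<beta> = f (\<beta>(n := T \<beta>))" for \<beta>
  have "F \<beta> = F \<gamma> \<or> (F \<gamma>, F \<beta>) \<in> r" if "\<And>i. \<beta> i \<le> \<gamma> i" for \<beta> \<gamma>
  proof -
    let ?t = "max (T \<beta>) (T \<gamma>)"
    have "F \<beta> = f (\<beta>(n := ?t))" "F \<gamma> = f (\<gamma>(n := ?t))"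
      unfolding F_def using T[of \<beta> ?t] T[of \<gamma> ?t] by auto
    thus ?thesis using mono[of "\<beta>(n := ?t)" "\<gamma>(n := ?t)"] that by auto
  qed
  from Suc.IH[of F, OF this] obtain N1 where
    N1: "\<And>\<beta> N'. \<beta> \<in> monomials n \<Longrightarrow> N' \<ge> N1 \<Longrightarrow> F \<beta> = F (\<lambda>i. min (\<beta> i) N')" by auto
  define S where "S = {\<beta> \<in> monomials n. \<forall>i<n. \<beta> i \<le> N1}"
  have finS: "finite S" unfolding S_def by (rule finite_bounded_monomials)
  define T0 where "T0 = Max (insert 0 (T ` S))"
  have T0: "T \<beta> \<le> T0" if "\<beta> \<in> S" for \<beta> unfolding T0_def using finS that by auto
  have "\<exists>N. \<forall>\<beta>\<in>monomials n. \<forall>N'\<ge>N. f (\<beta>(n := t)) = f ((\<lambda>i. min (\<beta> i) N')(n := t))" for t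
    by (rule Suc.IH[of "\<lambda>\<beta>. f (\<beta>(n := t))"], rule mono) auto
  then obtain Nt where Nt: "\<And>t \<beta> N'. \<beta> \<in> monomials n \<Longrightarrow> N' \<ge> Nt t \<Longrightarrow>
      f (\<beta>(n := t)) = f ((\<lambda>i. min (\<beta> i) N')(n := t))" by metis
  define N where "N = max N1 (max T0 (Max (insert 0 (Nt ` {..<T0}))))"
  \<comment> \<open>For \<open>t \<ge> T0\<close> the point lies between two points at which \<open>f\<close> has its limiting value.\<close>
  have large: "f (\<beta>(n := t)) = F (\<lambda>i. min (\<beta> i) N1)" if "\<beta> \<in> monomials n" "t \<ge> T0" for \<beta> t
  proof -
    let ?c = "\<lambda>i. min (\<beta> i) N1"
    have "?c \<in> S" using that monomials_le[of \<beta> n ?c] by (auto simp: S_def)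
    hence "f (?c(n := t)) = F ?c" unfolding F_def using T[of ?c t] T0[of ?c] that by auto
    moreover have "F ?c = f (\<beta>(n := max t (T \<beta>)))"
      using N1[OF that(1), of N1] T[of \<beta> "max t (T \<beta>)"] by (simp add: F_def)
    ultimately have "f (\<beta>(n := t)) = f (?c(n := t))"
      by (intro squeeze[of "?c(n := t)" "\<beta>(n := t)" "\<beta>(n := max t (T \<beta>))"]) simp_all
    thus ?thesis using \<open>f (?c(n := t)) = F ?c\<close> by simp
  qed
  show ?case
  proof (rule exI[of _ N], intro ballI allI impI)
    fix \<beta> N' assume "\<beta> \<in> monomials (Suc n)" and N': "N \<le> N'"
    define \<beta>' where "\<beta>' = \<beta>(n := 0)"
    define t where "t = \<beta> n"
    have \<beta>: "\<beta> = \<beta>'(n := t)" "\<beta>' \<in> monomials n"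
      unfolding \<beta>'_def t_def using monomials_Suc_restrict[OF \<open>\<beta> \<in> monomials (Suc n)\<close>] by simp_all
    have cap: "(\<lambda>i. min (\<beta> i) N') = (\<lambda>i. min (\<beta>' i) N')(n := min t N')"
      by (auto simp: \<beta>(1))
    have capm: "(\<lambda>i. min (\<beta>' i) N') \<in> monomials n" by (rule monomials_le[OF \<beta>(2)]) auto
    show "f \<beta> = f (\<lambda>i. min (\<beta> i) N')"
    proof (cases "t < T0")
      case True
      hence "Nt t \<le> N" unfolding N_def by (auto simp: le_max_iff_disj)
      moreover have "min t N' = t" using True N' unfolding N_def by auto
      ultimately show ?thesis unfolding cap using Nt[OF \<beta>(2), of t N'] N' \<beta>(1) by simp
    next
      case False
      have "min t N' \<ge> T0" using False N' unfolding N_def by auto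
      moreover have "(\<lambda>i. min (min (\<beta>' i) N') N1) = (\<lambda>i. min (\<beta>' i) N1)"
        using N' unfolding N_def by (auto simp: fun_eq_iff)
      ultimately show ?thesis
        unfolding cap using large[OF capm, of "min t N'"] large[OF \<beta>(2), of t] False \<beta>(1) by simp
    qed
  qed
qed

definition eventually_poly1 :: "(nat \<Rightarrow> rat) \<Rightarrow> bool" where
  "eventually_poly1 \<phi> \<longleftrightarrow> (\<exists>q N. \<forall>x\<ge>N. \<phi> x = poly q (of_nat x))"

lemma eventually_poly1I: "(\<And>x. x \<ge> N \<Longrightarrow> \<phi> x = poly q (of_nat x)) \<Longrightarrow> eventually_poly1 \<phi>"
  unfolding eventually_poly1_def by blast

text \<open>Summing \<open>(t + 1)\<^sup>k\<^sup>+\<^sup>1 - t\<^sup>k\<^sup>+\<^sup>1\<close> telescopes, and the binomial theorem expresses the \<open>k\<close>-th power sum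
by \<open>x\<^sup>k\<^sup>+\<^sup>1\<close> and the lower power sums.\<close>

lemma sum_power_poly: "\<exists>q. \<forall>x. (\<Sum>t<x. (of_nat t :: rat) ^ k) = poly q (of_nat x)"
proof (induction k rule: less_induct)
  case (less k)
  then obtain q where q: "\<And>i x. i < k \<Longrightarrow> (\<Sum>t<x. (of_nat t :: rat) ^ i) = poly (q i) (of_nat x)" by metis
  show ?case
  proof (rule exI[of _ "smult (1 / of_nat (Suc k)) (monom 1 (Suc k) - (\<Sum>i<k. smult (of_nat (Suc k choose i)) (q i)))"], rule allI)
    fix x
    have "(of_nat x :: rat) ^ Suc k = (\<Sum>t<x. of_nat (Suc t) ^ Suc k - of_nat t ^ Suc k)"
      by (subst sum_lessThan_telescope) simp
    also have "\<dots> = (\<Sum>t<x. \<Sum>i\<le>k. of_nat (Suc k choose i) * of_nat t ^ i)"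
    proof (rule sum.cong)
      fix t
      have "(of_nat (Suc t) :: rat) ^ Suc k = (\<Sum>i\<le>Suc k. of_nat (Suc k choose i) * of_nat t ^ i)"
        using binomial_ring[of "of_nat t :: rat" 1 "Suc k"] by (simp add: add.commute)
      thus "(of_nat (Suc t) :: rat) ^ Suc k - of_nat t ^ Suc k = (\<Sum>i\<le>k. of_nat (Suc k choose i) * of_nat t ^ i)"
        by (simp only: sum.atMost_Suc) simp
    qed simp
    also have "\<dots> = (\<Sum>i\<le>k. of_nat (Suc k choose i) * (\<Sum>t<x. of_nat t ^ i))"
      by (subst sum.swap) (simp add: sum_distrib_left)
    also have "{..k} = insert k {..<k}" by auto
    also have "(\<Sum>i\<in>insert k {..<k}. of_nat (Suc k choose i) * (\<Sum>t<x. (of_nat t :: rat) ^ i))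
      = of_nat (Suc k) * (\<Sum>t<x. of_nat t ^ k) + (\<Sum>i<k. of_nat (Suc k choose i) * poly (q i) (of_nat x))"
      by (subst sum.insert) (auto simp: q)
    finally have *: "(of_nat x :: rat) ^ Suc k = \<dots>" .
    show "(\<Sum>t<x. (of_nat t :: rat) ^ k) = poly (smult (1 / of_nat (Suc k)) (monom 1 (Suc k) - (\<Sum>i<k. smult (of_nat (Suc k choose i)) (q i)))) (of_nat x)"
      using * by (simp add: poly_sum poly_monom field_simps del: of_nat_Suc power_Suc)
  qed
qed

lemma sum_poly_poly: "\<exists>p. \<forall>x. (\<Sum>t<x. poly q (of_nat t :: rat)) = poly p (of_nat x)"
proof -
  obtain s where s: "\<And>k x. (\<Sum>t<x. (of_nat t :: rat) ^ k) = poly (s k) (of_nat x)"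
    using sum_power_poly by metis
  have "(\<Sum>t<x. poly q (of_nat t :: rat)) = poly (\<Sum>i\<le>degree q. smult (coeff q i) (s i)) (of_nat x)" for x
    unfolding poly_altdef[of q] by (subst sum.swap) (simp add: poly_sum sum_distrib_left[symmetric] s)
  thus ?thesis by blast
qed

lemma eventually_poly1_sum:
  assumes "eventually_poly1 \<phi>"
  shows "eventually_poly1 (\<lambda>x. \<Sum>t\<le>x. \<phi> t)"
proof -
  obtain q N where q: "\<And>x. x \<ge> N \<Longrightarrow> \<phi> x = poly q (of_nat x)"
    using assms unfolding eventually_poly1_def by blast
  obtain p where p: "\<And>x. (\<Sum>t<x. poly q (of_nat t :: rat)) = poly p (of_nat x)"
    using sum_poly_poly by blast
  define c where "c = (\<Sum>t<N. \<phi> t - poly q (of_nat t))"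
  have "(\<Sum>t\<le>x. \<phi> t) = poly (p \<circ>\<^sub>p [:1, 1:] + [:c:]) (of_nat x)" if "x \<ge> N" for x
  proof -
    have "(\<Sum>t\<le>x. \<phi> t) - (\<Sum>t\<le>x. poly q (of_nat t)) = (\<Sum>t\<le>x. \<phi> t - poly q (of_nat t))"
      by (simp add: sum_subtractf)
    also have "\<dots> = c" unfolding c_def
      by (rule sum.mono_neutral_right) (use that q in auto)
    also have "(\<Sum>t\<le>x. poly q (of_nat t)) = poly p (of_nat (Suc x))"
      using p[of "Suc x"] by (simp add: lessThan_Suc_atMost)
    finally show ?thesis by (simp add: poly_pcompose algebra_simps)
  qed
  thus ?thesis by (rule eventually_poly1I)
qed

lemma eventually_poly1_shift:
  assumes "eventually_poly1 \<phi>"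
  shows "eventually_poly1 (\<lambda>x. if x < t then 0 else \<phi> (x - t))"
proof -
  obtain q N where q: "\<And>x. x \<ge> N \<Longrightarrow> \<phi> x = poly q (of_nat x)"
    using assms unfolding eventually_poly1_def by blast
  show ?thesis
    by (rule eventually_poly1I[of "N + t" _ "q \<circ>\<^sub>p [:- of_nat t, 1:]"])
       (auto simp: q poly_pcompose of_nat_diff)
qed

text \<open>Being eventually a polynomial in all variables jointly is not inherited by sums over one variable
that start at 0, since the values at small arguments enter. The sums of products of univariate
eventually polynomial functions form a smaller class which is closed under such sums.\<close>

inductive separable :: "(('t::finite \<Rightarrow> nat) \<Rightarrow> rat) \<Rightarrow> bool" where
  separable_prod: "(\<And>d. eventually_poly1 (\<phi> d)) \<Longrightarrow> separable (\<lambda>w. \<Prod>d\<in>UNIV. \<phi> d (w d))"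
| separable_add: "separable g \<Longrightarrow> separable h \<Longrightarrow> separable (\<lambda>w. g w + h w)"

lemma prod_upd:
  fixes \<phi> :: "'t::finite \<Rightarrow> nat \<Rightarrow> rat"
  shows "(\<Prod>e\<in>UNIV. \<phi> e ((w(d := x)) e)) = \<phi> d x * (\<Prod>e\<in>UNIV - {d}. \<phi> e (w e))"
  by (subst prod.remove[of UNIV d]) (auto intro!: prod.cong)

lemma prod_upd_fun:
  fixes \<phi> :: "'t::finite \<Rightarrow> nat \<Rightarrow> rat"
  shows "(\<Prod>e\<in>UNIV. (\<phi>(d := \<psi>)) e (w e)) = \<psi> (w d) * (\<Prod>e\<in>UNIV - {d}. \<phi> e (w e))"
  by (subst prod.remove[of UNIV d]) (auto intro!: prod.cong)

lemma separable_zero: "separable (\<lambda>_ :: 't::finite \<Rightarrow> nat. 0)"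
proof -
  have "separable (\<lambda>w :: 't \<Rightarrow> nat. \<Prod>d\<in>UNIV. (\<lambda>_ _. 0) d (w d))"
    by (rule separable_prod) (rule eventually_poly1I[of 0 _ 0], simp)
  thus ?thesis by (simp add: zero_power card_gt_0_iff)
qed

lemma separable_shift:
  "separable h \<Longrightarrow> separable (\<lambda>w. if w d < t then 0 else h (w(d := w d - t)))"
proof (induction rule: separable.induct)
  case (separable_prod \<phi>)
  have "separable (\<lambda>w. \<Prod>e\<in>UNIV. (\<phi>(d := (\<lambda>x. if x < t then 0 else \<phi> d (x - t)))) e (w e))"
    by (rule separable.separable_prod) (use separable_prod eventually_poly1_shift in auto)
  moreover have "(\<lambda>w. \<Prod>e\<in>UNIV. (\<phi>(d := (\<lambda>x. if x < t then 0 else \<phi> d (x - t)))) e (w e))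
     = (\<lambda>w. if w d < t then 0 else (\<Prod>e\<in>UNIV. \<phi> e ((w(d := w d - t)) e)))"
    unfolding prod_upd_fun prod_upd by auto
  ultimately show ?case by simp
next
  case (separable_add g h)
  have "(\<lambda>w. if w d < t then 0 else g (w(d := w d - t)) + h (w(d := w d - t))) =
    (\<lambda>w. (if w d < t then 0 else g (w(d := w d - t))) + (if w d < t then 0 else h (w(d := w d - t))))"
    by auto
  thus ?case using separable.separable_add[OF separable_add.IH] by simp
qed

lemma separable_sum:
  "separable h \<Longrightarrow> separable (\<lambda>w. \<Sum>t\<le>w d. h (w(d := w d - t)))"
proof (induction rule: separable.induct)
  case (separable_prod \<phi>)
  have "separable (\<lambda>w. \<Prod>e\<in>UNIV. (\<phi>(d := (\<lambda>x. \<Sum>t\<le>x. \<phi> d t))) e (w e))"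
    by (rule separable.separable_prod) (use separable_prod eventually_poly1_sum in auto)
  moreover have "(\<Sum>t\<le>x. \<phi> d (x - t)) = (\<Sum>t\<le>x. \<phi> d t)" for x
    using sum.atLeastAtMost_rev[of "\<phi> d" 0 x] by (simp add: atLeast0AtMost)
  ultimately show ?case
    unfolding prod_upd_fun prod_upd sum_distrib_right[symmetric] by simp
next
  case (separable_add g h)
  show ?case using separable.separable_add[OF separable_add.IH] by (simp add: sum.distrib)
qed

lemma separable_finite_sum:
  "finite A \<Longrightarrow> (\<And>a. a \<in> A \<Longrightarrow> separable (h a)) \<Longrightarrow> separable (\<lambda>w. \<Sum>a\<in>A. h a w)"
  by (induction A rule: finite_induct) (auto intro: separable_zero separable_add)

definition monomial_sum :: "(nat \<Rightarrow> 't) \<Rightarrow> nat \<Rightarrow> ((nat \<Rightarrow> nat) \<Rightarrow> nat) \<Rightarrow> ('t \<Rightarrow> nat) \<Rightarrow> nat" where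
  "monomial_sum dir n \<l> w = (\<Sum>\<beta> | \<beta> \<in> monomials n \<and> mdeg dir n \<beta> = w. \<l> \<beta>)"

text \<open>Split off the exponent \<open>t\<close> of the last variable.\<close>

lemma monomial_sum_Suc:
  "monomial_sum dir (Suc n) \<l> w =
     (\<Sum>t\<le>w (dir n). monomial_sum dir n (\<lambda>\<beta>. \<l> (\<beta>(n := t))) (w(dir n := w (dir n) - t)))"
proof -
  let ?d = "dir n"
  let ?B = "\<lambda>t. {\<beta>. \<beta> \<in> monomials n \<and> mdeg dir n \<beta> = w(?d := w ?d - t)}"
  let ?S = "Sigma {..w ?d} ?B"
  have fin: "\<forall>t\<in>{..w ?d}. finite (?B t)"
    using finite_monomials_mdeg[of n dir] by auto
  have "(\<Sum>t\<le>w ?d. monomial_sum dir n (\<lambda>\<beta>. \<l> (\<beta>(n := t))) (w(?d := w ?d - t)))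
      = (\<Sum>(t, \<beta>)\<in>?S. \<l> (\<beta>(n := t)))"
    unfolding monomial_sum_def by (subst sum.Sigma) (use fin in auto)
  also have "\<dots> = (\<Sum>\<beta> | \<beta> \<in> monomials (Suc n) \<and> mdeg dir (Suc n) \<beta> = w. \<l> \<beta>)"
  proof (rule sum.reindex_bij_witness[of _ "\<lambda>\<beta>. (\<beta> n, \<beta>(n := 0))" "\<lambda>(t, \<beta>). \<beta>(n := t)"])
    fix \<beta> assume "\<beta> \<in> {\<beta>. \<beta> \<in> monomials (Suc n) \<and> mdeg dir (Suc n) \<beta> = w}"
    hence \<beta>: "\<beta> \<in> monomials (Suc n)" "mdeg dir (Suc n) \<beta> = w" by auto
    have m: "\<beta>(n := 0) \<in> monomials n"
      by (rule monomials_Suc_restrict[OF \<beta>(1)])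
    have "mdeg dir (Suc n) ((\<beta>(n := 0))(n := \<beta> n)) = w" using \<beta>(2) by simp
    hence w: "(mdeg dir n (\<beta>(n := 0)))(?d := mdeg dir n (\<beta>(n := 0)) ?d + \<beta> n) = w"
      by (simp only: mdeg_Suc[OF m])
    show "(\<beta> n, \<beta>(n := 0)) \<in> ?S" using m w by auto
  qed (auto simp: monomials_Suc_upd mdeg_Suc monomials_def fun_eq_iff)
  finally show ?thesis unfolding monomial_sum_def by simp
qed

text \<open>By induction on the number of variables. The slices at the values \<open>t\<close> of the last exponent become
independent of \<open>t\<close>, so the sum over \<open>t\<close> consists of finitely many shifted slices and one summation of
the limiting slice, and separable functions are closed under both.\<close>

theorem antitone_monomial_sum_separable:
  fixes dir :: "nat \<Rightarrow> 't::finite"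
  assumes "\<And>\<beta> \<gamma>. (\<And>i. \<beta> i \<le> \<gamma> i) \<Longrightarrow> \<l> \<gamma> \<le> \<l> \<beta>"
  shows "separable (\<lambda>w. of_nat (monomial_sum dir n \<l> w))"
  using assms
proof (induction n arbitrary: \<l>)
  case 0
  have "of_nat (monomial_sum dir 0 \<l> w)
      = (\<Prod>d\<in>UNIV. if w d = 0 then 1 else (0::rat)) * of_nat (\<l> (\<lambda>_. 0))" for w
  proof (cases "w = (\<lambda>_. 0)")
    case True
    thus ?thesis by (simp add: monomial_sum_def monomials_0 Collect_conv_if)
  next
    case False
    then obtain d where "w d \<noteq> 0" by auto
    hence "(\<Prod>d\<in>UNIV. if w d = 0 then 1 else (0::rat)) = 0" by (intro prod_zero) auto
    moreover have "{\<beta>. \<beta> \<in> {\<lambda>_. 0::nat} \<and> mdeg dir 0 \<beta> = w} = {}" using False by auto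
    ultimately show ?thesis unfolding monomial_sum_def monomials_0 by (metis (lifting) mult_zero_left of_nat_0 singleton_iff sum.empty)
  qed
  moreover have "separable (\<lambda>w :: 't \<Rightarrow> nat. (\<Prod>d\<in>UNIV. if w d = 0 then 1 else (0::rat)))"
    by (rule separable_prod[of "\<lambda>_ x. if x = 0 then 1 else 0"], rule eventually_poly1I[of 1 _ 0]) auto
  hence "separable (\<lambda>w :: 't \<Rightarrow> nat. \<Sum>i<\<l> (\<lambda>_. 0). (\<Prod>d\<in>UNIV. if w d = 0 then 1 else (0::rat)))"
    by (intro separable_finite_sum) auto
  ultimately show ?case by (simp add: mult.commute)
next
  case (Suc n)
  let ?d = "dir n"
  have "\<exists>N. \<forall>\<beta>\<in>monomials (Suc n). \<forall>N'\<ge>N. \<l> \<beta> = \<l> (\<lambda>i. min (\<beta> i) N')"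
    by (rule monotone_determined_by_cap[of less_than]) (use Suc.prems in \<open>auto simp: order.strict_iff_order\<close>)
  then obtain N where N: "\<And>\<beta> N'. \<beta> \<in> monomials (Suc n) \<Longrightarrow> N' \<ge> N \<Longrightarrow> \<l> \<beta> = \<l> (\<lambda>i. min (\<beta> i) N')" by blast
  define h :: "nat \<Rightarrow> ('t \<Rightarrow> nat) \<Rightarrow> rat" where
    "h t w = of_nat (monomial_sum dir n (\<lambda>\<beta>. \<l> (\<beta>(n := t))) w)" for t w
  have h: "separable (h t)" for t
    unfolding h_def by (rule Suc.IH) (auto intro!: Suc.prems)
  \<comment> \<open>the limiting slice\<close>
  have hN: "h t = h N" if "t \<ge> N" for t
  proof -
    have "\<l> (\<beta>(n := t)) = \<l> (\<beta>(n := N))" if "\<beta> \<in> monomials n" for \<beta>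
    proof -
      have "(\<lambda>i. min ((\<beta>(n := t)) i) N) = (\<lambda>i. min ((\<beta>(n := N)) i) N)" using \<open>t \<ge> N\<close> by auto
      thus ?thesis using N[of "\<beta>(n := t)" N] N[of "\<beta>(n := N)" N] monomials_Suc_upd[OF that] by simp
    qed
    thus ?thesis unfolding h_def monomial_sum_def by (intro ext arg_cong[of _ _ of_nat] sum.cong) auto
  qed
  have "of_nat (monomial_sum dir (Suc n) \<l> w) =
      (\<Sum>t<N. if w ?d < t then 0 else h t (w(?d := w ?d - t)))
     + (if w ?d < N then 0 else (\<lambda>w. \<Sum>t\<le>w ?d. h N (w(?d := w ?d - t))) (w(?d := w ?d - N)))" for w
  proof -
    have s: "of_nat (monomial_sum dir (Suc n) \<l> w) = (\<Sum>t\<le>w ?d. h t (w(?d := w ?d - t)))"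
      unfolding monomial_sum_Suc h_def by simp
    show ?thesis
    proof (cases "w ?d < N")
      case True
      have "(\<Sum>t<N. if w ?d < t then 0 else h t (w(?d := w ?d - t)))
        = (\<Sum>t\<le>w ?d. if w ?d < t then 0 else h t (w(?d := w ?d - t)))"
        by (rule sum.mono_neutral_right) (use True in auto)
      also have "\<dots> = (\<Sum>t\<le>w ?d. h t (w(?d := w ?d - t)))" by (rule sum.cong) auto
      finally show ?thesis using True s by simp
    next
      case False
      have split: "{..w ?d} = {..<N} \<union> {N..w ?d}" using False by auto
      have "(\<Sum>t\<in>{N..w ?d}. h t (w(?d := w ?d - t))) = (\<Sum>t\<le>w ?d - N. h N (w(?d := w ?d - N - t)))"
      proof (rule sum.reindex_bij_witness[of _ "\<lambda>t. t + N" "\<lambda>t. t - N"])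
        fix t assume "t \<in> {N..w ?d}"
        thus "h N (w(?d := w ?d - N - (t - N))) = h t (w(?d := w ?d - t))"
          using hN[of t] by simp
      qed (use False in auto)
      moreover have "(\<Sum>t<N. h t (w(?d := w ?d - t))) = (\<Sum>t<N. if w ?d < t then 0 else h t (w(?d := w ?d - t)))"
        by (rule sum.cong) (use False in auto)
      ultimately show ?thesis unfolding s split using False by (subst sum.union_disjoint) auto
    qed
  qed
  moreover have "separable (\<lambda>w. (\<Sum>t<N. if w ?d < t then 0 else h t (w(?d := w ?d - t)))
     + (if w ?d < N then 0 else (\<lambda>w. \<Sum>t\<le>w ?d. h N (w(?d := w ?d - t))) (w(?d := w ?d - N))))"
    by (intro separable_add separable_finite_sum separable_shift separable_sum h) auto
  ultimately show ?case by simp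
qed

lemma separable_eventually_polynomial:
  fixes h :: "('t::finite \<Rightarrow> nat) \<Rightarrow> rat"
  assumes "separable h"
  shows "\<exists>c N. finite {\<gamma>. c \<gamma> \<noteq> 0} \<and>
     (\<forall>w. (\<forall>d. w d \<ge> N) \<longrightarrow> h w = (\<Sum>\<gamma> | c \<gamma> \<noteq> 0. c \<gamma> * (\<Prod>d\<in>UNIV. of_nat (w d) ^ \<gamma> d)))"
  using assms
proof (induction rule: separable.induct)
  case (separable_prod \<phi>)
  then obtain q N where q: "\<And>d x. x \<ge> N d \<Longrightarrow> \<phi> d x = poly (q d) (of_nat x)"
    unfolding eventually_poly1_def by metis
  define c where "c \<gamma> = (\<Prod>d\<in>UNIV. coeff (q d) (\<gamma> d))" for \<gamma>
  let ?S = "PiE UNIV (\<lambda>d. {..degree (q d)})"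
  have fin: "finite ?S" by (rule finite_PiE) auto
  have sub: "{\<gamma>. c \<gamma> \<noteq> 0} \<subseteq> ?S"
    unfolding c_def by (auto simp: le_degree)
  have "(\<Prod>d\<in>UNIV. \<phi> d (w d)) = (\<Sum>\<gamma> | c \<gamma> \<noteq> 0. c \<gamma> * (\<Prod>d\<in>UNIV. of_nat (w d) ^ \<gamma> d))"
    if "\<forall>d. Max (range N) \<le> w d" for w
  proof -
    have "N d \<le> w d" for d using that by (meson Max_ge finite_class.finite finite_imageI order_trans rangeI)
    hence "(\<Prod>d\<in>UNIV. \<phi> d (w d)) = (\<Prod>d\<in>UNIV. \<Sum>i\<le>degree (q d). coeff (q d) i * of_nat (w d) ^ i)"
      by (simp add: q poly_altdef)
    also have "\<dots> = (\<Sum>\<gamma>\<in>?S. c \<gamma> * (\<Prod>d\<in>UNIV. of_nat (w d) ^ \<gamma> d))"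
      by (subst prod_sum_PiE) (auto simp: c_def prod.distrib)
    also have "\<dots> = (\<Sum>\<gamma> | c \<gamma> \<noteq> 0. c \<gamma> * (\<Prod>d\<in>UNIV. of_nat (w d) ^ \<gamma> d))"
      by (rule sum.mono_neutral_right[OF fin sub]) auto
    finally show ?thesis .
  qed
  thus ?case using finite_subset[OF sub fin] by (intro exI[of _ c] exI[of _ "Max (range N)"]) auto
next
  case (separable_add g h)
  let ?m = "\<lambda>w \<gamma>. (\<Prod>d\<in>UNIV. (of_nat (w d) :: rat) ^ \<gamma> d)"
  obtain c N where c: "finite {\<gamma>. c \<gamma> \<noteq> 0}"
      "\<forall>w. (\<forall>d. w d \<ge> N) \<longrightarrow> g w = (\<Sum>\<gamma> | c \<gamma> \<noteq> 0. c \<gamma> * ?m w \<gamma>)"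
    using separable_add.IH(1) by (elim exE conjE)
  obtain c' N' where c': "finite {\<gamma>. c' \<gamma> \<noteq> 0}"
      "\<forall>w. (\<forall>d. w d \<ge> N') \<longrightarrow> h w = (\<Sum>\<gamma> | c' \<gamma> \<noteq> 0. c' \<gamma> * ?m w \<gamma>)"
    using separable_add.IH(2) by (elim exE conjE)
  let ?S = "{\<gamma>. c \<gamma> \<noteq> 0} \<union> {\<gamma>. c' \<gamma> \<noteq> 0}"
  have fin: "finite ?S" using c(1) c'(1) by simp
  have sub: "{\<gamma>. c \<gamma> + c' \<gamma> \<noteq> 0} \<subseteq> ?S" by auto
  have "g w + h w = (\<Sum>\<gamma> | c \<gamma> + c' \<gamma> \<noteq> 0. (c \<gamma> + c' \<gamma>) * ?m w \<gamma>)" if "\<forall>d. max N N' \<le> w d" for w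
  proof -
    have "g w = (\<Sum>\<gamma>\<in>?S. c \<gamma> * ?m w \<gamma>)"
      using that by (subst c(2)[rule_format]) (auto intro!: sum.mono_neutral_left fin)
    moreover have "h w = (\<Sum>\<gamma>\<in>?S. c' \<gamma> * ?m w \<gamma>)"
      using that by (subst c'(2)[rule_format]) (auto intro!: sum.mono_neutral_left fin)
    moreover have "(\<Sum>\<gamma> | c \<gamma> + c' \<gamma> \<noteq> 0. (c \<gamma> + c' \<gamma>) * ?m w \<gamma>) = (\<Sum>\<gamma>\<in>?S. (c \<gamma> + c' \<gamma>) * ?m w \<gamma>)"
      by (rule sum.mono_neutral_left[OF fin sub]) auto
    ultimately show ?thesis by (simp add: sum.distrib distrib_right)
  qed
  hence "\<forall>w. (\<forall>d. max N N' \<le> w d) \<longrightarrow>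
      g w + h w = (\<Sum>\<gamma> | c \<gamma> + c' \<gamma> \<noteq> 0. (c \<gamma> + c' \<gamma>) * ?m w \<gamma>)"
    by blast
  thus ?case using finite_subset[OF sub fin] by (intro exI conjI)
qed

section \<open>Polynomials along rays\<close>

lemma poly_eventually_ge_lead_coeff:
  fixes q :: "'a::linordered_field poly"
  assumes "lead_coeff q > 0"
  shows "\<exists>b. \<forall>x\<ge>b. lead_coeff q \<le> poly q x"
  using assms
proof (induction q)
  case 0
  then show ?case by simp
next
  case (pCons a q)
  show ?case
  proof (cases "q = 0")
    case True
    then show ?thesis by simp
  next
    case False
    have lc: "lead_coeff q > 0" using pCons.prems unfolding lead_coeff_pCons(1)[OF False] .
    then obtain b where b: "\<And>x. x \<ge> b \<Longrightarrow> lead_coeff q \<le> poly q x" using pCons.IH by blast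
    define B where "B = max b (1 + \<bar>a\<bar> / lead_coeff q)"
    have "lead_coeff q \<le> a + x * poly q x" if "x \<ge> B" for x
    proof -
      have x: "x \<ge> b" "x \<ge> 1 + \<bar>a\<bar> / lead_coeff q" using that by (auto simp: B_def)
      have "lead_coeff q + \<bar>a\<bar> = (1 + \<bar>a\<bar> / lead_coeff q) * lead_coeff q"
        using False by (simp add: distrib_right)
      also have "\<dots> \<le> x * poly q x"
        using x b[OF x(1)] lc by (intro mult_mono) (auto intro: add_nonneg_nonneg order_trans[OF _ x(2)])
      finally show ?thesis by linarith
    qed
    thus ?thesis using False by (auto intro!: exI[of _ B])
  qed
qed

text \<open>All comparisons of leading forms reduce to this fact. It is stated at a degree \<open>k\<close> that may exceed
the degree of \<open>q\<close>.\<close>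

lemma coeff_nonneg_if_eventually_nonneg:
  fixes q :: "rat poly"
  assumes "degree q \<le> k" "\<And>n::nat. n \<ge> N \<Longrightarrow> poly q (of_nat n) \<ge> 0"
  shows "coeff q k \<ge> 0"
proof (rule ccontr)
  assume "\<not> coeff q k \<ge> 0"
  hence neg: "coeff q k < 0" by simp
  hence "degree q = k" using assms(1) le_degree[of q k] by force
  hence lc: "lead_coeff (- q) > 0" using neg by simp
  then obtain b where b: "\<And>x. x \<ge> b \<Longrightarrow> lead_coeff (- q) \<le> poly (- q) x"
    using poly_eventually_ge_lead_coeff by blast
  obtain n :: nat where "b \<le> of_nat n" using real_arch_simple by blast
  hence "b \<le> of_nat (max n N)" by (simp add: le_max_iff_disj of_nat_max)
  from b[OF this] lc have "poly q (of_nat (max n N)) < 0" by simp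
  with assms(2)[of "max n N"] show False by simp
qed

lemma coeff_mono_if_eventually_le:
  fixes q q' :: "rat poly"
  assumes "degree q \<le> k" "degree q' \<le> k"
    and "\<And>n::nat. n \<ge> N \<Longrightarrow> poly q (of_nat n) \<le> poly q' (of_nat n)"
  shows "coeff q k \<le> coeff q' k"
  using coeff_nonneg_if_eventually_nonneg[of "q' - q" k N] assms by (simp add: degree_diff_le)

lemma degree_le_if_squeezed:
  fixes q q1 q2 :: "rat poly"
  assumes "degree q1 \<le> k" "degree q2 \<le> k"
    and "\<And>n::nat. n \<ge> N \<Longrightarrow> poly q1 (of_nat n) \<le> poly q (of_nat n)"
    and "\<And>n::nat. n \<ge> N \<Longrightarrow> poly q (of_nat n) \<le> poly q2 (of_nat n)"
  shows "degree q \<le> k"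
proof (rule ccontr)
  assume "\<not> degree q \<le> k"
  hence k: "k < degree q" by simp
  have "coeff q1 (degree q) \<le> lead_coeff q" "lead_coeff q \<le> coeff q2 (degree q)"
    by (rule coeff_mono_if_eventually_le[where N = N]; use assms k in force)+
  moreover have "coeff q1 (degree q) = 0" "coeff q2 (degree q) = 0"
    using assms(1,2) k by (auto intro: coeff_eq_0)
  ultimately have "q = 0" by simp
  with k show False by simp
qed

text \<open>The coefficient at a prescribed degree bound \<open>k\<close>, which is 0 if the degree is smaller. In contrast
to the leading coefficient it is additive, and it is multiplicative when the bounds are added.\<close>

definition has_top :: "rat poly \<Rightarrow> nat \<Rightarrow> rat \<Rightarrow> bool" where
  "has_top q k c \<longleftrightarrow> degree q \<le> k \<and> coeff q k = c"

lemma has_top_mult: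
  assumes "has_top p m a" "has_top q n b"
  shows "has_top (p * q) (m + n) (a * b)"
proof -
  have d: "degree p \<le> m" "degree q \<le> n" and c: "coeff p m = a" "coeff q n = b"
    using assms by (auto simp: has_top_def)
  have "coeff (p * q) (m + n) = (\<Sum>i\<le>m + n. coeff p i * coeff q (m + n - i))" by (rule coeff_mult)
  also have "\<dots> = (\<Sum>i\<in>{m}. coeff p i * coeff q (m + n - i))"
  proof (rule sum.mono_neutral_right, goal_cases)
    case 3
    show ?case
    proof
      fix i assume "i \<in> {..m + n} - {m}"
      hence "i > m \<or> m + n - i > n" by auto
      thus "coeff p i * coeff q (m + n - i) = 0"
        using d by (auto simp: coeff_eq_0)
    qed
  qed auto
  finally have "coeff (p * q) (m + n) = a * b" using c by simp
  moreover have "degree (p * q) \<le> m + n"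
    using degree_mult_le[of p q] d by linarith
  ultimately show ?thesis by (simp add: has_top_def)
qed

lemma has_top_one: "has_top 1 0 1"
  by (simp add: has_top_def)

lemma has_top_power: "has_top p m a \<Longrightarrow> has_top (p ^ k) (m * k) (a ^ k)"
  by (induction k) (use has_top_one has_top_mult in \<open>auto simp: algebra_simps\<close>)

lemma has_top_prod:
  "finite A \<Longrightarrow> (\<And>x. x \<in> A \<Longrightarrow> has_top (p x) (m x) (a x)) \<Longrightarrow>
    has_top (\<Prod>x\<in>A. p x) (\<Sum>x\<in>A. m x) (\<Prod>x\<in>A. a x)"
  by (induction A rule: finite_induct) (auto simp: has_top_one has_top_mult)

lemma has_top_sum:
  "finite A \<Longrightarrow> (\<And>x. x \<in> A \<Longrightarrow> has_top (p x) k (a x)) \<Longrightarrow>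
    has_top (\<Sum>x\<in>A. p x) k (\<Sum>x\<in>A. a x)"
  by (auto simp: has_top_def coeff_sum intro: degree_sum_le)

lemma has_top_smult: "has_top p k a \<Longrightarrow> has_top (smult c p) k (c * a)"
  using degree_smult_le[of c p] by (auto simp: has_top_def)

lemma has_top_diff: "has_top p k a \<Longrightarrow> has_top q k b \<Longrightarrow> has_top (p - q) k (a - b)"
  by (auto simp: has_top_def degree_diff_le)

lemma has_top_linear: "has_top [:s, x:] 1 x"
  by (simp add: has_top_def)

lemma finite_vsize_le: "finite {\<beta> :: 's::finite \<Rightarrow> nat. vsize \<beta> \<le> n}"
proof (rule finite_subset)
  have "\<beta> l \<le> vsize \<beta>" for \<beta> :: "'s \<Rightarrow> nat" and l
    unfolding vsize_def by (rule member_le_sum) auto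
  thus "{\<beta> :: 's \<Rightarrow> nat. vsize \<beta> \<le> n} \<subseteq> PiE UNIV (\<lambda>_. {..n})"
    by (auto simp: PiE_def intro: order_trans)
  show "finite (PiE UNIV (\<lambda>_. {..n}) :: ('s \<Rightarrow> nat) set)" by (rule finite_PiE) auto
qed

lemma finite_exponents: "finite {(a, \<beta> :: 's::finite \<Rightarrow> nat). a + vsize \<beta> = n}"
  by (rule finite_subset[of _ "{..n} \<times> {\<beta>. vsize \<beta> \<le> n}"]) (auto simp: finite_vsize_le)

text \<open>The substitution of \<open>(s0 + n r, s + n u)\<close> into the component of degree \<open>k\<close>, as a polynomial in \<open>n\<close>.\<close>

definition ray_component ::
    "(nat \<Rightarrow> ('s::finite \<Rightarrow> nat) \<Rightarrow> rat) \<Rightarrow> nat \<Rightarrow> rat \<Rightarrow> nat \<Rightarrow> ('s \<Rightarrow> rat) \<Rightarrow> ('s \<Rightarrow> nat) \<Rightarrow> rat poly" where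
  "ray_component p k s0 r s u =
     (\<Sum>(a, \<beta>) \<in> {(a, \<beta>). a + vsize \<beta> = k}.
        smult (p a \<beta>) ([:s0, of_nat r:] ^ a * (\<Prod>l\<in>UNIV. [:s l, of_nat (u l):] ^ \<beta> l)))"

lemma poly_ray_component:
  assumes "of_nat r' = s0 + of_nat n * of_nat r" "\<And>l. of_nat (u' l) = s l + of_nat n * of_nat (u l)"
  shows "poly (ray_component p k s0 r s u) (of_nat n) = hom_component p k r' u'"
  unfolding ray_component_def hom_component_def poly_sum
  by (rule sum.cong) (auto simp: poly_prod assms mult.assoc)

text \<open>The translation \<open>(s0, s)\<close> only affects the lower coefficients.\<close>

lemma has_top_ray_component: "has_top (ray_component p k s0 r s u) k (hom_component p k r u)"
  unfolding ray_component_def hom_component_def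
proof (rule has_top_sum[OF finite_exponents], clarify)
  fix a and \<beta> :: "'a \<Rightarrow> nat"
  have "has_top ([:s0, of_nat r:] ^ a * (\<Prod>l\<in>UNIV. [:s l, of_nat (u l):] ^ \<beta> l))
      (1 * a + (\<Sum>l\<in>UNIV. 1 * \<beta> l)) (of_nat r ^ a * (\<Prod>l\<in>UNIV. of_nat (u l) ^ \<beta> l))"
    by (intro has_top_mult has_top_prod has_top_power has_top_linear) auto
  from has_top_smult[OF this, of "p a \<beta>"]
  show "has_top (smult (p a \<beta>) ([:s0, of_nat r:] ^ a * (\<Prod>l\<in>UNIV. [:s l, of_nat (u l):] ^ \<beta> l)))
      (a + vsize \<beta>) (p a \<beta> * of_nat r ^ a * (\<Prod>l\<in>UNIV. of_nat (u l) ^ \<beta> l))"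
    by (simp add: vsize_def mult.assoc)
qed

definition ray_poly ::
    "(nat \<Rightarrow> ('s::finite \<Rightarrow> nat) \<Rightarrow> rat) \<Rightarrow> nat \<Rightarrow> rat \<Rightarrow> nat \<Rightarrow> ('s \<Rightarrow> rat) \<Rightarrow> ('s \<Rightarrow> nat) \<Rightarrow> rat poly" where
  "ray_poly p k s0 r s u = (\<Sum>i\<le>k. ray_component p i s0 r s u)"

lemma poly_ray_poly:
  assumes "of_nat r' = s0 + of_nat n * of_nat r" "\<And>l. of_nat (u' l) = s l + of_nat n * of_nat (u l)"
  shows "poly (ray_poly p k s0 r s u) (of_nat n) = (\<Sum>i\<le>k. hom_component p i r' u')"
  unfolding ray_poly_def poly_sum using poly_ray_component[of r' s0 n r u' s u] assms by simp

lemma has_top_ray_poly: "has_top (ray_poly p k s0 r s u) k (hom_component p k r u)"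
proof -
  have t: "degree (ray_component p i s0 r s u) \<le> i" "coeff (ray_component p i s0 r s u) i = hom_component p i r u" for i
    using has_top_ray_component[of p i s0 r s u] by (auto simp: has_top_def)
  have "degree (ray_poly p k s0 r s u) \<le> k"
    unfolding ray_poly_def by (rule degree_sum_le) (auto intro: order_trans[OF t(1)])
  moreover have "coeff (ray_poly p k s0 r s u) k = (\<Sum>i\<in>{k}. coeff (ray_component p i s0 r s u) k)"
    unfolding ray_poly_def coeff_sum
    by (rule sum.mono_neutral_right) (auto intro!: coeff_eq_0 le_less_trans[OF t(1)])
  ultimately show ?thesis by (simp add: has_top_def t)
qed

lemma hom_component_scale:
  "hom_component p k (n * r) (\<lambda>l. n * u l) = of_nat n ^ k * hom_component p k r u"
  unfolding hom_component_def sum_distrib_left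
  by (rule sum.cong)
     (auto simp: power_mult_distrib prod.distrib power_add vsize_def power_sum)

text \<open>Along the ray through \<open>(r, u)\<close> the homogeneous components are the coefficients of a polynomial in
\<open>n\<close>, which is squeezed between polynomials of degree at most \<open>k\<close>.\<close>

lemma hom_components_vanish_above:
  assumes "degree q1 \<le> k" "degree q2 \<le> k"
    and "\<And>n::nat. n \<ge> N \<Longrightarrow> poly q1 (of_nat n) \<le> (\<Sum>i\<le>K. hom_component p i (n * r) (\<lambda>l. n * u l))"
    and "\<And>n::nat. n \<ge> N \<Longrightarrow> (\<Sum>i\<le>K. hom_component p i (n * r) (\<lambda>l. n * u l)) \<le> poly q2 (of_nat n)"
    and "k < i" "i \<le> K"
  shows "hom_component p i r u = 0"
proof -
  define Q where "Q = (\<Sum>i\<le>K. monom (hom_component p i r u) i)"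
  have "poly Q (of_nat n) = (\<Sum>i\<le>K. hom_component p i (n * r) (\<lambda>l. n * u l))" for n
    unfolding Q_def by (simp add: poly_sum poly_monom hom_component_scale mult.commute)
  hence "degree Q \<le> k" using degree_le_if_squeezed[of q1 k q2 N Q] assms(1-4) by simp
  hence "coeff Q i = 0" using assms(5) by (intro coeff_eq_0) auto
  moreover have "coeff Q i = hom_component p i r u"
    unfolding Q_def coeff_sum using assms(6) by (simp add: if_distrib coeff_monom cong: if_cong)
  ultimately show ?thesis by simp
qed

lemma eventually_poly_on_ray:
  assumes "eventually_poly H k p" "r > 0" "\<And>l. u l > 0"
  shows "\<exists>N. \<forall>n\<ge>N. \<exists>h. H (n * r - c) (\<lambda>l. n * u l + v l) = enat h \<and>
      of_nat h = poly (ray_poly p k (- of_nat c) r (\<lambda>l. of_nat (v l)) u) (of_nat n)"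
proof -
  obtain N where N: "\<And>r u. r \<ge> N \<Longrightarrow> (\<forall>l. u l \<ge> N) \<Longrightarrow>
      (\<exists>h. H r u = enat h \<and> of_nat h = (\<Sum>k\<le>k. hom_component p k r u))"
    using assms(1) unfolding eventually_poly_def by blast
  have le: "n \<le> n * x" if "x > 0" for n x :: nat
    using that by (metis One_nat_def Suc_leI mult.right_neutral mult_le_mono2)
  show ?thesis
  proof (rule exI[of _ "N + c"], intro allI impI)
    fix n assume n: "N + c \<le> n"
    have r: "N + c \<le> n * r" using n le[OF assms(2)] order_trans by blast
    have u: "N \<le> n * u l + v l" for l using n le[OF assms(3), of n l] by linarith
    have "\<exists>h. H (n * r - c) (\<lambda>l. n * u l + v l) = enat h \<and>
        of_nat h = (\<Sum>k\<le>k. hom_component p k (n * r - c) (\<lambda>l. n * u l + v l))"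
      by (rule N) (use r u in auto)
    moreover have "poly (ray_poly p k (- of_nat c) r (\<lambda>l. of_nat (v l)) u) (of_nat n)
        = (\<Sum>k\<le>k. hom_component p k (n * r - c) (\<lambda>l. n * u l + v l))"
      by (rule poly_ray_poly) (use r in \<open>auto simp: of_nat_diff\<close>)
    ultimately show "\<exists>h. H (n * r - c) (\<lambda>l. n * u l + v l) = enat h \<and>
      of_nat h = poly (ray_poly p k (- of_nat c) r (\<lambda>l. of_nat (v l)) u) (of_nat n)" by simp
  qed
qed

text \<open>Positive coordinates make the ray enter the region where both polynomials represent \<open>H\<close>.\<close>

lemma leading_form_unique:
  assumes "eventually_poly H k p" "eventually_poly H k p'" "r > 0" "\<And>l. u l > 0"
  shows "hom_component p k r u = hom_component p' k r u"
proof -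
  define q q' where "q = ray_poly p k (- of_nat 0) r (\<lambda>l. of_nat ((\<lambda>_. 0) l)) u"
    and "q' = ray_poly p' k (- of_nat 0) r (\<lambda>l. of_nat ((\<lambda>_. 0) l)) u"
  obtain N where N: "\<And>n. n \<ge> N \<Longrightarrow> \<exists>h. H (n * r - 0) (\<lambda>l. n * u l + 0) = enat h \<and> of_nat h = poly q (of_nat n)"
    unfolding q_def using eventually_poly_on_ray[where u = u and c = 0 and v = "\<lambda>_. 0", OF assms(1,3,4)] by blast
  obtain N' where N': "\<And>n. n \<ge> N' \<Longrightarrow> \<exists>h. H (n * r - 0) (\<lambda>l. n * u l + 0) = enat h \<and> of_nat h = poly q' (of_nat n)"
    unfolding q'_def using eventually_poly_on_ray[where u = u and c = 0 and v = "\<lambda>_. 0", OF assms(2,3,4)] by blast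
  have eq: "poly q (of_nat n) = poly q' (of_nat n)" if "n \<ge> max N N'" for n
    using N[of n] N'[of n] that by auto
  have t: "degree q \<le> k" "coeff q k = hom_component p k r u" "degree q' \<le> k" "coeff q' k = hom_component p' k r u"
    using has_top_ray_poly[of p k "- of_nat 0" r "\<lambda>l. of_nat ((\<lambda>_. 0) l)" u]
      has_top_ray_poly[of p' k "- of_nat 0" r "\<lambda>l. of_nat ((\<lambda>_. 0) l)" u]
    unfolding has_top_def q_def q'_def by blast+
  have "coeff q k \<le> coeff q' k"
    by (rule coeff_mono_if_eventually_le[OF t(1,3), of "max N N'"]) (use eq in force)
  moreover have "coeff q' k \<le> coeff q k"
    by (rule coeff_mono_if_eventually_le[OF t(3,1), of "max N N'"]) (use eq in force)
  ultimately show ?thesis using t by simp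
qed

lemma poly_zero_on_positive_nat:
  fixes q :: "rat poly"
  assumes "\<And>x::nat. x > 0 \<Longrightarrow> poly q (of_nat x) = 0"
  shows "q = 0"
proof (rule ccontr)
  assume "q \<noteq> 0"
  hence "finite {x. poly q x = 0}" by (rule poly_roots_finite)
  moreover have "of_nat ` {0<..} \<subseteq> {x. poly q x = 0}" using assms by auto
  ultimately have "finite (of_nat ` {0::nat<..} :: rat set)" using finite_subset by blast
  moreover have "inj_on (of_nat :: nat \<Rightarrow> rat) {0<..}" by (simp add: inj_on_def)
  ultimately have "finite {0::nat<..}" using finite_imageD by blast
  thus False using infinite_Ioi by blast
qed

text \<open>By induction on the set \<open>A\<close> of variables: collect the powers of one variable and use that a
univariate polynomial with infinitely many zeros vanishes. The exponents in \<open>S\<close> are only required to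
be separated by their values on \<open>A\<close>, a property that the subsets with a fixed exponent of the new
variable inherit.\<close>

lemma polynomial_zero_on_positive:
  fixes c :: "('t \<Rightarrow> nat) \<Rightarrow> rat"
  assumes "finite A" "finite S"
    and "\<And>\<gamma> \<gamma>'. \<gamma> \<in> S \<Longrightarrow> \<gamma>' \<in> S \<Longrightarrow> (\<And>d. d \<in> A \<Longrightarrow> \<gamma> d = \<gamma>' d) \<Longrightarrow> \<gamma> = \<gamma>'"
    and "\<And>w. (\<And>d. w d > 0) \<Longrightarrow> (\<Sum>\<gamma>\<in>S. c \<gamma> * (\<Prod>d\<in>A. of_nat (w d) ^ \<gamma> d)) = 0"
    and "\<gamma> \<in> S"
  shows "c \<gamma> = 0"
  using assms
proof (induction A arbitrary: S \<gamma> rule: finite_induct)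
  case empty
  hence "S = {\<gamma>}" by auto
  thus ?case using empty.prems(3)[of "\<lambda>_. 1"] by simp
next
  case (insert d A)
  define T where "T i = {\<gamma> \<in> S. \<gamma> d = i}" for i
  have "(\<Sum>\<gamma>\<in>T i. c \<gamma> * (\<Prod>e\<in>A. of_nat (w e) ^ \<gamma> e)) = 0" if w: "\<And>e. w e > 0" for w i
  proof -
    define Q where "Q = (\<Sum>\<gamma>\<in>S. monom (c \<gamma> * (\<Prod>e\<in>A. of_nat (w e) ^ \<gamma> e)) (\<gamma> d))"
    have "Q = 0"
    proof (rule poly_zero_on_positive_nat)
      fix x :: nat assume x: "x > 0"
      have "poly Q (of_nat x) = (\<Sum>\<gamma>\<in>S. c \<gamma> * (\<Prod>e\<in>insert d A. of_nat ((w(d := x)) e) ^ \<gamma> e))"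
        unfolding Q_def poly_sum poly_monom
      proof (rule sum.cong, simp)
        fix \<gamma> assume "\<gamma> \<in> S"
        have "(\<Prod>e\<in>A. of_nat ((w(d := x)) e) ^ \<gamma> e) = (\<Prod>e\<in>A. (of_nat (w e) :: rat) ^ \<gamma> e)"
          by (rule prod.cong) (use insert.hyps in auto)
        thus "c \<gamma> * (\<Prod>e\<in>A. of_nat (w e) ^ \<gamma> e) * of_nat x ^ \<gamma> d =
          c \<gamma> * (\<Prod>e\<in>insert d A. of_nat ((w(d := x)) e) ^ \<gamma> e)"
          using insert.hyps by simp
      qed
      also have "\<dots> = 0" by (rule insert.prems(3)) (use w x in auto)
      finally show "poly Q (of_nat x) = 0" .
    qed
    have "coeff Q i = (\<Sum>\<gamma>\<in>S. if \<gamma> d = i then c \<gamma> * (\<Prod>e\<in>A. of_nat (w e) ^ \<gamma> e) else 0)"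
      unfolding Q_def by (simp add: coeff_sum)
    also have "\<dots> = (\<Sum>\<gamma>\<in>T i. c \<gamma> * (\<Prod>e\<in>A. of_nat (w e) ^ \<gamma> e))"
      unfolding T_def using insert.prems(1) by (simp add: sum.inter_filter)
    finally show ?thesis using \<open>Q = 0\<close> by simp
  qed
  note vanish = this
  show ?case
  proof (rule insert.IH[of "T (\<gamma> d)" \<gamma>])
    fix \<gamma>1 \<gamma>2 assume "\<gamma>1 \<in> T (\<gamma> d)" "\<gamma>2 \<in> T (\<gamma> d)" "\<And>e. e \<in> A \<Longrightarrow> \<gamma>1 e = \<gamma>2 e"
    thus "\<gamma>1 = \<gamma>2" using insert.prems(2)[of \<gamma>1 \<gamma>2] unfolding T_def by fastforce
  qed (use insert.prems vanish in \<open>auto simp: T_def\<close>)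
qed

text \<open>The pair \<open>(a, \<beta>)\<close> is treated as one exponent vector over \<open>'s option\<close>, with \<open>None\<close> for the variable \<open>r\<close>.\<close>

lemma hom_component_eq_imp_coeff_eq:
  fixes p p' :: "nat \<Rightarrow> ('s::finite \<Rightarrow> nat) \<Rightarrow> rat"
  assumes "\<And>r u. r > 0 \<Longrightarrow> (\<And>l. u l > 0) \<Longrightarrow> hom_component p n r u = hom_component p' n r u"
    and "a + vsize \<beta> = n"
  shows "p a \<beta> = p' a \<beta>"
proof -
  let ?E = "{(a, \<beta> :: 's \<Rightarrow> nat). a + vsize \<beta> = n}"
  let ?f = "\<lambda>(a, \<beta>). case_option a \<beta>"
  define c :: "('s option \<Rightarrow> nat) \<Rightarrow> rat" where
    "c \<gamma> = p (\<gamma> None) (\<gamma> \<circ> Some) - p' (\<gamma> None) (\<gamma> \<circ> Some)" for \<gamma>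
  have comp: "(case_option a \<beta> \<circ> Some) = \<beta>" for a and \<beta> :: "'s \<Rightarrow> nat" by (auto simp: fun_eq_iff)
  have inj: "inj_on ?f ?E"
    by (intro inj_onI) (auto simp: fun_eq_iff split: option.splits)
  have prod: "(\<Prod>d\<in>UNIV. g d) = g None * (\<Prod>l\<in>UNIV. g (Some l))" for g :: "'s option \<Rightarrow> rat"
    by (simp add: UNIV_option_conv prod.reindex)
  have "c (case_option a \<beta>) = 0"
  proof (rule polynomial_zero_on_positive[of UNIV "?f ` ?E" c "case_option a \<beta>"])
    show "case_option a \<beta> \<in> ?f ` ?E" using assms(2) by force
    show "finite (?f ` ?E)" using finite_exponents by blast
    fix w :: "'s option \<Rightarrow> nat" assume w: "\<And>d. w d > 0"
    have "(\<Sum>\<gamma>\<in>?f ` ?E. c \<gamma> * (\<Prod>d\<in>UNIV. of_nat (w d) ^ \<gamma> d))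
       = hom_component p n (w None) (\<lambda>l. w (Some l)) - hom_component p' n (w None) (\<lambda>l. w (Some l))"
      unfolding hom_component_def sum_subtractf[symmetric] sum.reindex[OF inj]
      by (rule sum.cong) (auto simp: c_def comp prod algebra_simps)
    thus "(\<Sum>\<gamma>\<in>?f ` ?E. c \<gamma> * (\<Prod>d\<in>UNIV. of_nat (w d) ^ \<gamma> d)) = 0"
      using assms(1) w by simp
  qed (auto intro: ext)
  thus ?thesis by (simp add: c_def comp)
qed

lemma eventually_polynomial_hom_components:
  fixes h :: "('s::finite option \<Rightarrow> nat) \<Rightarrow> rat"
  assumes "separable h"
  shows "\<exists>p K N. (\<forall>a \<beta>. a + vsize \<beta> > K \<longrightarrow> p a \<beta> = 0) \<and>
     (\<forall>r u. N \<le> r \<longrightarrow> (\<forall>l. N \<le> u l) \<longrightarrow> h (case_option r u) = (\<Sum>k\<le>K. hom_component p k r u))"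
proof -
  obtain c N where fin: "finite {\<gamma>. c \<gamma> \<noteq> 0}" and
    N: "\<forall>w. (\<forall>d. w d \<ge> N) \<longrightarrow> h w = (\<Sum>\<gamma> | c \<gamma> \<noteq> 0. c \<gamma> * (\<Prod>d\<in>UNIV. of_nat (w d) ^ \<gamma> d))"
    using separable_eventually_polynomial[OF assms] by (elim exE conjE)
  define p where "p a \<beta> = c (case_option a \<beta>)" for a and \<beta> :: "'s \<Rightarrow> nat"
  define K where "K = Max (insert 0 ((\<lambda>\<gamma>. \<gamma> None + vsize (\<gamma> \<circ> Some)) ` {\<gamma>. c \<gamma> \<noteq> 0}))"
  have opt: "case_option (\<gamma> None) (\<gamma> \<circ> Some) = \<gamma>" for \<gamma> :: "'s option \<Rightarrow> nat"
    by (auto simp: fun_eq_iff split: option.splits)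
  have comp: "(case_option a \<beta> \<circ> Some) = \<beta>" for a and \<beta> :: "'s \<Rightarrow> nat" by (auto simp: fun_eq_iff)
  have prod: "(\<Prod>d\<in>UNIV. g d) = g None * (\<Prod>l\<in>UNIV. g (Some l))" for g :: "'s option \<Rightarrow> rat"
    by (simp add: UNIV_option_conv prod.reindex)
  have K: "\<gamma> None + vsize (\<gamma> \<circ> Some) \<le> K" if "c \<gamma> \<noteq> 0" for \<gamma>
    unfolding K_def using fin that by (intro Max_ge) auto
  have zero: "p a \<beta> = 0" if "a + vsize \<beta> > K" for a \<beta>
    using K[of "case_option a \<beta>"] that comp unfolding p_def by force
  let ?E = "{(a, \<beta> :: 's \<Rightarrow> nat). a + vsize \<beta> \<le> K}"
  have finE: "finite ?E"
    by (rule finite_subset[of _ "{..K} \<times> {\<beta>. vsize \<beta> \<le> K}"]) (auto simp: finite_vsize_le)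
  have "h (case_option r u) = (\<Sum>k\<le>K. hom_component p k r u)" if r: "N \<le> r" and u: "\<forall>l. N \<le> u l" for r u
  proof -
    let ?m = "\<lambda>(a, \<beta>). p a \<beta> * of_nat r ^ a * (\<Prod>l\<in>UNIV. of_nat (u l) ^ \<beta> l)"
    have "\<forall>d. N \<le> case_option r u d" using r u by (auto split: option.splits)
    hence "h (case_option r u) = (\<Sum>\<gamma> | c \<gamma> \<noteq> 0. c \<gamma> * (\<Prod>d\<in>UNIV. of_nat (case_option r u d) ^ \<gamma> d))"
      using N by blast
    also have "\<dots> = (\<Sum>x | x \<in> ?E \<and> ?m x \<noteq> 0 \<or> x \<in> ?E \<and> p (fst x) (snd x) \<noteq> 0. ?m x)"
      by (rule sum.reindex_bij_witness[of _ "\<lambda>(a, \<beta>). case_option a \<beta>" "\<lambda>\<gamma>. (\<gamma> None, \<gamma> \<circ> Some)"])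
         (auto simp: opt comp prod p_def K mult.assoc)
    also have "\<dots> = (\<Sum>x\<in>?E. ?m x)"
      by (rule sum.mono_neutral_left[OF finE]) auto
    also have "\<dots> = (\<Sum>k\<le>K. \<Sum>x | x \<in> ?E \<and> fst x + vsize (snd x) = k. ?m x)"
      by (rule sum.group[symmetric]) (use finE in auto)
    also have "\<dots> = (\<Sum>k\<le>K. hom_component p k r u)"
      unfolding hom_component_def by (intro sum.cong) auto
    finally show ?thesis .
  qed
  with zero show ?thesis by blast
qed

text \<open>A degree bound follows from bounds on all rays through points with positive coordinates; at such
points the components above degree \<open>k\<close> vanish, so they can be left out of the sum although their
coefficients have not been compared.\<close>

lemma separable_eventually_poly:
  fixes h :: "('s::finite option \<Rightarrow> nat) \<Rightarrow> nat"
  assumes sep: "separable (\<lambda>w. of_nat (h w))"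
    and bound: "\<And>(r :: nat) u. r > 0 \<Longrightarrow> (\<And>l. u l > 0) \<Longrightarrow> \<exists>(q1 :: rat poly) (q2 :: rat poly) N. degree q1 \<le> k \<and> degree q2 \<le> k \<and>
      (\<forall>n\<ge>N. poly q1 (of_nat n) \<le> of_nat (h (case_option (n * r) (\<lambda>l. n * u l))) \<and>
              of_nat (h (case_option (n * r) (\<lambda>l. n * u l))) \<le> poly q2 (of_nat n))"
  shows "\<exists>p. eventually_poly (\<lambda>r u. enat (h (case_option r u))) k p"
proof -
  obtain p K N where zero: "\<And>a \<beta>. a + vsize \<beta> > K \<Longrightarrow> p a \<beta> = 0" and
    N: "\<And>r u. N \<le> r \<Longrightarrow> \<forall>l. N \<le> u l \<Longrightarrow> of_nat (h (case_option r u)) = (\<Sum>k\<le>K. hom_component p k r u)"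
    using eventually_polynomial_hom_components[OF sep] by blast
  define K' where "K' = max K k"
  have "hom_component p i r u = 0" if "i > K" for i r u
    unfolding hom_component_def by (rule sum.neutral) (use zero that in auto)
  hence ext: "(\<Sum>i\<le>K. hom_component p i r u) = (\<Sum>i\<le>K'. hom_component p i r u)" for r u
    by (intro sum.mono_neutral_left) (auto simp: K'_def)
  have van: "hom_component p i r u = 0" if ru: "r > 0" "\<And>l. u l > 0" and i: "k < i" "i \<le> K'" for i r u
  proof -
    obtain q1 q2 :: "rat poly" and N' where q: "degree q1 \<le> k" "degree q2 \<le> k"
      "\<And>n. n \<ge> N' \<Longrightarrow> poly q1 (of_nat n) \<le> of_nat (h (case_option (n * r) (\<lambda>l. n * u l)))"
      "\<And>n. n \<ge> N' \<Longrightarrow> of_nat (h (case_option (n * r) (\<lambda>l. n * u l))) \<le> poly q2 (of_nat n)"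
      using bound[of r u] ru by blast
    have le: "n \<le> n * x" if "x > 0" for n x :: nat
      using that by (metis One_nat_def Suc_leI mult.right_neutral mult_le_mono2)
    have eq: "of_nat (h (case_option (n * r) (\<lambda>l. n * u l))) = (\<Sum>i\<le>K'. hom_component p i (n * r) (\<lambda>l. n * u l))"
      if "n \<ge> max N N'" for n
    proof -
      have "N \<le> n * r" "\<forall>l. N \<le> n * u l" using that le ru order_trans by (metis max.bounded_iff)+
      thus ?thesis using N ext by simp
    qed
    show ?thesis
    proof (rule hom_components_vanish_above[OF q(1,2) _ _ i])
      fix n assume n: "max N N' \<le> n"
      show "poly q1 (of_nat n) \<le> (\<Sum>i\<le>K'. hom_component p i (n * r) (\<lambda>l. n * u l))"
        and "(\<Sum>i\<le>K'. hom_component p i (n * r) (\<lambda>l. n * u l)) \<le> poly q2 (of_nat n)"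
        unfolding eq[OF n, symmetric] using q(3,4)[of n] n by auto
    qed
  qed
  have "eventually_poly (\<lambda>r u. enat (h (case_option r u))) k p"
    unfolding eventually_poly_def
  proof (rule exI[of _ "max N 1"], intro allI impI)
    fix r :: nat and u :: "'s \<Rightarrow> nat" assume ru: "max N 1 \<le> r \<and> (\<forall>l. max N 1 \<le> u l)"
    hence pos: "r > 0" "\<And>l. u l > 0" by (auto simp: Suc_le_eq)
    have "of_nat (h (case_option r u)) = (\<Sum>i\<le>K'. hom_component p i r u)" using N[of r u] ru ext by simp
    also have "\<dots> = (\<Sum>i\<le>k. hom_component p i r u)"
      by (rule sum.mono_neutral_right) (use van pos in \<open>auto simp: K'_def\<close>)
    finally show "\<exists>ha. enat (h (case_option r u)) = enat ha \<and> of_nat ha = (\<Sum>k\<le>k. hom_component p k r u)" by simp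
  qed
  thus ?thesis by blast
qed

lemma degree_le_pred:
  assumes "has_top q k 0" "k \<ge> 1"
  shows "degree q \<le> k - 1"
  using assms by (intro degree_le) (metis has_top_def coeff_eq_0 le_less_trans less_Suc_eq_le not_less_eq
      One_nat_def Suc_pred less_imp_Suc_add nat_neq_iff zero_less_one)

section \<open>Mixed multiplicities as normalised coefficients\<close>

lemma vsize_upd: "vsize (\<beta>(j := \<beta> j + 1)) = vsize \<beta> + 1"
proof -
  have "(\<Sum>l\<in>UNIV - {j}. (\<beta>(j := \<beta> j + 1)) l) = (\<Sum>l\<in>UNIV - {j}. \<beta> l)" by (rule sum.cong) auto
  thus ?thesis unfolding vsize_def by (simp add: sum.remove[of UNIV j])
qed

lemma vsize_upd_Suc [simp]: "vsize (\<beta>(j := Suc (\<beta> j))) = Suc (vsize \<beta>)"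
  using vsize_upd[of \<beta> j] by simp

text \<open>The exponents \<open>d\<close> with \<open>d j > 0\<close> correspond to pairs \<open>(a, \<beta>)\<close> of total degree \<open>D - 1\<close> through
\<open>d = \<beta> + e\<^sub>j\<close> and \<open>a = D - |d|\<close>.\<close>

lemma directional_form_eq_hom_component:
  fixes c :: "('s::finite \<Rightarrow> nat) \<Rightarrow> rat"
  assumes "D \<ge> 1"
  shows "(\<Sum>d\<in>{d. 1 \<le> vsize d \<and> vsize d \<le> D \<and> d j > 0}.
        c d / (fact (D - vsize d) * fact (d j - 1) * (\<Prod>l\<in>UNIV - {j}. fact (d l)))
                * of_nat r ^ (D - vsize d) * of_nat (u j) ^ (d j - 1)
                * (\<Prod>l\<in>UNIV - {j}. of_nat (u l) ^ d l))
     = hom_component (\<lambda>a \<beta>. c (\<beta>(j := \<beta> j + 1)) / (fact a * (\<Prod>l\<in>UNIV. fact (\<beta> l)))) (D - 1) r u"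
  unfolding hom_component_def
proof (rule sum.reindex_bij_witness[of _ "\<lambda>(a, \<beta>). \<beta>(j := \<beta> j + 1)" "\<lambda>d. (D - vsize d, d(j := d j - 1))"],
    goal_cases)
  case (1 d)
  then show ?case by auto
next
  case (2 d)
  hence "d = (d(j := d j - 1))(j := (d(j := d j - 1)) j + 1)" by auto
  hence "vsize d = vsize (d(j := d j - 1)) + 1" by (metis vsize_upd)
  then show ?case using 2 by auto
next
  case (3 x)
  then show ?case using assms by (auto simp: fun_eq_iff)
next
  case (4 x)
  then show ?case using assms by auto
next
  case (5 d)
  have P: "(\<Prod>l\<in>UNIV. g l ((d(j := d j - 1)) l)) = g j (d j - 1) * (\<Prod>l\<in>UNIV - {j}. g l (d l))"
    for g :: "'s \<Rightarrow> nat \<Rightarrow> rat"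
    by (subst prod.remove[of UNIV j]) (auto intro!: prod.cong)
  have "d(j := Suc (d j - Suc 0)) = d" using 5 by auto
  then show ?case using P[of "\<lambda>_. fact"] P[of "\<lambda>l. (^) (of_nat (u l))"] by simp
qed

lemma diagonal_form_eq_hom_component:
  fixes c :: "nat \<Rightarrow> ('s::finite \<Rightarrow> nat) \<Rightarrow> rat"
  assumes "D \<ge> 1"
  shows "(\<Sum>i=1..D. \<Sum>\<alpha>\<in>{\<alpha>. vsize \<alpha> = i - 1}.
                c i \<alpha> / (fact (D - i) * (\<Prod>l\<in>UNIV. fact (\<alpha> l)))
                * of_nat r ^ (D - i) * (\<Prod>l\<in>UNIV. of_nat (u l) ^ \<alpha> l))
     = hom_component (\<lambda>a \<beta>. c (D - a) \<beta> / (fact a * (\<Prod>l\<in>UNIV. fact (\<beta> l)))) (D - 1) r u"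
proof -
  have fin: "finite {\<alpha> :: 's \<Rightarrow> nat. vsize \<alpha> = i - 1}" for i
    by (rule finite_subset[OF _ finite_vsize_le[of "i - 1"]]) auto
  let ?f = "\<lambda>i \<alpha>. c i \<alpha> / (fact (D - i) * (\<Prod>l\<in>UNIV. fact (\<alpha> l)))
                * of_nat r ^ (D - i) * (\<Prod>l\<in>UNIV. of_nat (u l) ^ \<alpha> l)"
  have "(\<Sum>i=1..D. \<Sum>\<alpha>\<in>{\<alpha>. vsize \<alpha> = i - 1}. ?f i \<alpha>)
      = (\<Sum>(i, \<alpha>)\<in>Sigma {1..D} (\<lambda>i. {\<alpha>. vsize \<alpha> = i - 1}). ?f i \<alpha>)"
    by (rule sum.Sigma) (use fin in auto)
  also have "\<dots> = hom_component (\<lambda>a \<beta>. c (D - a) \<beta> / (fact a * (\<Prod>l\<in>UNIV. fact (\<beta> l)))) (D - 1) r u"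
    unfolding hom_component_def
    by (rule sum.reindex_bij_witness[of _ "\<lambda>(a, \<beta>). (D - a, \<beta>)" "\<lambda>(i, \<beta>). (D - i, \<beta>)"])
       (use assms in auto)
  finally show ?thesis .
qed

text \<open>A representing polynomial makes the definite description meaningful: normalising its coefficients of
degree \<open>D - 1\<close> gives a family with the defining property, and it is the only one because leading
forms are unique at positive points and determine their coefficients.\<close>

lemma directional_mm_eq_coeff:
  fixes \<beta> :: "'s::finite \<Rightarrow> nat"
  assumes "module_dim R M = enat D" "D \<ge> 1"
    and p: "eventually_poly (hilbert_fun R \<mm> J M (basis_vec j)) (D - 1) p"
    and \<beta>: "a + vsize \<beta> = D - 1"
  shows "directional_mm R \<mm> J M j (\<beta>(j := \<beta> j + 1)) = p a \<beta> * (fact a * (\<Prod>l\<in>UNIV. fact (\<beta> l)))"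
proof -
  let ?H = "hilbert_fun R \<mm> J M (basis_vec j)"
  let ?E = "{d. 1 \<le> vsize d \<and> vsize d \<le> D \<and> d j > 0}"
  let ?F = "\<lambda>a \<beta>. fact a * (\<Prod>l\<in>UNIV. fact (\<beta> l)) :: rat"
  let ?P = "\<lambda>c a \<beta>. c (\<beta>(j := \<beta> j + 1)) / ?F a \<beta>"
  have D: "the_enat (module_dim R M) = D" using assms(1) by simp
  have char: "is_directional_mm R \<mm> J M j c \<longleftrightarrow> (\<forall>d. d \<notin> ?E \<longrightarrow> c d = 0) \<and>
     (\<exists>p. eventually_poly ?H (D - 1) p \<and> (\<forall>r u. hom_component p (D - 1) r u = hom_component (?P c) (D - 1) r u))" for c
    unfolding is_directional_mm_def Let_def D directional_form_eq_hom_component[OF assms(2)] ..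
  have F: "?F a \<beta> \<noteq> 0" for a and \<beta> :: "'s \<Rightarrow> nat" by (simp add: prod_zero_iff)
  define c where "c d = (if d \<in> ?E then p (D - vsize d) (d(j := d j - 1)) * ?F (D - vsize d) (d(j := d j - 1)) else 0)" for d
  have mem: "\<beta>(j := \<beta> j + 1) \<in> ?E" if "a + vsize \<beta> = D - 1" for a \<beta>
    using that assms(2) by auto
  have cval: "c (\<beta>(j := \<beta> j + 1)) = p a \<beta> * ?F a \<beta>" if "a + vsize \<beta> = D - 1" for a \<beta>
  proof -
    have "D - vsize (\<beta>(j := \<beta> j + 1)) = a" using that assms(2) by simp
    moreover have "(\<beta>(j := \<beta> j + 1))(j := (\<beta>(j := \<beta> j + 1)) j - 1) = \<beta>" by auto
    ultimately show ?thesis unfolding c_def using mem[OF that] by (simp del: fun_upd_apply)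
  qed
  have "is_directional_mm R \<mm> J M j c"
    unfolding char
  proof (intro conjI exI[of _ p] allI p)
    fix r u
    show "hom_component p (D - 1) r u = hom_component (?P c) (D - 1) r u"
      unfolding hom_component_def
      by (rule sum.cong) (use cval F in \<open>auto simp del: fun_upd_apply\<close>)
  qed (simp add: c_def)
  moreover have "c' = c" if c': "is_directional_mm R \<mm> J M j c'" for c'
  proof
    fix d
    from c' obtain p' where p': "eventually_poly ?H (D - 1) p'"
      "\<And>r u. hom_component p' (D - 1) r u = hom_component (?P c') (D - 1) r u"
      and zero: "\<And>d. d \<notin> ?E \<Longrightarrow> c' d = 0" unfolding char by blast
    show "c' d = c d"
    proof (cases "d \<in> ?E")
      case False
      hence "c d = 0" unfolding c_def by (rule if_not_P)
      thus ?thesis using zero[OF False] by simp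
    next
      case True
      define \<delta> where "\<delta> = d(j := d j - 1)"
      have d: "d = \<delta>(j := \<delta> j + 1)" using True by (auto simp: \<delta>_def)
      have deg: "(D - vsize d) + vsize \<delta> = D - 1"
        using True unfolding d vsize_upd by auto
      have "?P c' (D - vsize d) \<delta> = p (D - vsize d) \<delta>"
      proof (rule hom_component_eq_imp_coeff_eq[OF _ deg])
        fix r :: nat and u :: "'s \<Rightarrow> nat" assume "r > 0" "\<And>l. u l > 0"
        thus "hom_component (?P c') (D - 1) r u = hom_component p (D - 1) r u"
          using leading_form_unique[OF p'(1) p, of r u] p'(2) by simp
      qed
      hence "c' d = p (D - vsize d) \<delta> * ?F (D - vsize d) \<delta>"
        using F[of "D - vsize d" \<delta>] d by (simp add: divide_eq_eq)
      moreover have "c d = p (D - vsize d) \<delta> * ?F (D - vsize d) \<delta>"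
        unfolding c_def \<delta>_def using True by (rule if_P)
      ultimately show ?thesis by simp
    qed
  qed
  ultimately have "directional_mm R \<mm> J M j = c"
    unfolding directional_mm_def by (rule the_equality)
  thus ?thesis using cval[OF \<beta>] by simp
qed

lemma diagonal_mm_eq_coeff:
  fixes \<beta> :: "'s::finite \<Rightarrow> nat"
  assumes "module_dim R M = enat D" "D \<ge> 1"
    and p: "eventually_poly (hilbert_fun R \<mm> J M (\<lambda>_. 1)) (D - 1) p"
    and \<beta>: "a + vsize \<beta> = D - 1"
  shows "diagonal_mm R \<mm> J M (D - a) \<beta> = p a \<beta> * (fact a * (\<Prod>l\<in>UNIV. fact (\<beta> l)))"
proof -
  let ?H = "hilbert_fun R \<mm> J M (\<lambda>_. 1)"
  let ?E = "\<lambda>i \<alpha>. 1 \<le> i \<and> i \<le> D \<and> vsize \<alpha> = i - 1"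
  let ?F = "\<lambda>a \<beta>. fact a * (\<Prod>l\<in>UNIV. fact (\<beta> l)) :: rat"
  let ?P = "\<lambda>c a \<beta>. c (D - a) \<beta> / ?F a \<beta>"
  have D: "the_enat (module_dim R M) = D" using assms(1) by simp
  have char: "is_diagonal_mm R \<mm> J M c \<longleftrightarrow> (\<forall>i \<alpha>. \<not> ?E i \<alpha> \<longrightarrow> c i \<alpha> = 0) \<and>
     (\<exists>p. eventually_poly ?H (D - 1) p \<and> (\<forall>r u. hom_component p (D - 1) r u = hom_component (?P c) (D - 1) r u))" for c
    unfolding is_diagonal_mm_def Let_def D diagonal_form_eq_hom_component[OF assms(2)] ..
  have F: "?F a \<beta> \<noteq> 0" for a and \<beta> :: "'s \<Rightarrow> nat" by (simp add: prod_zero_iff)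
  define c where "c i \<alpha> = (if ?E i \<alpha> then p (D - i) \<alpha> * ?F (D - i) \<alpha> else 0)" for i and \<alpha> :: "'s \<Rightarrow> nat"
  have cval: "c (D - a) \<beta> = p a \<beta> * ?F a \<beta>" if "a + vsize \<beta> = D - 1" for a \<beta>
  proof -
    have "?E (D - a) \<beta>" "D - (D - a) = a" using that assms(2) by auto
    thus ?thesis unfolding c_def by simp
  qed
  have "is_diagonal_mm R \<mm> J M c"
    unfolding char
  proof (intro conjI exI[of _ p] allI p)
    fix r u
    show "hom_component p (D - 1) r u = hom_component (?P c) (D - 1) r u"
      unfolding hom_component_def
      by (rule sum.cong) (use cval F in auto)
  qed (simp add: c_def)
  moreover have "c' = c" if c': "is_diagonal_mm R \<mm> J M c'" for c'
  proof (intro ext)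
    fix i \<alpha>
    from c' obtain p' where p': "eventually_poly ?H (D - 1) p'"
      "\<And>r u. hom_component p' (D - 1) r u = hom_component (?P c') (D - 1) r u"
      and zero: "\<And>i \<alpha>. \<not> ?E i \<alpha> \<Longrightarrow> c' i \<alpha> = 0" unfolding char by blast
    show "c' i \<alpha> = c i \<alpha>"
    proof (cases "?E i \<alpha>")
      case False
      hence "c i \<alpha> = 0" unfolding c_def by (rule if_not_P)
      thus ?thesis using zero[OF False] by simp
    next
      case True
      hence deg: "(D - i) + vsize \<alpha> = D - 1" by auto
      have "?P c' (D - i) \<alpha> = p (D - i) \<alpha>"
      proof (rule hom_component_eq_imp_coeff_eq[OF _ deg])
        fix r :: nat and u :: "'s \<Rightarrow> nat" assume "r > 0" "\<And>l. u l > 0"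
        thus "hom_component (?P c') (D - 1) r u = hom_component p (D - 1) r u"
          using leading_form_unique[OF p'(1) p, of r u] p'(2) by simp
      qed
      hence "c' (D - (D - i)) \<alpha> = p (D - i) \<alpha> * ?F (D - i) \<alpha>"
        using F[of "D - i" \<alpha>] by (simp add: divide_eq_eq)
      moreover have "D - (D - i) = i" using True by auto
      moreover have "c i \<alpha> = p (D - i) \<alpha> * ?F (D - i) \<alpha>"
        unfolding c_def using True by (rule if_P)
      ultimately show ?thesis by simp
    qed
  qed
  ultimately have "diagonal_mm R \<mm> J M = c"
    unfolding diagonal_mm_def by (rule the_equality)
  thus ?thesis using cval[OF \<beta>] by simp
qed

text \<open>The normalising factorials on both sides agree, since \<open>\<alpha> + e\<^sub>j\<close> in direction \<open>j\<close> contributes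
\<open>(d\<^sub>j - 1)! = \<alpha>\<^sub>j!\<close>. So the claim is the additivity of the leading forms.\<close>

lemma diagonal_mm_eq_sum_directional_mm:
  fixes J :: "'s::finite \<Rightarrow> 'a set"
  assumes "module_dim R M = enat D" "D \<ge> 1"
    and "eventually_poly (hilbert_fun R \<mm> J M (\<lambda>_. 1)) (D - 1) p"
    and "\<And>j. eventually_poly (hilbert_fun R \<mm> J M (basis_vec j)) (D - 1) (q j)"
    and "\<And>r u. r > 0 \<Longrightarrow> (\<And>l. u l > 0) \<Longrightarrow>
       hom_component p (D - 1) r u = (\<Sum>j\<in>UNIV. hom_component (q j) (D - 1) r u)"
    and "1 \<le> i" "i \<le> D" "vsize \<alpha> = i - 1"
  shows "diagonal_mm R \<mm> J M i \<alpha> = (\<Sum>j\<in>UNIV. directional_mm R \<mm> J M j (\<alpha>(j := \<alpha> j + 1)))"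
proof -
  have deg: "(D - i) + vsize \<alpha> = D - 1" using assms(6-8) by auto
  have "hom_component (\<lambda>a \<beta>. \<Sum>j\<in>UNIV. q j a \<beta>) n r u = (\<Sum>j\<in>UNIV. hom_component (q j) n r u)" for n r u
    unfolding hom_component_def
    by (subst sum.swap) (auto intro!: sum.cong simp: sum_distrib_right)
  hence "p (D - i) \<alpha> = (\<Sum>j\<in>UNIV. q j (D - i) \<alpha>)"
    using assms(5) by (intro hom_component_eq_imp_coeff_eq[OF _ deg]) simp
  moreover have "diagonal_mm R \<mm> J M (D - (D - i)) \<alpha> = p (D - i) \<alpha> * (fact (D - i) * (\<Prod>l\<in>UNIV. fact (\<alpha> l)))"
    by (rule diagonal_mm_eq_coeff[OF assms(1-3) deg])
  moreover have "D - (D - i) = i" using assms(7) by simp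
  ultimately show ?thesis
    by (simp add: directional_mm_eq_coeff[OF assms(1,2) assms(4) deg, simplified] sum_distrib_right)
qed

section \<open>Lengths of intervals of submodules\<close>

definition chain_length :: "('b set \<Rightarrow> bool) \<Rightarrow> enat" where
  "chain_length P = Sup {enat n | n. \<exists>C. (\<forall>i\<le>n. P (C i)) \<and> (\<forall>i<n. C i \<subset> C (Suc i))}"

text \<open>Truncating a longer chain gives all smaller lengths; the hypothesis provides the chain of length 0.\<close>

lemma enat_le_chain_length_iff:
  assumes "P X"
  shows "enat n \<le> chain_length P \<longleftrightarrow> (\<exists>C. (\<forall>i\<le>n. P (C i)) \<and> (\<forall>i<n. C i \<subset> C (Suc i)))"
    (is "_ \<longleftrightarrow> ?chain n")
proof
  assume le: "enat n \<le> chain_length P"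
  show "?chain n"
  proof (cases n)
    case 0
    then show ?thesis using assms by (auto intro!: exI[of _ "\<lambda>_. X"])
  next
    case (Suc k)
    hence "enat k < chain_length P" using le by (simp add: Suc_ile_eq)
    then obtain x where "x \<in> {enat n | n. ?chain n}" "enat k < x"
      unfolding chain_length_def less_Sup_iff by (elim bexE)
    then obtain m C where "k < m" and C: "\<forall>i\<le>m. P (C i)" "\<forall>i<m. C i \<subset> C (Suc i)"
      by (elim CollectE exE conjE) simp
    hence "n \<le> m" using Suc by simp
    thus ?thesis using C by (intro exI[of _ C]) simp
  qed
next
  assume "?chain n"
  thus "enat n \<le> chain_length P" unfolding chain_length_def by (intro Sup_upper) blast
qed

lemma enat_le_by_nat: "(\<And>n. enat n \<le> x \<Longrightarrow> enat n \<le> y) \<Longrightarrow> x \<le> y"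
proof (cases x)
  case infinity
  assume "\<And>n. enat n \<le> x \<Longrightarrow> enat n \<le> y"
  hence *: "enat n \<le> y" for n using infinity by simp
  have "y \<noteq> enat m" for m using *[of "Suc m"] by auto
  thus "x \<le> y" by (cases y) auto
qed auto

lemma enat_le_add_split:
  assumes "enat n \<le> x + y"
  obtains a b where "n = a + b" "enat a \<le> x" "enat b \<le> y"
proof (cases x)
  case x: (enat a)
  show ?thesis
  proof (cases y)
    case y: (enat b)
    show ?thesis by (rule that[of "min n a" "n - min n a"]) (use assms x y in auto)
  next
    case infinity
    show ?thesis by (rule that[of 0 n]) (use infinity in \<open>auto simp: zero_enat_def[symmetric]\<close>)
  qed
next
  case infinity
  show ?thesis by (rule that[of n 0]) (use infinity in \<open>auto simp: zero_enat_def[symmetric]\<close>)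
qed

lemma enat_add_finite: "x < \<infinity> \<Longrightarrow> y < \<infinity> \<Longrightarrow> x + y < (\<infinity> :: enat)"
  by (cases x; cases y) auto

lemma chain_length_le:
  assumes "\<And>X. P X \<Longrightarrow> Q (f X)" "\<And>X Y. P X \<Longrightarrow> P Y \<Longrightarrow> X \<subset> Y \<Longrightarrow> f X \<subset> f Y"
  shows "chain_length P \<le> chain_length Q"
  unfolding chain_length_def
proof (rule Sup_subset_mono, clarify)
  fix n C assume "\<forall>i\<le>n. P (C i)" "\<forall>i<n. C i \<subset> C (Suc i)"
  hence "(\<forall>i\<le>n. Q (f (C i))) \<and> (\<forall>i<n. f (C i) \<subset> f (C (Suc i)))" using assms by simp
  thus "\<exists>na. enat n = enat na \<and> (\<exists>C. (\<forall>i\<le>na. Q (C i)) \<and> (\<forall>i<na. C i \<subset> C (Suc i)))"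
    by (intro exI[of _ n] exI[of _ "f \<circ> C"]) auto
qed

text \<open>For submodules \<open>K \<subseteq> N\<close> this is the length of \<open>N / K\<close>. Working with intervals of submodules of one
fixed module replaces the isomorphism theorems by maps between chains.\<close>

definition interval_length ::
    "('a, 'r) ring_scheme \<Rightarrow> ('a, 'b, 'm) module_scheme \<Rightarrow> 'b set \<Rightarrow> 'b set \<Rightarrow> enat" where
  "interval_length R M K N = chain_length (\<lambda>C. submodule C R M \<and> K \<subseteq> C \<and> C \<subseteq> N)"

lemma interval_length_le:
  assumes "\<And>L. submodule L R M \<Longrightarrow> K \<subseteq> L \<Longrightarrow> L \<subseteq> N \<Longrightarrow> submodule (f L) R' M' \<and> K' \<subseteq> f L \<and> f L \<subseteq> N'"
    and "\<And>L L'. submodule L R M \<Longrightarrow> K \<subseteq> L \<Longrightarrow> submodule L' R M \<Longrightarrow> L' \<subseteq> N \<Longrightarrow> L \<subset> L' \<Longrightarrow> \<exists>z. z \<in> f L' \<and> z \<notin> f L"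
    and "mono f"
  shows "interval_length R M K N \<le> interval_length R' M' K' N'"
  unfolding interval_length_def
proof (rule chain_length_le[where f = f], use assms(1) in blast, elim conjE)
  fix X Y assume XY: "X \<subset> Y" "submodule X R M" "K \<subseteq> X" "X \<subseteq> N" "submodule Y R M" "K \<subseteq> Y" "Y \<subseteq> N"
  have "f X \<subseteq> f Y" using XY(1) monoD[OF assms(3)] by blast
  moreover have "f X \<noteq> f Y" using assms(2)[OF XY(2,3,5,7,1)] by blast
  ultimately show "f X \<subset> f Y" by blast
qed

lemma interval_length_mono:
  "K' \<subseteq> K \<Longrightarrow> N \<subseteq> N' \<Longrightarrow> interval_length R M K N \<le> interval_length R M K' N'"
  by (rule interval_length_le[where f = id]) (auto simp: mono_def)

context module
begin

lemma submodule_iff: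
  "submodule N R M \<longleftrightarrow> N \<subseteq> carrier M \<and> \<zero>\<^bsub>M\<^esub> \<in> N \<and> (\<forall>x\<in>N. \<forall>y\<in>N. x \<oplus>\<^bsub>M\<^esub> y \<in> N) \<and>
     (\<forall>a\<in>carrier R. \<forall>x\<in>N. a \<odot>\<^bsub>M\<^esub> x \<in> N)"
proof
  assume N: "submodule N R M"
  note E = submoduleE[OF N]
  obtain x where x: "x \<in> N" using E(2) by blast
  hence "\<zero> \<odot>\<^bsub>M\<^esub> x \<in> N" using E(4)[of \<zero> x] by simp
  hence "\<zero>\<^bsub>M\<^esub> \<in> N" using x E(1) by auto
  thus "N \<subseteq> carrier M \<and> \<zero>\<^bsub>M\<^esub> \<in> N \<and> (\<forall>x\<in>N. \<forall>y\<in>N. x \<oplus>\<^bsub>M\<^esub> y \<in> N) \<and>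
     (\<forall>a\<in>carrier R. \<forall>x\<in>N. a \<odot>\<^bsub>M\<^esub> x \<in> N)" using E by blast
next
  assume N: "N \<subseteq> carrier M \<and> \<zero>\<^bsub>M\<^esub> \<in> N \<and> (\<forall>x\<in>N. \<forall>y\<in>N. x \<oplus>\<^bsub>M\<^esub> y \<in> N) \<and>
     (\<forall>a\<in>carrier R. \<forall>x\<in>N. a \<odot>\<^bsub>M\<^esub> x \<in> N)"
  show "submodule N R M"
  proof (rule submoduleI)
    fix x assume x: "x \<in> N"
    have "\<ominus>\<^bsub>M\<^esub> x = (\<ominus> \<one>) \<odot>\<^bsub>M\<^esub> x" using N x smult_l_minus[of \<one> x] by auto
    thus "\<ominus>\<^bsub>M\<^esub> x \<in> N" using N x by simp
  qed (use N in auto)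
qed

lemma submodule_minus:
  assumes "submodule N R M" "x \<in> N" "y \<in> N"
  shows "x \<ominus>\<^bsub>M\<^esub> y \<in> N"
  using submoduleE[OF assms(1)] assms(2,3) by (simp add: M.minus_eq)

lemma submodule_add: "submodule N R M \<Longrightarrow> x \<in> N \<Longrightarrow> y \<in> N \<Longrightarrow> x \<oplus>\<^bsub>M\<^esub> y \<in> N"
  unfolding submodule_iff by blast

lemma submodule_smult: "submodule N R M \<Longrightarrow> a \<in> carrier R \<Longrightarrow> x \<in> N \<Longrightarrow> a \<odot>\<^bsub>M\<^esub> x \<in> N"
  unfolding submodule_iff by blast

lemma mem_set_add: "x \<in> A <+>\<^bsub>M\<^esub> B \<longleftrightarrow> (\<exists>a\<in>A. \<exists>b\<in>B. x = a \<oplus>\<^bsub>M\<^esub> b)"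
  unfolding set_add_def' by auto

lemma set_add_sub1: "A \<subseteq> carrier M \<Longrightarrow> submodule B R M \<Longrightarrow> A \<subseteq> A <+>\<^bsub>M\<^esub> B"
  unfolding submodule_iff subset_iff mem_set_add using M.r_zero by metis

lemma set_add_sub2: "submodule A R M \<Longrightarrow> B \<subseteq> carrier M \<Longrightarrow> B \<subseteq> A <+>\<^bsub>M\<^esub> B"
  unfolding submodule_iff subset_iff mem_set_add using M.l_zero by metis

lemma set_add_least:
  "A \<subseteq> C \<Longrightarrow> B \<subseteq> C \<Longrightarrow> submodule C R M \<Longrightarrow> A <+>\<^bsub>M\<^esub> B \<subseteq> C"
  unfolding submodule_iff by (auto simp: mem_set_add subset_iff)

lemma set_add_mono: "A \<subseteq> A' \<Longrightarrow> B \<subseteq> B' \<Longrightarrow> A <+>\<^bsub>M\<^esub> B \<subseteq> A' <+>\<^bsub>M\<^esub> B'"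
  unfolding subset_iff mem_set_add by blast

lemma set_add_comm:
  "A \<subseteq> carrier M \<Longrightarrow> B \<subseteq> carrier M \<Longrightarrow> A <+>\<^bsub>M\<^esub> B = B <+>\<^bsub>M\<^esub> A"
  unfolding set_eq_iff mem_set_add subset_iff using M.a_comm by metis

lemma set_add_assoc:
  assumes "A \<subseteq> carrier M" "B \<subseteq> carrier M" "C \<subseteq> carrier M"
  shows "(A <+>\<^bsub>M\<^esub> B) <+>\<^bsub>M\<^esub> C = A <+>\<^bsub>M\<^esub> (B <+>\<^bsub>M\<^esub> C)"
  unfolding set_add_def using assms by (intro M.add.set_mult_assoc) auto

lemma add_minus_left: "a \<in> carrier M \<Longrightarrow> b \<in> carrier M \<Longrightarrow> (a \<oplus>\<^bsub>M\<^esub> b) \<ominus>\<^bsub>M\<^esub> a = b"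
  by (metis M.a_assoc M.a_comm M.a_inv_closed M.minus_eq M.r_neg M.r_zero)

lemma add_minus_right: "a \<in> carrier M \<Longrightarrow> b \<in> carrier M \<Longrightarrow> (a \<oplus>\<^bsub>M\<^esub> b) \<ominus>\<^bsub>M\<^esub> b = a"
  by (metis M.a_assoc M.a_inv_closed M.minus_eq M.r_neg M.r_zero)

lemma minus_add_cancel: "a \<in> carrier M \<Longrightarrow> b \<in> carrier M \<Longrightarrow> (a \<ominus>\<^bsub>M\<^esub> b) \<oplus>\<^bsub>M\<^esub> b = a"
  by (metis M.a_assoc M.a_inv_closed M.minus_eq M.l_neg M.r_zero)

lemma submodule_set_add:
  assumes "submodule A R M" "submodule B R M"
  shows "submodule (A <+>\<^bsub>M\<^esub> B) R M"
proof -
  have A: "A \<subseteq> carrier M" "\<zero>\<^bsub>M\<^esub> \<in> A" "\<And>x y. x \<in> A \<Longrightarrow> y \<in> A \<Longrightarrow> x \<oplus>\<^bsub>M\<^esub> y \<in> A"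
      "\<And>a x. a \<in> carrier R \<Longrightarrow> x \<in> A \<Longrightarrow> a \<odot>\<^bsub>M\<^esub> x \<in> A"
    and B: "B \<subseteq> carrier M" "\<zero>\<^bsub>M\<^esub> \<in> B" "\<And>x y. x \<in> B \<Longrightarrow> y \<in> B \<Longrightarrow> x \<oplus>\<^bsub>M\<^esub> y \<in> B"
      "\<And>a x. a \<in> carrier R \<Longrightarrow> x \<in> B \<Longrightarrow> a \<odot>\<^bsub>M\<^esub> x \<in> B"
    using assms unfolding submodule_iff by blast+
  show ?thesis
    unfolding submodule_iff
  proof (intro conjI ballI)
    show "A <+>\<^bsub>M\<^esub> B \<subseteq> carrier M" using A(1) B(1) by (auto simp: mem_set_add subset_iff)
    show "\<zero>\<^bsub>M\<^esub> \<in> A <+>\<^bsub>M\<^esub> B" using A(2) B(2) M.r_zero[OF M.zero_closed] unfolding mem_set_add by metis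
  next
    fix x y assume "x \<in> A <+>\<^bsub>M\<^esub> B" "y \<in> A <+>\<^bsub>M\<^esub> B"
    then obtain a b c d where *: "x = a \<oplus>\<^bsub>M\<^esub> b" "y = c \<oplus>\<^bsub>M\<^esub> d" "a \<in> A" "c \<in> A" "b \<in> B" "d \<in> B"
      by (auto simp: mem_set_add)
    moreover have "a \<in> carrier M" "b \<in> carrier M" "c \<in> carrier M" "d \<in> carrier M" using * A B by auto
    ultimately have "x \<oplus>\<^bsub>M\<^esub> y = (a \<oplus>\<^bsub>M\<^esub> c) \<oplus>\<^bsub>M\<^esub> (b \<oplus>\<^bsub>M\<^esub> d)"
      by (simp add: M.a_ac)
    thus "x \<oplus>\<^bsub>M\<^esub> y \<in> A <+>\<^bsub>M\<^esub> B" using * A(3) B(3) unfolding mem_set_add by blast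
  next
    fix r x assume r: "r \<in> carrier R" and "x \<in> A <+>\<^bsub>M\<^esub> B"
    then obtain a b where *: "x = a \<oplus>\<^bsub>M\<^esub> b" "a \<in> A" "b \<in> B" by (auto simp: mem_set_add)
    hence "r \<odot>\<^bsub>M\<^esub> x = r \<odot>\<^bsub>M\<^esub> a \<oplus>\<^bsub>M\<^esub> r \<odot>\<^bsub>M\<^esub> b" using A(1) B(1) r smult_r_distr by blast
    thus "r \<odot>\<^bsub>M\<^esub> x \<in> A <+>\<^bsub>M\<^esub> B" using * A(4) B(4) r unfolding mem_set_add by blast
  qed
qed

lemma submodule_Int:
  "submodule A R M \<Longrightarrow> submodule B R M \<Longrightarrow> submodule (A \<inter> B) R M"
  unfolding submodule_iff by auto

lemma submodule_zero: "submodule {\<zero>\<^bsub>M\<^esub>} R M"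
  unfolding submodule_iff by auto

lemma submodule_subset_carrier: "submodule A R M \<Longrightarrow> A \<subseteq> carrier M"
  unfolding submodule_iff by auto

lemma modular_law:
  assumes "submodule A R M" "submodule C R M" "B \<subseteq> carrier M" "A \<subseteq> C"
  shows "(A <+>\<^bsub>M\<^esub> B) \<inter> C \<subseteq> A <+>\<^bsub>M\<^esub> (B \<inter> C)"
proof
  fix x assume x: "x \<in> (A <+>\<^bsub>M\<^esub> B) \<inter> C"
  then obtain a b where *: "x = a \<oplus>\<^bsub>M\<^esub> b" "a \<in> A" "b \<in> B" by (auto simp: mem_set_add)
  have c: "a \<in> carrier M" "b \<in> carrier M" using * assms submodule_subset_carrier by auto
  have "x \<ominus>\<^bsub>M\<^esub> a \<in> C" using x * assms(4) submodule_minus[OF assms(2)] by blast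
  moreover have "x \<ominus>\<^bsub>M\<^esub> a = b" using c * by (simp add: add_minus_left)
  ultimately show "x \<in> A <+>\<^bsub>M\<^esub> (B \<inter> C)" using * unfolding mem_set_add by blast
qed

lemma interval_length_extend:
  assumes "submodule K R M" "submodule A R M" "submodule B R M" "K \<subseteq> A" "A \<subset> B"
  shows "interval_length R M K A + 1 \<le> interval_length R M K B"
proof -
  have "enat n + 1 \<le> interval_length R M K B" if n: "enat n \<le> interval_length R M K A" for n
  proof -
    have PA: "submodule A R M \<and> K \<subseteq> A \<and> A \<subseteq> A" and PB: "submodule B R M \<and> K \<subseteq> B \<and> B \<subseteq> B"
      using assms by auto
    obtain C where C: "\<forall>i\<le>n. submodule (C i) R M \<and> K \<subseteq> C i \<and> C i \<subseteq> A" "\<forall>i<n. C i \<subset> C (Suc i)"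
      using n unfolding interval_length_def enat_le_chain_length_iff[of "\<lambda>C. submodule C R M \<and> K \<subseteq> C \<and> C \<subseteq> A", OF PA]
      by blast
    have "enat (Suc n) \<le> interval_length R M K B"
      unfolding interval_length_def enat_le_chain_length_iff[of "\<lambda>C. submodule C R M \<and> K \<subseteq> C \<and> C \<subseteq> B", OF PB]
      by (rule exI[of _ "\<lambda>i. if i \<le> n then C i else B"]) (use C assms in \<open>auto simp: le_Suc_eq less_Suc_eq subset_iff psubset_eq\<close>)
    thus ?thesis by (simp add: eSuc_enat[symmetric] plus_1_eSuc)
  qed
  note * = this
  show ?thesis
  proof (cases "interval_length R M K A")
    case (enat n)
    thus ?thesis using *[of n] by simp
  next
    case infinity
    have le: "enat n \<le> interval_length R M K B" for n
      by (rule order_trans[OF _ *[of n]]) (simp_all add: infinity)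
    have "\<infinity> \<le> interval_length R M K B" by (rule enat_le_by_nat) (rule le)
    thus ?thesis by simp
  qed
qed

text \<open>For the upper bound, every strict step of a chain remains strict after intersecting with \<open>L\<close> or
after adding \<open>L\<close>, by the modular law.\<close>

lemma interval_length_add:
  assumes K: "submodule K R M" and L: "submodule L R M" and N: "submodule N R M" and sub: "K \<subseteq> L" "L \<subseteq> N"
  shows "interval_length R M K N = interval_length R M K L + interval_length R M L N"
proof (rule antisym)
  have PK: "submodule K R M \<and> K \<subseteq> K \<and> K \<subseteq> N" "submodule K R M \<and> K \<subseteq> K \<and> K \<subseteq> L"
    and PL: "submodule L R M \<and> L \<subseteq> L \<and> L \<subseteq> N" using assms by auto
  note iff = enat_le_chain_length_iff[of "\<lambda>C. submodule C R M \<and> K \<subseteq> C \<and> C \<subseteq> N", OF PK(1)]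
    enat_le_chain_length_iff[of "\<lambda>C. submodule C R M \<and> K \<subseteq> C \<and> C \<subseteq> L", OF PK(2)]
    enat_le_chain_length_iff[of "\<lambda>C. submodule C R M \<and> L \<subseteq> C \<and> C \<subseteq> N", OF PL]
  show "interval_length R M K N \<le> interval_length R M K L + interval_length R M L N"
  proof (rule enat_le_by_nat)
    fix n assume "enat n \<le> interval_length R M K N"
    then obtain C where C: "\<forall>i\<le>n. submodule (C i) R M \<and> K \<subseteq> C i \<and> C i \<subseteq> N" "\<forall>i<n. C i \<subset> C (Suc i)"
      unfolding interval_length_def iff by blast
    have "enat i \<le> interval_length R M K (C i \<inter> L) + interval_length R M L (C i <+>\<^bsub>M\<^esub> L)" if "i \<le> n" for i
      using that
    proof (induction i)
      case 0
      then show ?case by (simp add: zero_enat_def[symmetric])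
    next
      case (Suc i)
      let ?A = "C i" and ?B = "C (Suc i)"
      have A: "submodule ?A R M" "K \<subseteq> ?A" "submodule ?B R M" "K \<subseteq> ?B" "?A \<subset> ?B" using C Suc.prems by auto
      have sm: "submodule (?A \<inter> L) R M" "submodule (?B \<inter> L) R M" "submodule (?A <+>\<^bsub>M\<^esub> L) R M" "submodule (?B <+>\<^bsub>M\<^esub> L) R M"
        using submodule_Int submodule_set_add A L by auto
      have i1: "?A \<inter> L \<subseteq> ?B \<inter> L" and i2: "?A <+>\<^bsub>M\<^esub> L \<subseteq> ?B <+>\<^bsub>M\<^esub> L" using A(5) set_add_mono[of ?A ?B L L] by auto
      have l1: "interval_length R M K (?A \<inter> L) \<le> interval_length R M K (?B \<inter> L)"
        and l2: "interval_length R M L (?A <+>\<^bsub>M\<^esub> L) \<le> interval_length R M L (?B <+>\<^bsub>M\<^esub> L)"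
        using interval_length_mono[OF _ i1, of K K] interval_length_mono[OF _ i2, of L L] by auto
      have "?A \<inter> L \<subset> ?B \<inter> L \<or> ?A <+>\<^bsub>M\<^esub> L \<subset> ?B <+>\<^bsub>M\<^esub> L"
      proof (rule ccontr)
        assume "\<not> ?thesis"
        hence eq: "?A \<inter> L = ?B \<inter> L" "?A <+>\<^bsub>M\<^esub> L = ?B <+>\<^bsub>M\<^esub> L" using i1 i2 by auto
        have "?B \<subseteq> (?A <+>\<^bsub>M\<^esub> L) \<inter> ?B" using eq(2) set_add_sub1[of ?B L] submodule_subset_carrier A L by auto
        also have "\<dots> \<subseteq> ?A <+>\<^bsub>M\<^esub> (L \<inter> ?B)" using A L submodule_subset_carrier by (intro modular_law) auto
        also have "\<dots> \<subseteq> ?A" using eq(1) A by (intro set_add_least) auto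
        finally show False using A(5) by auto
      qed
      hence step: "interval_length R M K (?A \<inter> L) + interval_length R M L (?A <+>\<^bsub>M\<^esub> L) + 1
        \<le> interval_length R M K (?B \<inter> L) + interval_length R M L (?B <+>\<^bsub>M\<^esub> L)"
      proof
        assume "?A \<inter> L \<subset> ?B \<inter> L"
        hence "interval_length R M K (?A \<inter> L) + 1 \<le> interval_length R M K (?B \<inter> L)"
          using K sm A(2) sub by (intro interval_length_extend) auto
        from add_mono[OF this l2] show ?thesis by (simp add: ac_simps)
      next
        assume "?A <+>\<^bsub>M\<^esub> L \<subset> ?B <+>\<^bsub>M\<^esub> L"
        hence "interval_length R M L (?A <+>\<^bsub>M\<^esub> L) + 1 \<le> interval_length R M L (?B <+>\<^bsub>M\<^esub> L)"
          using L sm A set_add_sub2[of ?A L] submodule_subset_carrier by (intro interval_length_extend) auto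
        from add_mono[OF l1 this] show ?thesis by (simp add: ac_simps)
      qed
      have Suc_eq: "enat (Suc i) = enat i + 1" by (simp add: eSuc_enat[symmetric] plus_1_eSuc)
      have "enat i + 1 \<le> interval_length R M K (?A \<inter> L) + interval_length R M L (?A <+>\<^bsub>M\<^esub> L) + 1"
        using Suc by (intro add_right_mono) auto
      thus ?case unfolding Suc_eq using step by (rule order_trans)
    qed
    from this[of n] have "enat n \<le> interval_length R M K (C n \<inter> L) + interval_length R M L (C n <+>\<^bsub>M\<^esub> L)" by simp
    also have "\<dots> \<le> interval_length R M K L + interval_length R M L N"
      using C N sub set_add_least[of "C n" N L] by (intro add_mono interval_length_mono) auto
    finally show "enat n \<le> interval_length R M K L + interval_length R M L N" .
  qed
  show "interval_length R M K L + interval_length R M L N \<le> interval_length R M K N"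
  proof (rule enat_le_by_nat)
    fix n assume "enat n \<le> interval_length R M K L + interval_length R M L N"
    then obtain a b where n: "n = a + b" "enat a \<le> interval_length R M K L" "enat b \<le> interval_length R M L N"
      by (rule enat_le_add_split)
    obtain C where C: "\<forall>i\<le>a. submodule (C i) R M \<and> K \<subseteq> C i \<and> C i \<subseteq> L" "\<forall>i<a. C i \<subset> C (Suc i)"
      using n(2) unfolding interval_length_def iff by blast
    obtain C' where C': "\<forall>i\<le>b. submodule (C' i) R M \<and> L \<subseteq> C' i \<and> C' i \<subseteq> N" "\<forall>i<b. C' i \<subset> C' (Suc i)"
      using n(3) unfolding interval_length_def iff by blast
    define E where "E i = (if i \<le> a then C i else C' (i - a))" for i
    have "E i \<subset> E (Suc i)" if "i < n" for i
    proof -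
      consider "i < a" | "i = a" | "i > a" by linarith
      thus ?thesis
      proof cases
        case 2
        hence "C i \<subseteq> L" "L \<subseteq> C' 0" "C' 0 \<subset> C' (Suc 0)" using C C' n that by auto
        thus ?thesis using 2 by (auto simp: E_def)
      next
        case 3
        hence "C' (i - a) \<subset> C' (Suc (i - a))" using C'(2) n that by simp
        thus ?thesis using 3 by (simp add: E_def Suc_diff_le)
      qed (use C in \<open>auto simp: E_def\<close>)
    qed
    moreover have "submodule (E i) R M \<and> K \<subseteq> E i \<and> E i \<subseteq> N" if "i \<le> n" for i
    proof (cases "i \<le> a")
      case True
      hence "submodule (C i) R M \<and> K \<subseteq> C i \<and> C i \<subseteq> L" using C(1) by blast
      thus ?thesis using True sub order_trans by (simp add: E_def) blast
    next
      case False
      hence "i - a \<le> b" using that n by simp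
      hence "submodule (C' (i - a)) R M \<and> L \<subseteq> C' (i - a) \<and> C' (i - a) \<subseteq> N" using C'(1) by blast
      thus ?thesis using False sub order_trans by (simp add: E_def) blast
    qed
    ultimately show "enat n \<le> interval_length R M K N" unfolding interval_length_def iff by blast
  qed
qed

lemma interval_length_self: "submodule K R M \<Longrightarrow> interval_length R M K K = 0"
proof -
  assume K: "submodule K R M"
  have P: "submodule K R M \<and> K \<subseteq> K \<and> K \<subseteq> K" using K by simp
  have "\<not> enat 1 \<le> interval_length R M K K"
    unfolding interval_length_def enat_le_chain_length_iff[of "\<lambda>C. submodule C R M \<and> K \<subseteq> C \<and> C \<subseteq> K", OF P]
  proof
    assume "\<exists>C. (\<forall>i\<le>1::nat. submodule (C i) R M \<and> K \<subseteq> C i \<and> C i \<subseteq> K) \<and> (\<forall>i<1. C i \<subset> C (Suc i))"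
    then obtain C where C: "\<forall>i\<le>1::nat. submodule (C i) R M \<and> K \<subseteq> C i \<and> C i \<subseteq> K" "\<forall>i<1. C i \<subset> C (Suc i)"
      by (elim exE conjE)
    have "K \<subseteq> C 0" "C (Suc 0) \<subseteq> K" "C 0 \<subset> C (Suc 0)" using C by simp_all
    thus False by blast
  qed
  thus ?thesis by (cases "interval_length R M K K") (simp_all add: zero_enat_def)
qed

text \<open>The second isomorphism theorem, in the form of two strictly monotone maps between the intervals.\<close>

lemma interval_length_diamond:
  assumes A: "submodule A R M" and B: "submodule B R M"
  shows "interval_length R M (A \<inter> B) A = interval_length R M B (A <+>\<^bsub>M\<^esub> B)"
proof (rule antisym)
  have cA: "A \<subseteq> carrier M" "B \<subseteq> carrier M" using A B submodule_subset_carrier by auto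
  show "interval_length R M (A \<inter> B) A \<le> interval_length R M B (A <+>\<^bsub>M\<^esub> B)"
  proof (rule interval_length_le[where f = "\<lambda>L. L <+>\<^bsub>M\<^esub> B"])
    fix L assume L: "submodule L R M" "A \<inter> B \<subseteq> L" "L \<subseteq> A"
    thus "submodule (L <+>\<^bsub>M\<^esub> B) R M \<and> B \<subseteq> L <+>\<^bsub>M\<^esub> B \<and> L <+>\<^bsub>M\<^esub> B \<subseteq> A <+>\<^bsub>M\<^esub> B"
      using submodule_set_add B set_add_sub2 cA set_add_mono[of L A B B] by auto
  next
    fix L L' assume L: "submodule L R M" "A \<inter> B \<subseteq> L" "submodule L' R M" "L' \<subseteq> A" "L \<subset> L'"
    show "\<exists>z. z \<in> L' <+>\<^bsub>M\<^esub> B \<and> z \<notin> L <+>\<^bsub>M\<^esub> B"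
    proof (rule ccontr)
      assume "\<not> ?thesis"
      hence "L' \<subseteq> (L <+>\<^bsub>M\<^esub> B) \<inter> L'" using set_add_sub1[of L' B] submodule_subset_carrier L B by auto
      also have "\<dots> \<subseteq> L <+>\<^bsub>M\<^esub> (B \<inter> L')" using L cA by (intro modular_law) auto
      also have "\<dots> \<subseteq> L" using L by (intro set_add_least) auto
      finally show False using L(5) by auto
    qed
  qed (simp add: mono_def set_add_mono)
  show "interval_length R M B (A <+>\<^bsub>M\<^esub> B) \<le> interval_length R M (A \<inter> B) A"
  proof (rule interval_length_le[where f = "\<lambda>L. L \<inter> A"])
    fix L assume L: "submodule L R M" "B \<subseteq> L" "L \<subseteq> A <+>\<^bsub>M\<^esub> B"
    thus "submodule (L \<inter> A) R M \<and> A \<inter> B \<subseteq> L \<inter> A \<and> L \<inter> A \<subseteq> A"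
      using submodule_Int A by auto
  next
    fix L L' assume L: "submodule L R M" "B \<subseteq> L" "submodule L' R M" "L' \<subseteq> A <+>\<^bsub>M\<^esub> B" "L \<subset> L'"
    show "\<exists>z. z \<in> L' \<inter> A \<and> z \<notin> L \<inter> A"
    proof (rule ccontr)
      assume n: "\<not> ?thesis"
      have "L' \<subseteq> L"
      proof
        fix x assume x: "x \<in> L'"
        then obtain a b where *: "x = a \<oplus>\<^bsub>M\<^esub> b" "a \<in> A" "b \<in> B" using subsetD[OF L(4) x] unfolding mem_set_add by blast
        have c: "a \<in> carrier M" "b \<in> carrier M" using * cA by auto
        have "x \<ominus>\<^bsub>M\<^esub> b \<in> L'" using x * L by (intro submodule_minus) auto
        moreover have "x \<ominus>\<^bsub>M\<^esub> b = a" using c * by (simp add: add_minus_right)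
        ultimately have "a \<in> L" using * n by auto
        moreover have "b \<in> L" using * L(2) by blast
        ultimately show "x \<in> L" using *(1) submodule_add[OF L(1)] by simp
      qed
      thus False using L(5) by auto
    qed
  qed (auto simp: mono_def)
qed

definition smult_image :: "'a \<Rightarrow> 'c set \<Rightarrow> 'c set" where
  "smult_image a N = (\<lambda>x. a \<odot>\<^bsub>M\<^esub> x) ` N"

definition smult_preimage :: "'a \<Rightarrow> 'c set \<Rightarrow> 'c set" where
  "smult_preimage a P = {x \<in> carrier M. a \<odot>\<^bsub>M\<^esub> x \<in> P}"

lemma submodule_smult_image:
  assumes "a \<in> carrier R" "submodule N R M"
  shows "submodule (smult_image a N) R M"
  unfolding submodule_iff
proof (intro conjI ballI)
  have N: "N \<subseteq> carrier M" "\<zero>\<^bsub>M\<^esub> \<in> N" "\<And>x y. x \<in> N \<Longrightarrow> y \<in> N \<Longrightarrow> x \<oplus>\<^bsub>M\<^esub> y \<in> N"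
      "\<And>a x. a \<in> carrier R \<Longrightarrow> x \<in> N \<Longrightarrow> a \<odot>\<^bsub>M\<^esub> x \<in> N"
    using assms(2) unfolding submodule_iff by blast+
  show "smult_image a N \<subseteq> carrier M" using N(1) assms(1) by (auto simp: smult_image_def)
  show "\<zero>\<^bsub>M\<^esub> \<in> smult_image a N" unfolding smult_image_def
    using N(2) assms(1) smult_r_null by (metis imageI)
  {
    fix x y assume "x \<in> smult_image a N" "y \<in> smult_image a N"
    then obtain x' y' where *: "x = a \<odot>\<^bsub>M\<^esub> x'" "y = a \<odot>\<^bsub>M\<^esub> y'" "x' \<in> N" "y' \<in> N" by (auto simp: smult_image_def)
    hence "x \<oplus>\<^bsub>M\<^esub> y = a \<odot>\<^bsub>M\<^esub> (x' \<oplus>\<^bsub>M\<^esub> y')" using N(1) assms(1) by (simp add: smult_r_distr subset_iff)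
    thus "x \<oplus>\<^bsub>M\<^esub> y \<in> smult_image a N" using N(3)[OF *(3,4)] by (auto simp: smult_image_def)
  }
  {
    fix r x assume r: "r \<in> carrier R" and "x \<in> smult_image a N"
    then obtain x' where *: "x = a \<odot>\<^bsub>M\<^esub> x'" "x' \<in> N" by (auto simp: smult_image_def)
    have "r \<odot>\<^bsub>M\<^esub> x = a \<odot>\<^bsub>M\<^esub> (r \<odot>\<^bsub>M\<^esub> x')"
      using * N(1) assms(1) r by (simp add: subset_iff smult_assoc1[symmetric] R.m_comm)
    thus "r \<odot>\<^bsub>M\<^esub> x \<in> smult_image a N" using N(4)[OF r *(2)] by (auto simp: smult_image_def)
  }
qed

lemma submodule_smult_preimage:
  assumes "a \<in> carrier R" "submodule P R M"
  shows "submodule (smult_preimage a P) R M"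
  unfolding submodule_iff
proof (intro conjI ballI)
  have P: "P \<subseteq> carrier M" "\<zero>\<^bsub>M\<^esub> \<in> P" "\<And>x y. x \<in> P \<Longrightarrow> y \<in> P \<Longrightarrow> x \<oplus>\<^bsub>M\<^esub> y \<in> P"
      "\<And>a x. a \<in> carrier R \<Longrightarrow> x \<in> P \<Longrightarrow> a \<odot>\<^bsub>M\<^esub> x \<in> P"
    using assms(2) unfolding submodule_iff by blast+
  show "smult_preimage a P \<subseteq> carrier M" by (auto simp: smult_preimage_def)
  show "\<zero>\<^bsub>M\<^esub> \<in> smult_preimage a P" using P(2) assms(1) by (simp add: smult_preimage_def)
  show "x \<oplus>\<^bsub>M\<^esub> y \<in> smult_preimage a P" if "x \<in> smult_preimage a P" "y \<in> smult_preimage a P" for x y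
    using that P(3) assms(1) by (auto simp: smult_preimage_def smult_r_distr)
  show "r \<odot>\<^bsub>M\<^esub> x \<in> smult_preimage a P" if r: "r \<in> carrier R" and x: "x \<in> smult_preimage a P" for r x
  proof -
    have "a \<odot>\<^bsub>M\<^esub> (r \<odot>\<^bsub>M\<^esub> x) = r \<odot>\<^bsub>M\<^esub> (a \<odot>\<^bsub>M\<^esub> x)"
      using x assms(1) r by (simp add: smult_preimage_def smult_assoc1[symmetric] R.m_comm)
    thus ?thesis using x P(4)[OF r] r by (simp add: smult_preimage_def)
  qed
qed

text \<open>Multiplication by \<open>a\<close> induces an isomorphism of \<open>M / (P : a)\<close> onto \<open>(a M + P) / P\<close>.\<close>

lemma interval_length_smult_image:
  assumes a: "a \<in> carrier R" and P: "submodule P R M"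
  shows "interval_length R M P (smult_image a (carrier M) <+>\<^bsub>M\<^esub> P) = interval_length R M (smult_preimage a P) (carrier M)"
proof (rule antisym)
  have cP: "P \<subseteq> carrier M" using P submodule_subset_carrier by auto
  show "interval_length R M P (smult_image a (carrier M) <+>\<^bsub>M\<^esub> P) \<le> interval_length R M (smult_preimage a P) (carrier M)"
  proof (rule interval_length_le[where f = "smult_preimage a"])
    fix L assume L: "submodule L R M" "P \<subseteq> L"
    thus "submodule (smult_preimage a L) R M \<and> smult_preimage a P \<subseteq> smult_preimage a L \<and> smult_preimage a L \<subseteq> carrier M"
      using submodule_smult_preimage[OF a] by (auto simp: smult_preimage_def)
  next
    fix L L' assume L: "submodule L R M" "P \<subseteq> L" "submodule L' R M" "L' \<subseteq> smult_image a (carrier M) <+>\<^bsub>M\<^esub> P" "L \<subset> L'"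
    then obtain z where z: "z \<in> L'" "z \<notin> L" by auto
    then obtain x p where *: "x \<in> carrier M" "p \<in> P" "z = a \<odot>\<^bsub>M\<^esub> x \<oplus>\<^bsub>M\<^esub> p"
      using subsetD[OF L(4) z(1)] unfolding mem_set_add smult_image_def by blast
    have c: "a \<odot>\<^bsub>M\<^esub> x \<in> carrier M" "p \<in> carrier M" using * cP a by auto
    have "z \<ominus>\<^bsub>M\<^esub> p \<in> L'" using z * L by (intro submodule_minus) auto
    moreover have "z \<ominus>\<^bsub>M\<^esub> p = a \<odot>\<^bsub>M\<^esub> x" using c * by (simp add: add_minus_right)
    moreover have "a \<odot>\<^bsub>M\<^esub> x \<notin> L"
    proof
      assume "a \<odot>\<^bsub>M\<^esub> x \<in> L"
      moreover have "p \<in> L" using * L(2) by blast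
      ultimately have "z \<in> L" using *(3) submodule_add[OF L(1)] by simp
      thus False using z by simp
    qed
    ultimately show "\<exists>z. z \<in> smult_preimage a L' \<and> z \<notin> smult_preimage a L"
      using *(1) by (intro exI[of _ x]) (auto simp: smult_preimage_def)
  qed (auto simp: mono_def smult_preimage_def)
  show "interval_length R M (smult_preimage a P) (carrier M) \<le> interval_length R M P (smult_image a (carrier M) <+>\<^bsub>M\<^esub> P)"
  proof (rule interval_length_le[where f = "\<lambda>L. smult_image a L <+>\<^bsub>M\<^esub> P"])
    fix L assume L: "submodule L R M" "L \<subseteq> carrier M"
    have "smult_image a L \<subseteq> smult_image a (carrier M)" using L(2) by (auto simp: smult_image_def)
    thus "submodule (smult_image a L <+>\<^bsub>M\<^esub> P) R M \<and> P \<subseteq> smult_image a L <+>\<^bsub>M\<^esub> P \<and>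
        smult_image a L <+>\<^bsub>M\<^esub> P \<subseteq> smult_image a (carrier M) <+>\<^bsub>M\<^esub> P"
      using submodule_set_add[OF submodule_smult_image[OF a L(1)] P] set_add_sub2[OF submodule_smult_image[OF a L(1)] cP]
        set_add_mono[of _ _ P P] by blast
  next
    fix L L' assume L: "submodule L R M" "smult_preimage a P \<subseteq> L" "submodule L' R M" "L' \<subseteq> carrier M" "L \<subset> L'"
    then obtain x where x: "x \<in> L'" "x \<notin> L" by auto
    have xc: "x \<in> carrier M" using x L by auto
    have "a \<odot>\<^bsub>M\<^esub> x \<in> smult_image a L' <+>\<^bsub>M\<^esub> P"
      using set_add_sub1[OF submodule_subset_carrier[OF submodule_smult_image[OF a L(3)]] P] x by (auto simp: smult_image_def)
    moreover have "a \<odot>\<^bsub>M\<^esub> x \<notin> smult_image a L <+>\<^bsub>M\<^esub> P"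
    proof
      assume "a \<odot>\<^bsub>M\<^esub> x \<in> smult_image a L <+>\<^bsub>M\<^esub> P"
      then obtain y p where y: "y \<in> L" "p \<in> P" "a \<odot>\<^bsub>M\<^esub> x = a \<odot>\<^bsub>M\<^esub> y \<oplus>\<^bsub>M\<^esub> p"
        unfolding mem_set_add smult_image_def by blast
      have c: "y \<in> carrier M" "p \<in> carrier M" using y L cP submodule_subset_carrier by auto
      have "a \<odot>\<^bsub>M\<^esub> (x \<ominus>\<^bsub>M\<^esub> y) = a \<odot>\<^bsub>M\<^esub> x \<ominus>\<^bsub>M\<^esub> a \<odot>\<^bsub>M\<^esub> y"
        using a c xc by (simp add: M.minus_eq smult_r_distr smult_r_minus)
      also have "\<dots> = p" using y(3) c a by (simp add: add_minus_left)
      finally have "x \<ominus>\<^bsub>M\<^esub> y \<in> L" using y(2) L(2) c xc by (auto simp: smult_preimage_def)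
      hence "(x \<ominus>\<^bsub>M\<^esub> y) \<oplus>\<^bsub>M\<^esub> y \<in> L" using y(1) by (rule submodule_add[OF L(1)])
      moreover have "(x \<ominus>\<^bsub>M\<^esub> y) \<oplus>\<^bsub>M\<^esub> y = x" using c xc by (simp add: minus_add_cancel)
      ultimately show False using x by simp
    qed
    ultimately show "\<exists>z. z \<in> smult_image a L' <+>\<^bsub>M\<^esub> P \<and> z \<notin> smult_image a L <+>\<^bsub>M\<^esub> P" by blast
  qed (simp add: mono_def smult_image_def set_add_mono image_mono)
qed

end

section \<open>Lengths of quotient modules\<close>

context module
begin

lemma abelian_subgroup_submodule:
  assumes "submodule K R M"
  shows "abelian_subgroup K M"
  by (rule abelian_subgroupI3[OF additive_subgroup.intro M.abelian_group_axioms])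
     (rule submodule.axioms(1)[OF assms])

lemma coset_eq_iff:
  assumes K: "submodule K R M" and x: "x \<in> carrier M" and y: "y \<in> carrier M"
  shows "K +>\<^bsub>M\<^esub> x = K +>\<^bsub>M\<^esub> y \<longleftrightarrow> x \<ominus>\<^bsub>M\<^esub> y \<in> K"
proof -
  interpret K: abelian_subgroup K M by (rule abelian_subgroup_submodule[OF K])
  have "x \<in> K +>\<^bsub>M\<^esub> y \<longleftrightarrow> x \<ominus>\<^bsub>M\<^esub> y \<in> K"
    unfolding M.minus_eq by (rule K.a_rcos_module[OF y x])
  thus ?thesis using K.a_rcos_self[OF x] K.a_repr_independence'[OF _ y] by metis
qed

lemma quotient_module_carrier: "X \<in> carrier (quotient_module M K) \<longleftrightarrow> (\<exists>x\<in>carrier M. X = K +>\<^bsub>M\<^esub> x)"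
  by (auto simp: quotient_module_def A_RCOSETS_def' a_r_coset_def')

lemma quotient_module_add:
  assumes "submodule K R M" "x \<in> carrier M" "y \<in> carrier M"
  shows "(K +>\<^bsub>M\<^esub> x) \<oplus>\<^bsub>quotient_module M K\<^esub> (K +>\<^bsub>M\<^esub> y) = K +>\<^bsub>M\<^esub> (x \<oplus>\<^bsub>M\<^esub> y)"
  using abelian_subgroup.a_rcos_sum[OF abelian_subgroup_submodule[OF assms(1)] assms(2,3)]
  by (simp add: quotient_module_def)

lemma quotient_module_smult:
  assumes K: "submodule K R M" and a: "a \<in> carrier R" and x: "x \<in> carrier M"
  shows "a \<odot>\<^bsub>quotient_module M K\<^esub> (K +>\<^bsub>M\<^esub> x) = K +>\<^bsub>M\<^esub> (a \<odot>\<^bsub>M\<^esub> x)"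
proof -
  interpret K: abelian_subgroup K M by (rule abelian_subgroup_submodule[OF K])
  have const: "K +>\<^bsub>M\<^esub> (a \<odot>\<^bsub>M\<^esub> z) = K +>\<^bsub>M\<^esub> (a \<odot>\<^bsub>M\<^esub> x)" if z: "z \<in> K +>\<^bsub>M\<^esub> x" for z
  proof -
    have zc: "z \<in> carrier M" using z x K.a_elemrcos_carrier by blast
    have "z \<ominus>\<^bsub>M\<^esub> x \<in> K" using z K.a_rcos_module[OF x zc] by (simp add: M.minus_eq)
    hence "a \<odot>\<^bsub>M\<^esub> (z \<ominus>\<^bsub>M\<^esub> x) \<in> K" by (rule submodule_smult[OF K a])
    moreover have "a \<odot>\<^bsub>M\<^esub> (z \<ominus>\<^bsub>M\<^esub> x) = a \<odot>\<^bsub>M\<^esub> z \<ominus>\<^bsub>M\<^esub> a \<odot>\<^bsub>M\<^esub> x"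
      using a x zc by (simp add: M.minus_eq smult_r_distr smult_r_minus)
    ultimately show ?thesis using a x zc by (simp add: coset_eq_iff[OF K])
  qed
  have "K +>\<^bsub>M\<^esub> x \<noteq> {}" using K.a_rcos_self[OF x] by blast
  hence "(\<Union>z\<in>K +>\<^bsub>M\<^esub> x. K +>\<^bsub>M\<^esub> (a \<odot>\<^bsub>M\<^esub> z)) = K +>\<^bsub>M\<^esub> (a \<odot>\<^bsub>M\<^esub> x)"
    by (rule SUP_eq_const) (rule const)
  thus ?thesis unfolding quotient_module_def by simp
qed

lemma module_quotient_module:
  assumes K: "submodule K R M"
  shows "module R (quotient_module M K)"
proof (rule moduleI)
  interpret K: abelian_subgroup K M by (rule abelian_subgroup_submodule[OF K])
  show "cring R" by (rule R.is_cring)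
  note simps = quotient_module_carrier quotient_module_add[OF K] quotient_module_smult[OF K]
  have zero: "\<zero>\<^bsub>quotient_module M K\<^esub> = K +>\<^bsub>M\<^esub> \<zero>\<^bsub>M\<^esub>"
    using submodule_subset_carrier[OF K] by (simp add: quotient_module_def)
  show "abelian_group (quotient_module M K)"
  proof (rule abelian_groupI)
    show "\<zero>\<^bsub>quotient_module M K\<^esub> \<in> carrier (quotient_module M K)"
      unfolding zero quotient_module_carrier by blast
  next
    fix x y assume "x \<in> carrier (quotient_module M K)" "y \<in> carrier (quotient_module M K)"
    then obtain x' y' where "x' \<in> carrier M" "x = K +>\<^bsub>M\<^esub> x'" "y' \<in> carrier M" "y = K +>\<^bsub>M\<^esub> y'"
      unfolding quotient_module_carrier by blast
    thus "x \<oplus>\<^bsub>quotient_module M K\<^esub> y \<in> carrier (quotient_module M K)"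
      and "x \<oplus>\<^bsub>quotient_module M K\<^esub> y = y \<oplus>\<^bsub>quotient_module M K\<^esub> x"
      by (auto simp: simps M.a_comm)
  next
    fix x y z assume "x \<in> carrier (quotient_module M K)" "y \<in> carrier (quotient_module M K)"
      "z \<in> carrier (quotient_module M K)"
    then obtain x' y' z' where "x' \<in> carrier M" "x = K +>\<^bsub>M\<^esub> x'" "y' \<in> carrier M" "y = K +>\<^bsub>M\<^esub> y'"
      "z' \<in> carrier M" "z = K +>\<^bsub>M\<^esub> z'"
      unfolding quotient_module_carrier by blast
    thus "x \<oplus>\<^bsub>quotient_module M K\<^esub> y \<oplus>\<^bsub>quotient_module M K\<^esub> z =
        x \<oplus>\<^bsub>quotient_module M K\<^esub> (y \<oplus>\<^bsub>quotient_module M K\<^esub> z)"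
      by (simp add: simps M.a_assoc)
  next
    fix x assume "x \<in> carrier (quotient_module M K)"
    then obtain x' where x': "x' \<in> carrier M" "x = K +>\<^bsub>M\<^esub> x'"
      unfolding quotient_module_carrier by blast
    thus "\<zero>\<^bsub>quotient_module M K\<^esub> \<oplus>\<^bsub>quotient_module M K\<^esub> x = x"
      unfolding zero by (simp add: quotient_module_add[OF K])
    have "(K +>\<^bsub>M\<^esub> (\<ominus>\<^bsub>M\<^esub> x')) \<oplus>\<^bsub>quotient_module M K\<^esub> x = \<zero>\<^bsub>quotient_module M K\<^esub>"
      unfolding zero x'(2) using x'(1) by (subst quotient_module_add[OF K]) (simp_all add: M.l_neg)
    moreover have "K +>\<^bsub>M\<^esub> (\<ominus>\<^bsub>M\<^esub> x') \<in> carrier (quotient_module M K)"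
      unfolding quotient_module_carrier using x'(1) by blast
    ultimately show "\<exists>y\<in>carrier (quotient_module M K). y \<oplus>\<^bsub>quotient_module M K\<^esub> x = \<zero>\<^bsub>quotient_module M K\<^esub>"
      by blast
  qed
  fix a b x y assume a: "a \<in> carrier R" and b: "b \<in> carrier R"
    and x: "x \<in> carrier (quotient_module M K)" and y: "y \<in> carrier (quotient_module M K)"
  obtain x' where x': "x' \<in> carrier M" "x = K +>\<^bsub>M\<^esub> x'" using x quotient_module_carrier by blast
  obtain y' where y': "y' \<in> carrier M" "y = K +>\<^bsub>M\<^esub> y'" using y quotient_module_carrier by blast
  show "a \<odot>\<^bsub>quotient_module M K\<^esub> x \<in> carrier (quotient_module M K)"
    using a x' by (auto simp: simps)
  show "(a \<oplus> b) \<odot>\<^bsub>quotient_module M K\<^esub> x =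
      a \<odot>\<^bsub>quotient_module M K\<^esub> x \<oplus>\<^bsub>quotient_module M K\<^esub> b \<odot>\<^bsub>quotient_module M K\<^esub> x"
    using a b x' by (simp add: simps smult_l_distr)
  show "a \<odot>\<^bsub>quotient_module M K\<^esub> (x \<oplus>\<^bsub>quotient_module M K\<^esub> y) =
      a \<odot>\<^bsub>quotient_module M K\<^esub> x \<oplus>\<^bsub>quotient_module M K\<^esub> a \<odot>\<^bsub>quotient_module M K\<^esub> y"
    using a x' y' by (simp add: simps smult_r_distr)
  show "(a \<otimes> b) \<odot>\<^bsub>quotient_module M K\<^esub> x = a \<odot>\<^bsub>quotient_module M K\<^esub> (b \<odot>\<^bsub>quotient_module M K\<^esub> x)"
    using a b x' by (simp add: simps smult_assoc1)
next
  fix x assume "x \<in> carrier (quotient_module M K)"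
  then obtain x' where "x' \<in> carrier M" "x = K +>\<^bsub>M\<^esub> x'" using quotient_module_carrier by blast
  thus "\<one> \<odot>\<^bsub>quotient_module M K\<^esub> x = x"
    by (simp add: quotient_module_smult[OF K])
qed

text \<open>Submodules of the quotient correspond to submodules above \<open>K\<close>, by preimages and images under the
coset map.\<close>

lemma module_length_quotient_carrier:
  assumes K: "submodule K R M"
  shows "module_length R (quotient_module M K) = interval_length R M K (carrier M)"
proof -
  let ?Q = "quotient_module M K"
  let ?c = "\<lambda>x. K +>\<^bsub>M\<^esub> x"
  interpret Q: module R ?Q by (rule module_quotient_module[OF K])
  note simps = quotient_module_add[OF K] quotient_module_smult[OF K]
  have Kc: "K \<subseteq> carrier M" by (rule submodule_subset_carrier[OF K])
  have zero: "\<zero>\<^bsub>?Q\<^esub> = ?c \<zero>\<^bsub>M\<^esub>"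
    using Kc by (simp add: quotient_module_def)
  have czero: "?c x = \<zero>\<^bsub>?Q\<^esub>" if "x \<in> K" for x
  proof -
    have "x \<ominus>\<^bsub>M\<^esub> \<zero>\<^bsub>M\<^esub> \<in> K" using that K submodule_minus[OF K that] unfolding submodule_iff by blast
    thus ?thesis unfolding zero using that Kc by (subst coset_eq_iff[OF K]) auto
  qed
  have len: "module_length R ?Q = chain_length (\<lambda>C. submodule C R ?Q)"
    unfolding module_length_def chain_length_def ..
  show ?thesis unfolding len interval_length_def
  proof (rule antisym)
    show "chain_length (\<lambda>C. submodule C R ?Q) \<le> chain_length (\<lambda>C. submodule C R M \<and> K \<subseteq> C \<and> C \<subseteq> carrier M)"
    proof (rule chain_length_le[where f = "\<lambda>X. {x \<in> carrier M. ?c x \<in> X}"])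
      fix X assume X: "submodule X R ?Q"
      have "submodule {x \<in> carrier M. ?c x \<in> X} R M"
        unfolding submodule_iff
      proof (intro conjI ballI)
        show "\<zero>\<^bsub>M\<^esub> \<in> {x \<in> carrier M. ?c x \<in> X}" using X zero unfolding Q.submodule_iff by simp
      next
        fix x y assume "x \<in> {x \<in> carrier M. ?c x \<in> X}" "y \<in> {x \<in> carrier M. ?c x \<in> X}"
        thus "x \<oplus>\<^bsub>M\<^esub> y \<in> {x \<in> carrier M. ?c x \<in> X}"
          using Q.submodule_add[OF X, of "?c x" "?c y"] by (simp add: simps)
      next
        fix a x assume "a \<in> carrier R" "x \<in> {x \<in> carrier M. ?c x \<in> X}"
        thus "a \<odot>\<^bsub>M\<^esub> x \<in> {x \<in> carrier M. ?c x \<in> X}"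
          using Q.submodule_smult[OF X, of a "?c x"] by (simp add: simps)
      qed auto
      moreover have "K \<subseteq> {x \<in> carrier M. ?c x \<in> X}"
        using czero Kc X unfolding Q.submodule_iff by auto
      ultimately show "submodule {x \<in> carrier M. ?c x \<in> X} R M \<and> K \<subseteq> {x \<in> carrier M. ?c x \<in> X} \<and> {x \<in> carrier M. ?c x \<in> X} \<subseteq> carrier M"
        by blast
    next
      fix X Y assume X: "submodule X R ?Q" and Y: "submodule Y R ?Q" and "X \<subset> Y"
      then obtain z where z: "z \<in> Y" "z \<notin> X" by blast
      then obtain x where "x \<in> carrier M" "z = ?c x"
        using Q.submodule_subset_carrier[OF Y] quotient_module_carrier by blast
      thus "{x \<in> carrier M. ?c x \<in> X} \<subset> {x \<in> carrier M. ?c x \<in> Y}" using z \<open>X \<subset> Y\<close> by blast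
    qed
    show "chain_length (\<lambda>C. submodule C R M \<and> K \<subseteq> C \<and> C \<subseteq> carrier M) \<le> chain_length (\<lambda>C. submodule C R ?Q)"
    proof (rule chain_length_le[where f = "\<lambda>L. ?c ` L"], elim conjE)
      fix L assume L: "submodule L R M" "K \<subseteq> L" "L \<subseteq> carrier M"
      show "submodule (?c ` L) R ?Q"
        unfolding Q.submodule_iff
      proof (intro conjI ballI)
        show "?c ` L \<subseteq> carrier ?Q" using L(3) quotient_module_carrier by blast
        show "\<zero>\<^bsub>?Q\<^esub> \<in> ?c ` L" unfolding zero using L(1) unfolding submodule_iff by blast
      next
        fix X Y assume "X \<in> ?c ` L" "Y \<in> ?c ` L"
        then obtain x y where "X = ?c x" "Y = ?c y" "x \<in> L" "y \<in> L" by blast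
        thus "X \<oplus>\<^bsub>?Q\<^esub> Y \<in> ?c ` L" using L(3) submodule_add[OF L(1)] by (auto simp: simps subset_iff)
      next
        fix a X assume "a \<in> carrier R" "X \<in> ?c ` L"
        then obtain x where "X = ?c x" "x \<in> L" by blast
        thus "a \<odot>\<^bsub>?Q\<^esub> X \<in> ?c ` L" using \<open>a \<in> carrier R\<close> L(3) submodule_smult[OF L(1)]
          by (auto simp: simps subset_iff)
      qed
    next
      fix L L' assume L: "submodule L R M \<and> K \<subseteq> L \<and> L \<subseteq> carrier M" "submodule L' R M \<and> K \<subseteq> L' \<and> L' \<subseteq> carrier M" "L \<subset> L'"
      then obtain z where z: "z \<in> L'" "z \<notin> L" by blast
      have "?c z \<notin> ?c ` L"
      proof
        assume "?c z \<in> ?c ` L"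
        then obtain y where y: "y \<in> L" "?c z = ?c y" by blast
        have c: "z \<in> carrier M" "y \<in> carrier M" using z y L by auto
        have "z \<ominus>\<^bsub>M\<^esub> y \<in> L" using y(2) L c by (auto simp: coset_eq_iff[OF K])
        hence "(z \<ominus>\<^bsub>M\<^esub> y) \<oplus>\<^bsub>M\<^esub> y \<in> L" using y(1) L(1) submodule_add by blast
        thus False using z c by (simp add: minus_add_cancel)
      qed
      thus "?c ` L \<subset> ?c ` L'" using z L(3) by blast
    qed
  qed
qed

lemma module_length_quotient_module:
  assumes N: "submodule N R M" and K: "submodule K R M" and sub: "K \<subseteq> N"
  shows "module_length R (quotient_module (M\<lparr>carrier := N\<rparr>) K) = interval_length R M K N"
proof -
  interpret N: module R "M\<lparr>carrier := N\<rparr>"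
    by (rule submodule.submodule_is_module[OF N module_axioms])
  have iff: "submodule C R (M\<lparr>carrier := N\<rparr>) \<longleftrightarrow> submodule C R M \<and> C \<subseteq> N" for C
    unfolding N.submodule_iff submodule_iff using submodule_subset_carrier[OF N] by auto
  have "module_length R (quotient_module (M\<lparr>carrier := N\<rparr>) K) = interval_length R (M\<lparr>carrier := N\<rparr>) K N"
    using N.module_length_quotient_carrier[of K] K sub by (simp add: iff)
  also have "\<dots> = interval_length R M K N"
    unfolding interval_length_def iff by (rule arg_cong[of _ _ chain_length]) auto
  finally show ?thesis .
qed

end

section \<open>Ideal powers and monomials\<close>

lemma ideal_subset_carrier: "ideal I R \<Longrightarrow> I \<subseteq> carrier R"
  by (rule additive_subgroup.a_subset[OF ideal.axioms(1)])

context module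
begin

lemma submodule_module_span: "S \<subseteq> carrier M \<Longrightarrow> submodule (module_span R M S) R M"
  unfolding module_span_def submodule_iff
  using carrier_is_submodule by (auto simp: submodule_iff)

lemma module_span_superset: "S \<subseteq> module_span R M S"
  unfolding module_span_def by blast

lemma module_span_least: "submodule N R M \<Longrightarrow> S \<subseteq> N \<Longrightarrow> module_span R M S \<subseteq> N"
  unfolding module_span_def by blast

lemma ideal_colon:
  assumes N: "N \<subseteq> carrier M" and C: "submodule C R M"
  shows "ideal {c \<in> carrier R. \<forall>y\<in>N. c \<odot>\<^bsub>M\<^esub> y \<in> C} R" (is "ideal ?C R")
proof (rule idealI)
  show "ring R" by (rule R.ring_axioms)
  show "subgroup ?C (add_monoid R)"
  proof (rule R.add.subgroupI, goal_cases)
    case 1 show ?case by auto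
    case 2
    have "\<zero>\<^bsub>R\<^esub> \<in> ?C" using N C unfolding submodule_iff by auto
    thus ?case by blast
  next
    case (3 c)
    thus ?case using N submoduleE(3)[OF C] by (auto simp: smult_l_minus subset_iff a_inv_def[symmetric])
  next
    case (4 c d)
    thus ?case using N submodule_add[OF C] by (auto simp: smult_l_distr subset_iff)
  qed
  fix c x assume "c \<in> ?C" and x: "x \<in> carrier R"
  hence c: "c \<in> carrier R" "\<And>y. y \<in> N \<Longrightarrow> c \<odot>\<^bsub>M\<^esub> y \<in> C" by auto
  show "x \<otimes>\<^bsub>R\<^esub> c \<in> ?C"
    using c x N submodule_smult[OF C x] by (auto simp: smult_assoc1 subset_iff)
  thus "c \<otimes>\<^bsub>R\<^esub> x \<in> ?C" using R.m_comm[OF c(1) x] by simp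
qed

lemma ideal_smult_generators: "I \<subseteq> carrier R \<Longrightarrow> N \<subseteq> carrier M \<Longrightarrow> {a \<odot>\<^bsub>M\<^esub> x | a x. a \<in> I \<and> x \<in> N} \<subseteq> carrier M"
  by auto

lemma submodule_ideal_smult: "I \<subseteq> carrier R \<Longrightarrow> N \<subseteq> carrier M \<Longrightarrow> submodule (ideal_smult R M I N) R M"
  unfolding ideal_smult_def by (rule submodule_module_span[OF ideal_smult_generators])

lemma ideal_smultI: "a \<in> I \<Longrightarrow> x \<in> N \<Longrightarrow> a \<odot>\<^bsub>M\<^esub> x \<in> ideal_smult R M I N"
  unfolding ideal_smult_def by (rule subsetD[OF module_span_superset]) blast

lemma ideal_smult_least:
  "submodule C R M \<Longrightarrow> (\<And>a x. a \<in> I \<Longrightarrow> x \<in> N \<Longrightarrow> a \<odot>\<^bsub>M\<^esub> x \<in> C) \<Longrightarrow> ideal_smult R M I N \<subseteq> C"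
  unfolding ideal_smult_def by (rule module_span_least) auto

lemma ideal_smult_subset: "I \<subseteq> carrier R \<Longrightarrow> submodule N R M \<Longrightarrow> ideal_smult R M I N \<subseteq> N"
  by (rule ideal_smult_least) (auto intro: submodule_smult)

lemma ideal_smult_mono:
  "I \<subseteq> I' \<Longrightarrow> N \<subseteq> N' \<Longrightarrow> I' \<subseteq> carrier R \<Longrightarrow> N' \<subseteq> carrier M \<Longrightarrow> ideal_smult R M I N \<subseteq> ideal_smult R M I' N'"
  by (rule ideal_smult_least[OF submodule_ideal_smult]) (auto intro: ideal_smultI)

lemma ideal_smult_one: "submodule N R M \<Longrightarrow> ideal_smult R M (carrier R) N = N"
proof (rule antisym[OF ideal_smult_subset])
  assume N: "submodule N R M"
  show "N \<subseteq> ideal_smult R M (carrier R) N"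
  proof
    fix x assume "x \<in> N"
    from ideal_smultI[OF R.one_closed this] show "x \<in> ideal_smult R M (carrier R) N"
      using \<open>x \<in> N\<close> submodule_subset_carrier[OF N] by auto
  qed
qed auto

lemma ideal_smult_prod:
  assumes I: "ideal I R" and K: "ideal K R" and N: "submodule N R M"
  shows "ideal_smult R M (I \<cdot>\<^bsub>R\<^esub> K) N = ideal_smult R M I (ideal_smult R M K N)"
proof (rule antisym)
  note Ic = ideal_subset_carrier[OF I] and Kc = ideal_subset_carrier[OF K] and Nc = submodule_subset_carrier[OF N]
  have IKc: "I \<cdot>\<^bsub>R\<^esub> K \<subseteq> carrier R" by (rule R.ideal_prod_in_carrier[OF I K])
  have sK: "submodule (ideal_smult R M K N) R M" by (rule submodule_ideal_smult[OF Kc Nc])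
  have sL: "submodule (ideal_smult R M I (ideal_smult R M K N)) R M"
    by (rule submodule_ideal_smult[OF Ic submodule_subset_carrier[OF sK]])
  have sR: "submodule (ideal_smult R M (I \<cdot>\<^bsub>R\<^esub> K) N) R M" by (rule submodule_ideal_smult[OF IKc Nc])
  show "ideal_smult R M (I \<cdot>\<^bsub>R\<^esub> K) N \<subseteq> ideal_smult R M I (ideal_smult R M K N)"
  proof (rule ideal_smult_least[OF sL])
    fix s x assume s: "s \<in> I \<cdot>\<^bsub>R\<^esub> K" and x: "x \<in> N"
    from s show "s \<odot>\<^bsub>M\<^esub> x \<in> ideal_smult R M I (ideal_smult R M K N)"
    proof (induction rule: ideal_prod.induct)
      case (prod i j)
      hence "(i \<otimes> j) \<odot>\<^bsub>M\<^esub> x = i \<odot>\<^bsub>M\<^esub> (j \<odot>\<^bsub>M\<^esub> x)"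
        using Ic Kc Nc x by (intro smult_assoc1) auto
      thus ?case using prod x by (simp add: ideal_smultI)
    next
      case (sum s1 s2)
      hence "(s1 \<oplus> s2) \<odot>\<^bsub>M\<^esub> x = s1 \<odot>\<^bsub>M\<^esub> x \<oplus>\<^bsub>M\<^esub> s2 \<odot>\<^bsub>M\<^esub> x"
        using IKc Nc x by (intro smult_l_distr) auto
      thus ?case using sum submodule_add[OF sL] by simp
    qed
  qed
  show "ideal_smult R M I (ideal_smult R M K N) \<subseteq> ideal_smult R M (I \<cdot>\<^bsub>R\<^esub> K) N"
  proof (rule ideal_smult_least[OF sR])
    fix i y assume i: "i \<in> I" and y: "y \<in> ideal_smult R M K N"
    have ic: "i \<in> carrier R" using i Ic by blast
    have "ideal_smult R M K N \<subseteq> smult_preimage i (ideal_smult R M (I \<cdot>\<^bsub>R\<^esub> K) N)"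
    proof (rule ideal_smult_least[OF submodule_smult_preimage[OF ic sR]])
      fix k x assume k: "k \<in> K" and x: "x \<in> N"
      have c: "k \<in> carrier R" "x \<in> carrier M" using k x Kc Nc by auto
      have "(i \<otimes> k) \<odot>\<^bsub>M\<^esub> x \<in> ideal_smult R M (I \<cdot>\<^bsub>R\<^esub> K) N"
        by (rule ideal_smultI[OF ideal_prod.prod[OF i k] x])
      thus "k \<odot>\<^bsub>M\<^esub> x \<in> smult_preimage i (ideal_smult R M (I \<cdot>\<^bsub>R\<^esub> K) N)"
        using c ic by (simp add: smult_preimage_def smult_assoc1)
    qed
    thus "i \<odot>\<^bsub>M\<^esub> y \<in> ideal_smult R M (I \<cdot>\<^bsub>R\<^esub> K) N" using y by (auto simp: smult_preimage_def)
  qed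
qed

end

context cring
begin

lemma ideals_set_simps [simp]: "I \<in> carrier (ideals_set R) \<longleftrightarrow> ideal I R" "I \<otimes>\<^bsub>ideals_set R\<^esub> K = I \<cdot> K"
  "\<one>\<^bsub>ideals_set R\<^esub> = carrier R"
  by (simp_all add: ideals_set_def)

lemma ideal_multi_power:
  assumes "\<And>l. ideal (J l) R"
  shows "ideal (multi_power R J u) R"
proof -
  interpret S: comm_monoid "ideals_set R" by (rule ideals_set_is_comm_monoid)
  have "multi_power R J u \<in> carrier (ideals_set R)"
    unfolding multi_power_def by (rule S.finprod_closed) (use assms in \<open>auto intro: S.nat_pow_closed\<close>)
  thus ?thesis by simp
qed

lemma ideal_nat_pow:
  assumes "ideal I R"
  shows "ideal (I [^]\<^bsub>ideals_set R\<^esub> (k::nat)) R"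
proof -
  interpret S: comm_monoid "ideals_set R" by (rule ideals_set_is_comm_monoid)
  show ?thesis using S.nat_pow_closed[of I k] assms by simp
qed

lemma multi_power_add:
  assumes "\<And>l. ideal (J l) R"
  shows "multi_power R J (\<lambda>l. u l + v l) = multi_power R J u \<cdot> multi_power R J v"
proof -
  interpret S: comm_monoid "ideals_set R" by (rule ideals_set_is_comm_monoid)
  have "multi_power R J (\<lambda>l. u l + v l) =
      (\<Otimes>\<^bsub>ideals_set R\<^esub>l\<in>UNIV. J l [^]\<^bsub>ideals_set R\<^esub> u l \<otimes>\<^bsub>ideals_set R\<^esub> J l [^]\<^bsub>ideals_set R\<^esub> v l)"
    unfolding multi_power_def
    by (rule S.finprod_cong') (use assms in \<open>auto simp del: ideals_set_simps(2) simp: S.nat_pow_mult\<close>)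
  also have "\<dots> = multi_power R J u \<otimes>\<^bsub>ideals_set R\<^esub> multi_power R J v"
    unfolding multi_power_def
    by (rule S.finprod_multf) (use assms in \<open>auto intro: S.nat_pow_closed\<close>)
  finally show ?thesis by simp
qed

lemma multi_power_basis_vec:
  assumes "\<And>l. ideal (J l) R"
  shows "multi_power R J (basis_vec j) = J j"
proof -
  interpret S: comm_monoid "ideals_set R" by (rule ideals_set_is_comm_monoid)
  have J: "J l \<in> carrier (ideals_set R)" for l using assms by simp
  have "multi_power R J (basis_vec j) = (\<Otimes>\<^bsub>ideals_set R\<^esub>l\<in>UNIV. if j = l then J l else \<one>\<^bsub>ideals_set R\<^esub>)"
    unfolding multi_power_def
    by (rule S.finprod_cong') (use J in \<open>auto simp: basis_vec_def simp del: ideals_set_simps\<close>)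
  also have "\<dots> = J j" by (rule S.finprod_singleton) (use assms in \<open>auto simp: oneideal\<close>)
  finally show ?thesis .
qed

lemma multi_power_zero:
  assumes "\<And>l. ideal (J l) R"
  shows "multi_power R J (\<lambda>_. 0) = carrier R"
proof -
  interpret S: comm_monoid "ideals_set R" by (rule ideals_set_is_comm_monoid)
  show ?thesis unfolding multi_power_def by (simp del: ideals_set_simps add: S.finprod_one_eqI) simp
qed

text \<open>The maximal ideal is adjoined to the family as the member with index \<open>None\<close>; this turns \<open>\<mm>\<^sup>k J\<^sup>u\<close> into a
single mixed power.\<close>

lemma multi_power_option:
  assumes "\<And>l. ideal (J l) R" "ideal \<mm> R"
  shows "multi_power R (case_option \<mm> J) (case_option k u) = (\<mm> [^]\<^bsub>ideals_set R\<^esub> k) \<cdot> multi_power R J u"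
proof -
  interpret S: comm_monoid "ideals_set R" by (rule ideals_set_is_comm_monoid)
  let ?f = "\<lambda>l. case_option \<mm> J l [^]\<^bsub>ideals_set R\<^esub> (case_option k u l :: nat)"
  have f: "?f l \<in> carrier (ideals_set R)" for l
    using assms by (intro S.nat_pow_closed) (auto split: option.splits)
  have "multi_power R (case_option \<mm> J) (case_option k u) = (\<Otimes>\<^bsub>ideals_set R\<^esub>l\<in>insert None (Some ` UNIV). ?f l)"
    unfolding multi_power_def UNIV_option_conv ..
  also have "\<dots> = ?f None \<otimes>\<^bsub>ideals_set R\<^esub> (\<Otimes>\<^bsub>ideals_set R\<^esub>l\<in>Some ` UNIV. ?f l)"
    by (rule S.finprod_insert) (use f[of None] f in \<open>auto simp: Pi_def simp del: ideals_set_simps\<close>)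
  also have "(\<Otimes>\<^bsub>ideals_set R\<^esub>l\<in>Some ` UNIV. ?f l) = (\<Otimes>\<^bsub>ideals_set R\<^esub>l\<in>UNIV. ?f (Some l))"
    by (rule S.finprod_reindex) (use f in \<open>auto simp: Pi_def simp del: ideals_set_simps\<close>)
  finally show ?thesis unfolding multi_power_def by simp
qed

end

text \<open>A finite list of generators for a finite family of ideals, where \<open>dir i\<close> tells which ideal the
generator \<open>a i\<close> belongs to.\<close>

locale ideal_powers = module R M for R :: "('a, 'r) ring_scheme" and M :: "('a, 'b, 'm) module_scheme" +
  fixes I :: "'t::finite \<Rightarrow> 'a set" and n :: nat and a :: "nat \<Rightarrow> 'a" and dir :: "nat \<Rightarrow> 't"
  assumes a_closed: "i < n \<Longrightarrow> a i \<in> carrier R"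
    and I_gen: "I d = genideal R {a i | i. i < n \<and> dir i = d}"
begin

lemma a_dir_closed: "{a i | i. i < n \<and> dir i = d} \<subseteq> carrier R"
  using a_closed by auto

lemma ideal_I: "ideal (I d) R"
  unfolding I_gen by (rule R.genideal_ideal[OF a_dir_closed])

lemma a_mem_I: "i < n \<Longrightarrow> a i \<in> I (dir i)"
  unfolding I_gen by (rule subsetD[OF R.genideal_self[OF a_dir_closed]]) blast

definition power_sub :: "('t \<Rightarrow> nat) \<Rightarrow> 'b set" where
  "power_sub w = ideal_smult R M (multi_power R I w) (carrier M)"

lemma submodule_power_sub: "submodule (power_sub w) R M"
  unfolding power_sub_def
  by (rule submodule_ideal_smult[OF ideal_subset_carrier[OF R.ideal_multi_power[OF ideal_I]]]) auto

lemma power_sub_add: "power_sub (\<lambda>d. v d + w d) = ideal_smult R M (multi_power R I v) (power_sub w)"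
  unfolding power_sub_def R.multi_power_add[OF ideal_I]
  by (rule ideal_smult_prod[OF R.ideal_multi_power[OF ideal_I] R.ideal_multi_power[OF ideal_I] carrier_is_submodule])

lemma power_sub_zero: "power_sub (\<lambda>_. 0) = carrier M"
  unfolding power_sub_def R.multi_power_zero[OF ideal_I] by (rule ideal_smult_one[OF carrier_is_submodule])

lemma power_sub_antimono: "(\<And>d. v d \<le> w d) \<Longrightarrow> power_sub w \<subseteq> power_sub v"
proof -
  assume "\<And>d. v d \<le> w d"
  hence "w = (\<lambda>d. (w d - v d) + v d)" by auto
  hence "power_sub w = ideal_smult R M (multi_power R I (\<lambda>d. w d - v d)) (power_sub v)"
    using power_sub_add[of "\<lambda>d. w d - v d" v] by simp
  thus ?thesis
    using ideal_smult_subset[OF ideal_subset_carrier[OF R.ideal_multi_power[OF ideal_I]] submodule_power_sub] by simp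
qed

definition mon :: "(nat \<Rightarrow> nat) \<Rightarrow> 'a" where
  "mon \<beta> = (\<Otimes>\<^bsub>R\<^esub>i\<in>{..<n}. a i [^]\<^bsub>R\<^esub> \<beta> i)"

lemma mon_closed [simp]: "mon \<beta> \<in> carrier R"
  unfolding mon_def by (rule R.finprod_closed) (auto simp: a_closed)

lemma mon_add: "mon (\<lambda>i. \<beta> i + \<gamma> i) = mon \<beta> \<otimes>\<^bsub>R\<^esub> mon \<gamma>"
proof -
  have "mon (\<lambda>i. \<beta> i + \<gamma> i) = (\<Otimes>\<^bsub>R\<^esub>i\<in>{..<n}. a i [^]\<^bsub>R\<^esub> \<beta> i \<otimes>\<^bsub>R\<^esub> a i [^]\<^bsub>R\<^esub> \<gamma> i)"
    unfolding mon_def by (rule R.finprod_cong') (auto simp: R.nat_pow_mult a_closed)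
  thus ?thesis unfolding mon_def by (subst R.finprod_multf[symmetric]) (auto simp: a_closed)
qed

lemma mon_zero: "mon (\<lambda>_. 0) = \<one>\<^bsub>R\<^esub>"
  unfolding mon_def by (simp add: R.finprod_one_eqI)

lemma mon_unit: "j < n \<Longrightarrow> mon (basis_vec j) = a j"
proof -
  assume j: "j < n"
  have "mon (basis_vec j) = (\<Otimes>\<^bsub>R\<^esub>i\<in>{..<n}. if j = i then a i else \<one>\<^bsub>R\<^esub>)"
    unfolding mon_def by (rule R.finprod_cong') (auto simp: basis_vec_def a_closed)
  also have "\<dots> = a j" by (rule R.finprod_singleton) (use j a_closed in auto)
  finally show ?thesis .
qed

definition mon_span :: "(nat \<Rightarrow> nat) set \<Rightarrow> 'b set" where
  "mon_span T = module_span R M {mon \<beta> \<odot>\<^bsub>M\<^esub> x | \<beta> x. \<beta> \<in> T \<and> x \<in> carrier M}"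

lemma submodule_mon_span: "submodule (mon_span T) R M"
  unfolding mon_span_def by (rule submodule_module_span) auto

lemma mon_spanI: "\<beta> \<in> T \<Longrightarrow> x \<in> carrier M \<Longrightarrow> mon \<beta> \<odot>\<^bsub>M\<^esub> x \<in> mon_span T"
  unfolding mon_span_def by (rule subsetD[OF module_span_superset]) blast

lemma mon_span_least:
  "submodule C R M \<Longrightarrow> (\<And>\<beta> x. \<beta> \<in> T \<Longrightarrow> x \<in> carrier M \<Longrightarrow> mon \<beta> \<odot>\<^bsub>M\<^esub> x \<in> C) \<Longrightarrow> mon_span T \<subseteq> C"
  unfolding mon_span_def by (rule module_span_least) auto

lemma mon_span_mono: "T \<subseteq> T' \<Longrightarrow> mon_span T \<subseteq> mon_span T'"
  by (rule mon_span_least[OF submodule_mon_span]) (auto intro: mon_spanI)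

lemma mon_span_empty: "mon_span {} = {\<zero>\<^bsub>M\<^esub>}"
  using mon_span_least[OF submodule_zero, of "{}"] submodule_mon_span[of "{}"] unfolding submodule_iff by auto

lemma mon_span_insert: "mon_span (insert \<beta> T) = smult_image (mon \<beta>) (carrier M) <+>\<^bsub>M\<^esub> mon_span T"
proof (rule antisym)
  have s: "submodule (smult_image (mon \<beta>) (carrier M)) R M"
    by (rule submodule_smult_image[OF mon_closed carrier_is_submodule])
  have sub1: "smult_image (mon \<beta>) (carrier M) \<subseteq> smult_image (mon \<beta>) (carrier M) <+>\<^bsub>M\<^esub> mon_span T"
    by (rule set_add_sub1[OF submodule_subset_carrier[OF s] submodule_mon_span])
  have sub2: "mon_span T \<subseteq> smult_image (mon \<beta>) (carrier M) <+>\<^bsub>M\<^esub> mon_span T"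
    by (rule set_add_sub2[OF s submodule_subset_carrier[OF submodule_mon_span]])
  show "mon_span (insert \<beta> T) \<subseteq> smult_image (mon \<beta>) (carrier M) <+>\<^bsub>M\<^esub> mon_span T"
  proof (rule mon_span_least[OF submodule_set_add[OF s submodule_mon_span]])
    fix \<gamma> x assume "\<gamma> \<in> insert \<beta> T" "x \<in> carrier M"
    thus "mon \<gamma> \<odot>\<^bsub>M\<^esub> x \<in> smult_image (mon \<beta>) (carrier M) <+>\<^bsub>M\<^esub> mon_span T"
      using sub1 sub2 mon_spanI[of \<gamma> T x] unfolding smult_image_def by blast
  qed
  show "smult_image (mon \<beta>) (carrier M) <+>\<^bsub>M\<^esub> mon_span T \<subseteq> mon_span (insert \<beta> T)"
    by (rule set_add_least[OF _ mon_span_mono submodule_mon_span])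
       (auto simp: smult_image_def intro: mon_spanI)
qed

lemma smult_mon_span:
  assumes "\<And>\<beta>. \<beta> \<in> T \<Longrightarrow> (\<lambda>i. \<delta> i + \<beta> i) \<in> T'" "y \<in> mon_span T"
  shows "mon \<delta> \<odot>\<^bsub>M\<^esub> y \<in> mon_span T'"
proof -
  have "mon_span T \<subseteq> smult_preimage (mon \<delta>) (mon_span T')"
  proof (rule mon_span_least[OF submodule_smult_preimage[OF mon_closed submodule_mon_span]])
    fix \<beta> x assume "\<beta> \<in> T" and x: "x \<in> carrier M"
    hence "mon (\<lambda>i. \<delta> i + \<beta> i) \<odot>\<^bsub>M\<^esub> x \<in> mon_span T'" using assms(1) by (intro mon_spanI) auto
    thus "mon \<beta> \<odot>\<^bsub>M\<^esub> x \<in> smult_preimage (mon \<delta>) (mon_span T')"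
      using x by (simp add: smult_preimage_def mon_add smult_assoc1)
  qed
  thus ?thesis using assms(2) by (auto simp: smult_preimage_def)
qed

abbreviation deg :: "(nat \<Rightarrow> nat) \<Rightarrow> 't \<Rightarrow> nat" where
  "deg \<equiv> mdeg dir n"

definition of_deg :: "('t \<Rightarrow> nat) \<Rightarrow> (nat \<Rightarrow> nat) set" where
  "of_deg w = {\<beta> \<in> monomials n. deg \<beta> = w}"

lemma finite_of_deg: "finite (of_deg w)"
  unfolding of_deg_def by (rule finite_monomials_mdeg)

lemma basis_vec_of_deg: "i < n \<Longrightarrow> basis_vec i \<in> of_deg (basis_vec (dir i))"
proof -
  assume i: "i < n"
  have "deg (basis_vec i) d = basis_vec (dir i) d" for d
    using i by (auto simp: mdeg_def basis_vec_def sum.If_cases Int_def conj_commute cong: conj_cong)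
  thus ?thesis using i by (auto simp: of_deg_def monomials_def basis_vec_def)
qed

lemma of_deg_add: "\<beta> \<in> of_deg v \<Longrightarrow> \<gamma> \<in> of_deg w \<Longrightarrow> (\<lambda>i. \<beta> i + \<gamma> i) \<in> of_deg (\<lambda>d. v d + w d)"
  by (auto simp: of_deg_def monomials_add mdeg_add fun_eq_iff)

text \<open>By induction on the size of \<open>w\<close>: multiplying by the ideal \<open>I d\<close> adds one generator of direction \<open>d\<close>
to each monomial, and every monomial of positive degree in direction \<open>d\<close> contains one.\<close>

lemma power_sub_eq_mon_span: "power_sub w = mon_span (of_deg w)"
proof (induction "vsize w" arbitrary: w)
  case 0
  hence w: "w = (\<lambda>_. 0)" by (auto simp: vsize_def fun_eq_iff)
  have "(\<lambda>_. 0) \<in> of_deg w" by (auto simp: w of_deg_def monomials_def)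
  hence "carrier M \<subseteq> mon_span (of_deg w)"
    using mon_spanI[of "\<lambda>_. 0" "of_deg w"] by (auto simp: mon_zero)
  thus ?case using submodule_subset_carrier[OF submodule_mon_span] by (auto simp: w power_sub_zero)
next
  case (Suc k)
  hence "\<exists>d. w d \<noteq> 0" unfolding vsize_def by (metis nat.distinct(1) sum.neutral)
  then obtain d where d: "w d \<noteq> 0" by blast
  define v where "v = w(d := w d - 1)"
  have w: "w = v(d := v d + 1)" and w': "w = (\<lambda>e. basis_vec d e + v e)"
    using d by (auto simp: v_def basis_vec_def)
  have "vsize w = vsize v + 1" unfolding w by (rule vsize_upd)
  hence IH: "power_sub v = mon_span (of_deg v)" using Suc by simp
  have "power_sub w = ideal_smult R M (I d) (mon_span (of_deg v))"
    unfolding w' power_sub_add R.multi_power_basis_vec[OF ideal_I] IH ..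
  also have "\<dots> = mon_span (of_deg w)"
  proof (rule antisym)
    let ?C = "{c \<in> carrier R. \<forall>y\<in>mon_span (of_deg v). c \<odot>\<^bsub>M\<^esub> y \<in> mon_span (of_deg w)}"
    have "I d \<subseteq> ?C"
      unfolding I_gen
    proof (rule R.genideal_minimal[OF ideal_colon[OF submodule_subset_carrier[OF submodule_mon_span] submodule_mon_span]], safe)
      fix i assume i: "i < n" "d = dir i"
      show "a i \<in> carrier R" by (rule a_closed[OF i(1)])
      fix y assume y: "y \<in> mon_span (of_deg v)"
      have "mon (basis_vec i) \<odot>\<^bsub>M\<^esub> y \<in> mon_span (of_deg w)"
        using of_deg_add[OF basis_vec_of_deg[OF i(1)], of _ v] y unfolding w' i(2) by (intro smult_mon_span) auto
      thus "a i \<odot>\<^bsub>M\<^esub> y \<in> mon_span (of_deg w)" by (simp add: mon_unit[OF i(1)])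
    qed
    thus "ideal_smult R M (I d) (mon_span (of_deg v)) \<subseteq> mon_span (of_deg w)"
      by (intro ideal_smult_least[OF submodule_mon_span]) auto
    have sI: "submodule (ideal_smult R M (I d) (mon_span (of_deg v))) R M"
      by (rule submodule_ideal_smult[OF ideal_subset_carrier[OF ideal_I] submodule_subset_carrier[OF submodule_mon_span]])
    show "mon_span (of_deg w) \<subseteq> ideal_smult R M (I d) (mon_span (of_deg v))"
    proof (rule mon_span_least[OF sI])
      fix \<beta> x assume \<beta>: "\<beta> \<in> of_deg w" and x: "x \<in> carrier M"
      have "deg \<beta> d \<noteq> 0" using \<beta> d by (auto simp: of_deg_def)
      then obtain i where i: "i < n" "dir i = d" "\<beta> i \<noteq> 0"
        unfolding mdeg_def by (metis (mono_tags, lifting) mem_Collect_eq sum.neutral)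
      define \<gamma> where "\<gamma> = \<beta>(i := \<beta> i - 1)"
      have \<beta>\<gamma>: "\<beta> = (\<lambda>k. basis_vec i k + \<gamma> k)" using i by (auto simp: \<gamma>_def basis_vec_def)
      have "\<gamma> \<in> monomials n" using \<beta> by (auto simp: \<gamma>_def of_deg_def monomials_def)
      moreover have "deg \<gamma> = v"
      proof
        fix e
        have "deg \<beta> e = deg (basis_vec i) e + deg \<gamma> e" unfolding \<beta>\<gamma> by (rule mdeg_add)
        moreover have "deg (basis_vec i) = basis_vec d" using basis_vec_of_deg[OF i(1)] i(2) by (simp add: of_deg_def)
        moreover have "deg \<beta> e = basis_vec d e + v e" using \<beta> w' by (auto simp: of_deg_def)
        ultimately show "deg \<gamma> e = v e" by simp
      qed
      ultimately have "\<gamma> \<in> of_deg v" by (simp add: of_deg_def)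
      hence "a i \<odot>\<^bsub>M\<^esub> (mon \<gamma> \<odot>\<^bsub>M\<^esub> x) \<in> ideal_smult R M (I d) (mon_span (of_deg v))"
        using a_mem_I[OF i(1)] i(2) x by (intro ideal_smultI mon_spanI) auto
      moreover have "mon \<beta> \<odot>\<^bsub>M\<^esub> x = a i \<odot>\<^bsub>M\<^esub> (mon \<gamma> \<odot>\<^bsub>M\<^esub> x)"
        unfolding \<beta>\<gamma> mon_add mon_unit[OF i(1)] using a_closed[OF i(1)] x by (simp add: smult_assoc1)
      ultimately show "mon \<beta> \<odot>\<^bsub>M\<^esub> x \<in> ideal_smult R M (I d) (mon_span (of_deg v))" by simp
    qed
  qed
  finally show ?case .
qed

lemma smult_power_sub:
  assumes "\<delta> \<in> of_deg v" "y \<in> power_sub w"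
  shows "mon \<delta> \<odot>\<^bsub>M\<^esub> y \<in> power_sub (\<lambda>d. v d + w d)"
  using assms of_deg_add[OF assms(1)] unfolding power_sub_eq_mon_span by (intro smult_mon_span) auto

end

section \<open>The lexicographic filtration\<close>

text \<open>The lexicographic order on functions is only partial, but exponents with support below \<open>n\<close> are
comparable.\<close>

lemma ex_lex_max:
  assumes "finite T" "T \<noteq> {}" "T \<subseteq> monomials n"
  shows "\<exists>\<beta>\<in>T. \<forall>\<gamma>\<in>T. \<gamma> = \<beta> \<or> less_fun \<gamma> \<beta>"
  using assms
proof (induction T rule: finite_ne_induct)
  case (insert x F)
  then obtain \<beta> where \<beta>: "\<beta> \<in> F" "\<forall>\<gamma>\<in>F. \<gamma> = \<beta> \<or> less_fun \<gamma> \<beta>" by auto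
  have "x \<in> monomials n" "\<beta> \<in> monomials n" using insert.prems \<beta>(1) by auto
  hence "x k = \<beta> k" if "\<not> k < n" for k using that by (simp add: monomials_def)
  hence "{k. x k \<noteq> \<beta> k} \<subseteq> {..<n}" by blast
  hence "finite {k. x k \<noteq> \<beta> k}" using finite_subset by blast
  hence tri: "less_fun x \<beta> \<or> x = \<beta> \<or> less_fun \<beta> x" by (rule less_fun_trichotomy)
  show ?case
  proof (cases "less_fun \<beta> x")
    case True
    have "\<gamma> = x \<or> less_fun \<gamma> x" if "\<gamma> \<in> insert x F" for \<gamma>
      using that \<beta>(2) True less_fun_trans[of \<gamma> \<beta> x] by auto
    thus ?thesis by blast
  next
    case False
    hence "\<gamma> = \<beta> \<or> less_fun \<gamma> \<beta>" if "\<gamma> \<in> insert x F" for \<gamma>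
      using that \<beta>(2) tri by auto
    thus ?thesis using \<beta>(1) by blast
  qed
qed simp

lemma less_fun_shift: "less_fun \<gamma> \<beta> \<Longrightarrow> less_fun (\<lambda>i. \<delta> i + \<gamma> i) (\<lambda>i. \<delta> i + \<beta> i :: nat)"
  unfolding less_fun_def by auto

context ideal_powers
begin

definition below :: "(nat \<Rightarrow> nat) \<Rightarrow> (nat \<Rightarrow> nat) set" where
  "below \<beta> = {\<gamma> \<in> of_deg (deg \<beta>). less_fun \<gamma> \<beta>}"

lemma below_sub: "\<beta> \<in> of_deg w \<Longrightarrow> below \<beta> \<subseteq> of_deg w"
  by (auto simp: below_def of_deg_def)

lemma finite_below: "finite (below \<beta>)"
  unfolding below_def using finite_of_deg by simp

lemma below_irrefl: "\<beta> \<notin> below \<beta>"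
  by (simp add: below_def less_fun_irrefl)

text \<open>The monomials of degree \<open>w\<close> are added in lexicographic order.\<close>

lemma lex_filtration_induct:
  assumes "P {}" "\<And>\<beta>. \<beta> \<in> of_deg w \<Longrightarrow> P (below \<beta>) \<Longrightarrow> P (insert \<beta> (below \<beta>))"
  shows "P (of_deg w)"
proof -
  have "P T" if "T \<subseteq> of_deg w" "\<And>\<beta>. \<beta> \<in> T \<Longrightarrow> below \<beta> \<subseteq> T" for T
    using that
  proof (induction "card T" arbitrary: T rule: less_induct)
    case less
    have fin: "finite T" using less.prems(1) finite_of_deg finite_subset by blast
    show ?case
    proof (cases "T = {}")
      case False
      have "T \<subseteq> monomials n" using less.prems(1) by (auto simp: of_deg_def)
      then obtain \<beta> where \<beta>: "\<beta> \<in> T" "\<forall>\<gamma>\<in>T. \<gamma> = \<beta> \<or> less_fun \<gamma> \<beta>"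
        using ex_lex_max[OF fin False] by blast
      have \<beta>w: "\<beta> \<in> of_deg w" using \<beta>(1) less.prems(1) by auto
      hence "T \<subseteq> insert \<beta> (below \<beta>)" using \<beta> less.prems(1) by (auto simp: below_def of_deg_def)
      hence T: "T = insert \<beta> (below \<beta>)" using \<beta>(1) less.prems(2)[of \<beta>] by auto
      have "card (below \<beta>) < card T" unfolding T using finite_below below_irrefl by (simp add: card_insert_if)
      moreover have "below \<gamma> \<subseteq> below \<beta>" if "\<gamma> \<in> below \<beta>" for \<gamma>
        using that less_fun_trans by (auto simp: below_def of_deg_def)
      ultimately have "P (below \<beta>)" using less.hyps[of "below \<beta>"] below_sub[OF \<beta>w] by blast
      thus ?thesis unfolding T by (rule assms(2)[OF \<beta>w])
    qed (use assms in simp)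
  qed
  moreover have "below \<beta> \<subseteq> of_deg w" if "\<beta> \<in> of_deg w" for \<beta> by (rule below_sub[OF that])
  ultimately show ?thesis by blast
qed

text \<open>Graded submodules of the multi-Rees module of \<open>M\<close>, given by their components \<open>B w\<close> inside \<open>M\<close>.\<close>

definition stable :: "(('t \<Rightarrow> nat) \<Rightarrow> 'b set) \<Rightarrow> bool" where
  "stable B \<longleftrightarrow> (\<forall>w. submodule (B w) R M) \<and>
     (\<forall>v w. \<forall>\<delta>\<in>of_deg v. \<forall>y\<in>B w. mon \<delta> \<odot>\<^bsub>M\<^esub> y \<in> B (\<lambda>d. v d + w d))"

lemma stableD: "stable B \<Longrightarrow> submodule (B w) R M"
  "stable B \<Longrightarrow> \<delta> \<in> of_deg v \<Longrightarrow> y \<in> B w \<Longrightarrow> mon \<delta> \<odot>\<^bsub>M\<^esub> y \<in> B (\<lambda>d. v d + w d)"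
  by (auto simp: stable_def)

text \<open>The module of leading coefficients at \<open>\<beta>\<close>: all \<open>x\<close> for which some element of \<open>B\<close> in the degree of \<open>\<beta>\<close>
has the form \<open>a\<^sup>\<beta> x\<close> plus terms that are lexicographically smaller.\<close>

definition lead :: "(('t \<Rightarrow> nat) \<Rightarrow> 'b set) \<Rightarrow> (nat \<Rightarrow> nat) \<Rightarrow> 'b set" where
  "lead B \<beta> = smult_preimage (mon \<beta>) (mon_span (below \<beta>) <+>\<^bsub>M\<^esub> B (deg \<beta>))"

lemma submodule_lead: "stable B \<Longrightarrow> submodule (lead B \<beta>) R M"
  unfolding lead_def
  by (intro submodule_smult_preimage submodule_set_add submodule_mon_span mon_closed) (rule stableD(1))

lemma shift_below:
  assumes "\<delta> \<in> of_deg v" "y \<in> mon_span (below \<beta>)"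
  shows "mon \<delta> \<odot>\<^bsub>M\<^esub> y \<in> mon_span (below (\<lambda>i. \<delta> i + \<beta> i))"
proof (rule smult_mon_span[OF _ assms(2)])
  fix \<gamma> assume "\<gamma> \<in> below \<beta>"
  hence \<gamma>: "\<gamma> \<in> of_deg (deg \<beta>)" "less_fun \<gamma> \<beta>" by (auto simp: below_def)
  have "deg (\<lambda>i. \<delta> i + \<beta> i) = (\<lambda>d. v d + deg \<beta> d)"
    using assms(1) by (auto simp: of_deg_def mdeg_add fun_eq_iff)
  thus "(\<lambda>i. \<delta> i + \<gamma> i) \<in> below (\<lambda>i. \<delta> i + \<beta> i)"
    using of_deg_add[OF assms(1) \<gamma>(1)] less_fun_shift[OF \<gamma>(2)] by (simp add: below_def)
qed

text \<open>Multiplication by a monomial respects the lexicographic order.\<close>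

lemma lead_mono:
  assumes B: "stable B" and \<delta>: "\<delta> \<in> monomials n"
  shows "lead B \<beta> \<subseteq> lead B (\<lambda>i. \<delta> i + \<beta> i)"
proof
  fix x assume "x \<in> lead B \<beta>"
  hence x: "x \<in> carrier M" "mon \<beta> \<odot>\<^bsub>M\<^esub> x \<in> mon_span (below \<beta>) <+>\<^bsub>M\<^esub> B (deg \<beta>)"
    by (auto simp: lead_def smult_preimage_def)
  then obtain s b where *: "s \<in> mon_span (below \<beta>)" "b \<in> B (deg \<beta>)" "mon \<beta> \<odot>\<^bsub>M\<^esub> x = s \<oplus>\<^bsub>M\<^esub> b"
    by (auto simp: mem_set_add)
  have \<delta>': "\<delta> \<in> of_deg (deg \<delta>)" using \<delta> by (simp add: of_deg_def)
  have c: "s \<in> carrier M" "b \<in> carrier M"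
    using * submodule_subset_carrier[OF submodule_mon_span] submodule_subset_carrier[OF stableD(1)[OF B]] by auto
  have "mon (\<lambda>i. \<delta> i + \<beta> i) \<odot>\<^bsub>M\<^esub> x = mon \<delta> \<odot>\<^bsub>M\<^esub> s \<oplus>\<^bsub>M\<^esub> mon \<delta> \<odot>\<^bsub>M\<^esub> b"
    using x(1) c by (simp add: mon_add smult_assoc1 *(3) smult_r_distr)
  moreover have "mon \<delta> \<odot>\<^bsub>M\<^esub> s \<in> mon_span (below (\<lambda>i. \<delta> i + \<beta> i))" by (rule shift_below[OF \<delta>' *(1)])
  moreover have "mon \<delta> \<odot>\<^bsub>M\<^esub> b \<in> B (deg (\<lambda>i. \<delta> i + \<beta> i))"
    using stableD(2)[OF B \<delta>' *(2)] by (simp add: mdeg_add[abs_def])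
  ultimately show "x \<in> lead B (\<lambda>i. \<delta> i + \<beta> i)"
    using x(1) unfolding lead_def smult_preimage_def mem_set_add by blast
qed

text \<open>Adding the monomial \<open>\<beta>\<close> to the smaller ones enlarges the submodule by a quotient of \<open>M\<close> under
multiplication with \<open>a\<^sup>\<beta>\<close>, whose kernel is \<open>lead B \<beta>\<close>.\<close>

theorem interval_length_lex_filtration:
  assumes B: "stable B"
  shows "interval_length R M (B w) (power_sub w <+>\<^bsub>M\<^esub> B w) =
     (\<Sum>\<beta>\<in>of_deg w. interval_length R M (lead B \<beta>) (carrier M))"
  unfolding power_sub_eq_mon_span
proof (induction rule: lex_filtration_induct)
  have sB: "submodule (B w) R M" by (rule stableD(1)[OF B])
  have cB: "B w \<subseteq> carrier M" by (rule submodule_subset_carrier[OF sB])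
  note cS = submodule_subset_carrier[OF submodule_mon_span]
  {
    case 1
    have "{\<zero>\<^bsub>M\<^esub>} <+>\<^bsub>M\<^esub> B w = B w"
      by (rule antisym[OF set_add_least[OF _ order_refl sB] set_add_sub2[OF submodule_zero cB]])
         (use sB in \<open>auto simp: submodule_iff\<close>)
    thus ?case by (simp add: mon_span_empty interval_length_self[OF sB])
  next
    case (2 \<beta>)
    let ?P = "mon_span (below \<beta>) <+>\<^bsub>M\<^esub> B w"
    let ?X = "smult_image (mon \<beta>) (carrier M)"
    have sX: "submodule ?X R M" by (rule submodule_smult_image[OF mon_closed carrier_is_submodule])
    have sP: "submodule ?P R M" by (rule submodule_set_add[OF submodule_mon_span sB])
    have eq: "mon_span (insert \<beta> (below \<beta>)) <+>\<^bsub>M\<^esub> B w = ?X <+>\<^bsub>M\<^esub> ?P"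
      unfolding mon_span_insert by (rule set_add_assoc[OF submodule_subset_carrier[OF sX] cS cB])
    have "interval_length R M (B w) (?X <+>\<^bsub>M\<^esub> ?P) =
        interval_length R M (B w) ?P + interval_length R M ?P (?X <+>\<^bsub>M\<^esub> ?P)"
      by (rule interval_length_add[OF sB sP submodule_set_add[OF sX sP] set_add_sub2[OF submodule_mon_span cB]
            set_add_sub2[OF sX submodule_subset_carrier[OF sP]]])
    also have "interval_length R M ?P (?X <+>\<^bsub>M\<^esub> ?P) = interval_length R M (lead B \<beta>) (carrier M)"
      using 2(1) unfolding lead_def by (simp add: interval_length_smult_image[OF mon_closed sP] of_deg_def)
    finally show ?case unfolding eq 2(2)
      using finite_below below_irrefl by (simp add: add.commute)
  }
qed

lemma lead_determined_by_cap:
  assumes wf: "wf {(L', L). submodule L R M \<and> submodule L' R M \<and> L \<subset> L'}" and B: "stable B"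
  shows "\<exists>N. \<forall>\<beta>\<in>monomials n. lead B \<beta> = lead B (\<lambda>i. min (\<beta> i) N)"
proof -
  define cut where "cut \<beta> = (\<lambda>i. if i < n then \<beta> i else (0::nat))" for \<beta>
  have cut: "cut \<beta> = \<beta>" if "\<beta> \<in> monomials n" for \<beta>
    using that by (auto simp: cut_def monomials_def fun_eq_iff)
  have "\<exists>N. \<forall>\<beta>\<in>monomials n. \<forall>N'\<ge>N. lead B (cut \<beta>) = lead B (cut (\<lambda>i. min (\<beta> i) N'))"
  proof (rule monotone_determined_by_cap[OF wf])
    fix \<beta> \<gamma> :: "nat \<Rightarrow> nat" assume le: "\<And>i. \<beta> i \<le> \<gamma> i"
    have "cut \<gamma> = (\<lambda>i. (cut \<gamma> i - cut \<beta> i) + cut \<beta> i)" using le by (auto simp: cut_def fun_eq_iff)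
    moreover have "(\<lambda>i. cut \<gamma> i - cut \<beta> i) \<in> monomials n" by (auto simp: cut_def monomials_def)
    ultimately have "lead B (cut \<beta>) \<subseteq> lead B (cut \<gamma>)" using lead_mono[OF B] by metis
    thus "lead B (cut \<beta>) = lead B (cut \<gamma>) \<or>
       (lead B (cut \<gamma>), lead B (cut \<beta>)) \<in> {(L', L). submodule L R M \<and> submodule L' R M \<and> L \<subset> L'}"
      using submodule_lead[OF B] by auto
  qed
  then obtain N where N: "\<And>\<beta>. \<beta> \<in> monomials n \<Longrightarrow> lead B (cut \<beta>) = lead B (cut (\<lambda>i. min (\<beta> i) N))" by blast
  have "lead B \<beta> = lead B (\<lambda>i. min (\<beta> i) N)" if \<beta>: "\<beta> \<in> monomials n" for \<beta>
  proof -
    have "(\<lambda>i. min (\<beta> i) N) \<in> monomials n" using \<beta> by (auto simp: monomials_def)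
    thus ?thesis using N[OF \<beta>] cut[OF \<beta>] cut by simp
  qed
  thus ?thesis by blast
qed

text \<open>The graded submodule \<open>F\<close> is finitely generated, as in the proof of Hilbert's basis theorem by
Groebner bases: the leading coefficient modules are determined by exponents bounded by \<open>N\<close>, so the
leading term of an element of \<open>F\<close> can be cancelled by a monomial multiple of an element of bounded
degree, and the lexicographic order of the monomials of one degree is a finite descent.\<close>

theorem stable_generated_in_bounded_degree:
  assumes wf: "wf {(L', L). submodule L R M \<and> submodule L' R M \<and> L \<subset> L'}" and F: "stable F"
    and sub: "\<And>w. F w \<subseteq> power_sub w"
  shows "\<exists>N. \<forall>w C. submodule C R M \<longrightarrow>
     (\<forall>v v' \<delta> \<beta> f. \<delta> \<in> of_deg v' \<longrightarrow> \<beta> \<in> of_deg v \<longrightarrow> (\<forall>i. \<beta> i \<le> N) \<longrightarrow> w = (\<lambda>d. v' d + v d) \<longrightarrow> f \<in> F v \<longrightarrow>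
        mon \<delta> \<odot>\<^bsub>M\<^esub> f \<in> C) \<longrightarrow> F w \<subseteq> C"
proof -
  obtain N where N: "\<And>\<beta>. \<beta> \<in> monomials n \<Longrightarrow> lead F \<beta> = lead F (\<lambda>i. min (\<beta> i) N)"
    using lead_determined_by_cap[OF wf F] by blast
  have main: "F w \<subseteq> C" if C: "submodule C R M" and gen: "\<And>v v' \<delta> \<beta> f. \<delta> \<in> of_deg v' \<Longrightarrow> \<beta> \<in> of_deg v \<Longrightarrow>
     (\<And>i. \<beta> i \<le> N) \<Longrightarrow> w = (\<lambda>d. v' d + v d) \<Longrightarrow> f \<in> F v \<Longrightarrow> mon \<delta> \<odot>\<^bsub>M\<^esub> f \<in> C" for w C
  proof -
    have Fw: "submodule (F w) R M" by (rule stableD(1)[OF F])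
    have "mon_span (of_deg w) \<inter> F w \<subseteq> C"
    proof (induction rule: lex_filtration_induct)
      case 1
      show ?case unfolding mon_span_empty using C unfolding submodule_iff by auto
    next
      case (2 \<beta>)
      have \<beta>m: "\<beta> \<in> monomials n" and \<beta>d: "deg \<beta> = w" using 2(1) by (auto simp: of_deg_def)
      show ?case
      proof
        fix z assume z: "z \<in> mon_span (insert \<beta> (below \<beta>)) \<inter> F w"
        then obtain x y where x: "x \<in> carrier M" and y: "y \<in> mon_span (below \<beta>)" and zxy: "z = mon \<beta> \<odot>\<^bsub>M\<^esub> x \<oplus>\<^bsub>M\<^esub> y"
          unfolding mon_span_insert by (auto simp: mem_set_add smult_image_def)
        have sS: "submodule (mon_span (below \<beta>)) R M" by (rule submodule_mon_span)
        have c: "y \<in> carrier M" "z \<in> carrier M" "mon \<beta> \<odot>\<^bsub>M\<^esub> x \<in> carrier M"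
          using y z x submodule_subset_carrier[OF sS] submodule_subset_carrier[OF Fw] by auto
        have "mon \<beta> \<odot>\<^bsub>M\<^esub> x = (\<ominus>\<^bsub>M\<^esub> y) \<oplus>\<^bsub>M\<^esub> z"
          using add_minus_right[OF c(3,1)] c unfolding zxy[symmetric] by (simp add: M.minus_eq M.a_comm)
        hence "x \<in> lead F \<beta>"
          using x z submoduleE(3)[OF sS y] unfolding lead_def smult_preimage_def mem_set_add \<beta>d by blast
        \<comment> \<open>The coefficient of the leading term of \<open>z\<close> also occurs at the truncated exponent \<open>\<beta>0\<close>.\<close>
        define \<beta>0 where "\<beta>0 = (\<lambda>i. min (\<beta> i) N)"
        define \<delta> where "\<delta> = (\<lambda>i. \<beta> i - \<beta>0 i)"
        have \<beta>: "\<beta> = (\<lambda>i. \<delta> i + \<beta>0 i)" by (auto simp: \<delta>_def \<beta>0_def)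
        have \<delta>m: "\<delta> \<in> of_deg (deg \<delta>)" and \<beta>0m: "\<beta>0 \<in> of_deg (deg \<beta>0)"
          using \<beta>m by (auto simp: \<delta>_def \<beta>0_def of_deg_def monomials_def)
        have w: "w = (\<lambda>d. deg \<delta> d + deg \<beta>0 d)" unfolding \<beta>d[symmetric] by (subst \<beta>) (simp add: mdeg_add[abs_def])
        have "x \<in> lead F \<beta>0" using \<open>x \<in> lead F \<beta>\<close> N[OF \<beta>m] by (simp add: \<beta>0_def)
        then obtain s f where s: "s \<in> mon_span (below \<beta>0)" and f: "f \<in> F (deg \<beta>0)" and sf: "mon \<beta>0 \<odot>\<^bsub>M\<^esub> x = s \<oplus>\<^bsub>M\<^esub> f"
          unfolding lead_def smult_preimage_def by (auto simp: mem_set_add)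
        have c': "s \<in> carrier M" "f \<in> carrier M"
          using s f submodule_subset_carrier[OF submodule_mon_span] submodule_subset_carrier[OF stableD(1)[OF F]] by auto
        have mx: "mon \<beta> \<odot>\<^bsub>M\<^esub> x = mon \<delta> \<odot>\<^bsub>M\<^esub> s \<oplus>\<^bsub>M\<^esub> mon \<delta> \<odot>\<^bsub>M\<^esub> f"
          using x c' by (subst \<beta>) (simp add: mon_add smult_assoc1 sf smult_r_distr)
        \<comment> \<open>Subtracting \<open>g\<close> from \<open>z\<close> cancels the leading term and stays in \<open>F w\<close>.\<close>
        define g where "g = mon \<delta> \<odot>\<^bsub>M\<^esub> f"
        have gC: "g \<in> C" unfolding g_def
          by (rule gen[OF \<delta>m \<beta>0m _ w f]) (simp add: \<beta>0_def)
        have gF: "g \<in> F w" unfolding g_def w by (rule stableD(2)[OF F \<delta>m f])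
        have "mon \<delta> \<odot>\<^bsub>M\<^esub> s \<in> mon_span (below \<beta>)" using shift_below[OF \<delta>m s] \<beta> by simp
        hence t: "mon \<delta> \<odot>\<^bsub>M\<^esub> s \<oplus>\<^bsub>M\<^esub> y \<in> mon_span (below \<beta>)" using y by (rule submodule_add[OF sS])
        have gc: "g \<in> carrier M" using gF submodule_subset_carrier[OF Fw] by auto
        have zg: "z = (mon \<delta> \<odot>\<^bsub>M\<^esub> s \<oplus>\<^bsub>M\<^esub> y) \<oplus>\<^bsub>M\<^esub> g"
          unfolding zxy mx g_def[symmetric] using c c' gc by (simp add: M.a_ac)
        have "mon \<delta> \<odot>\<^bsub>M\<^esub> s \<oplus>\<^bsub>M\<^esub> y = z \<ominus>\<^bsub>M\<^esub> g"
          unfolding zg using c c' gc by (simp add: add_minus_right)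
        hence "mon \<delta> \<odot>\<^bsub>M\<^esub> s \<oplus>\<^bsub>M\<^esub> y \<in> F w" using submodule_minus[OF Fw, of z g] z gF by simp
        hence "mon \<delta> \<odot>\<^bsub>M\<^esub> s \<oplus>\<^bsub>M\<^esub> y \<in> C" using t 2(2) by blast
        thus "z \<in> C" unfolding zg using gC by (rule submodule_add[OF C])
      qed
    qed
    thus ?thesis using sub[of w] unfolding power_sub_eq_mon_span by blast
  qed
  show ?thesis
  proof (rule exI[of _ N], intro allI impI)
    fix w C assume C: "submodule C R M" and gen: "\<forall>v v' \<delta> \<beta> f. \<delta> \<in> of_deg v' \<longrightarrow> \<beta> \<in> of_deg v \<longrightarrow>
      (\<forall>i. \<beta> i \<le> N) \<longrightarrow> w = (\<lambda>d. v' d + v d) \<longrightarrow> f \<in> F v \<longrightarrow> mon \<delta> \<odot>\<^bsub>M\<^esub> f \<in> C"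
    show "F w \<subseteq> C" by (rule main[OF C], rule gen[rule_format])
  qed
qed

text \<open>The quotients \<open>M / lead B \<beta>\<close> are annihilated by the ideal \<open>I e\<close>, which bounds their lengths. The
function \<open>\<l>\<close> ignores exponents from \<open>n\<close> on, so that it can be summed over monomials with an extra
variable.\<close>

lemma lead_length_antitone:
  assumes B: "stable B" and fin: "interval_length R M (power_sub (basis_vec e)) (carrier M) < \<infinity>"
    and B_sup: "\<And>w. power_sub (\<lambda>d. basis_vec e d + w d) \<subseteq> B w"
  obtains \<l> :: "(nat \<Rightarrow> nat) \<Rightarrow> nat" where
    "\<And>\<beta> \<gamma>. (\<And>i. \<beta> i \<le> \<gamma> i) \<Longrightarrow> \<l> \<gamma> \<le> \<l> \<beta>"
    "\<And>\<beta> t. \<l> (\<beta>(n := t)) = \<l> \<beta>"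
    "\<And>w. interval_length R M (B w) (power_sub w <+>\<^bsub>M\<^esub> B w) = enat (monomial_sum dir n \<l> w)"
proof -
  define cut where "cut \<beta> = (\<lambda>i. if i < n then \<beta> i else (0::nat))" for \<beta>
  have cut: "cut \<beta> = \<beta>" if "\<beta> \<in> monomials n" for \<beta>
    using that by (auto simp: cut_def monomials_def fun_eq_iff)
  define \<l> where "\<l> \<beta> = the_enat (interval_length R M (lead B (cut \<beta>)) (carrier M))" for \<beta>
  have bound: "power_sub (basis_vec e) \<subseteq> lead B \<beta>" if "\<beta> \<in> monomials n" for \<beta>
  proof
    fix x assume x: "x \<in> power_sub (basis_vec e)"
    have \<beta>: "\<beta> \<in> of_deg (deg \<beta>)" using that by (simp add: of_deg_def)
    have "mon \<beta> \<odot>\<^bsub>M\<^esub> x \<in> power_sub (\<lambda>d. deg \<beta> d + basis_vec e d)" by (rule smult_power_sub[OF \<beta> x])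
    hence "mon \<beta> \<odot>\<^bsub>M\<^esub> x \<in> B (deg \<beta>)" using B_sup[of "deg \<beta>"] by (auto simp: add.commute)
    hence "mon \<beta> \<odot>\<^bsub>M\<^esub> x \<in> mon_span (below \<beta>) <+>\<^bsub>M\<^esub> B (deg \<beta>)"
      using set_add_sub2[OF submodule_mon_span submodule_subset_carrier[OF stableD(1)[OF B]]] by blast
    thus "x \<in> lead B \<beta>"
      using x submodule_subset_carrier[OF submodule_power_sub] unfolding lead_def smult_preimage_def by blast
  qed
  have cutm: "cut \<beta> \<in> monomials n" for \<beta> by (auto simp: cut_def monomials_def)
  have l: "interval_length R M (lead B (cut \<beta>)) (carrier M) = enat (\<l> \<beta>)" for \<beta>
  proof -
    have "interval_length R M (lead B (cut \<beta>)) (carrier M) < \<infinity>"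
      by (rule le_less_trans[OF interval_length_mono[OF bound[OF cutm] order_refl] fin])
    thus ?thesis unfolding \<l>_def by (cases "interval_length R M (lead B (cut \<beta>)) (carrier M)") auto
  qed
  show thesis
  proof (rule that[of \<l>])
    fix \<beta> \<gamma> :: "nat \<Rightarrow> nat" assume le: "\<And>i. \<beta> i \<le> \<gamma> i"
    have "cut \<gamma> = (\<lambda>i. (cut \<gamma> i - cut \<beta> i) + cut \<beta> i)" using le by (auto simp: cut_def fun_eq_iff)
    moreover have "(\<lambda>i. cut \<gamma> i - cut \<beta> i) \<in> monomials n" by (auto simp: cut_def monomials_def)
    ultimately have "lead B (cut \<beta>) \<subseteq> lead B (cut \<gamma>)" using lead_mono[OF B] by metis
    hence "enat (\<l> \<gamma>) \<le> enat (\<l> \<beta>)" unfolding l[symmetric] by (rule interval_length_mono) simp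
    thus "\<l> \<gamma> \<le> \<l> \<beta>" by simp
  next
    fix \<beta> t
    have "cut (\<beta>(n := t)) = cut \<beta>" by (auto simp: cut_def)
    thus "\<l> (\<beta>(n := t)) = \<l> \<beta>" by (simp add: \<l>_def)
  next
    fix w
    have "(\<Sum>\<beta>\<in>of_deg w. interval_length R M (lead B \<beta>) (carrier M)) = (\<Sum>\<beta>\<in>of_deg w. enat (\<l> \<beta>))"
      by (rule sum.cong) (auto simp: l[symmetric] cut of_deg_def)
    also have "\<dots> = enat (\<Sum>\<beta>\<in>of_deg w. \<l> \<beta>)"
      using finite_of_deg[of w] by (induction rule: finite_induct) (auto simp: zero_enat_def)
    finally show "interval_length R M (B w) (power_sub w <+>\<^bsub>M\<^esub> B w) = enat (monomial_sum dir n \<l> w)"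
      unfolding interval_length_lex_filtration[OF B] monomial_sum_def of_deg_def .
  qed
qed

text \<open>The length is the sum over \<open>k \<le> w e\<close> of the lengths of the successive quotients in direction \<open>e\<close>. An
additional variable of direction \<open>e\<close>, on which the summand does not depend, turns this double sum
into a single sum over monomials. The family \<open>G\<close> is the part that is factored out in all degrees of
direction \<open>e\<close>.\<close>

theorem separable_hilbert_function:
  assumes sG: "\<And>w. submodule (G w) R M"
    and shift: "\<And>v w \<delta> y. \<delta> \<in> of_deg v \<Longrightarrow> y \<in> G w \<Longrightarrow> mon \<delta> \<odot>\<^bsub>M\<^esub> y \<in> G (\<lambda>d. v d + w d)"
    and Ge: "\<And>w x. G (w(e := x)) = G w" and Gsub: "\<And>w. G w \<subseteq> power_sub (w(e := 0))"
    and fin: "interval_length R M (power_sub (basis_vec e)) (carrier M) < \<infinity>"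
  obtains h where "separable (\<lambda>w. of_nat (h w))"
    "\<And>w. interval_length R M (power_sub (w(e := w e + 1)) <+>\<^bsub>M\<^esub> G w) (power_sub (w(e := 0))) = enat (h w)"
proof -
  define B where "B w = power_sub (w(e := w e + 1)) <+>\<^bsub>M\<^esub> G w" for w
  note sp = submodule_power_sub and cp = submodule_subset_carrier[OF submodule_power_sub]
  have cG: "G w \<subseteq> carrier M" for w by (rule submodule_subset_carrier[OF sG])
  have up: "w(e := w e + 1) = (\<lambda>d. basis_vec e d + w d)" for w by (auto simp: basis_vec_def)
  have B: "stable B"
    unfolding stable_def
  proof (intro conjI allI ballI)
    show "submodule (B w) R M" for w unfolding B_def by (rule submodule_set_add[OF sp sG])
    fix v w \<delta> y assume \<delta>: "\<delta> \<in> of_deg v" and y: "y \<in> B w"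
    then obtain p g where pg: "p \<in> power_sub (w(e := w e + 1))" "g \<in> G w" "y = p \<oplus>\<^bsub>M\<^esub> g"
      by (auto simp: B_def mem_set_add)
    have "mon \<delta> \<odot>\<^bsub>M\<^esub> p \<in> power_sub (\<lambda>d. v d + (w(e := w e + 1)) d)" by (rule smult_power_sub[OF \<delta> pg(1)])
    moreover have "(\<lambda>d. v d + (w(e := w e + 1)) d) = (\<lambda>d. v d + w d)(e := v e + w e + 1)" by auto
    moreover have "mon \<delta> \<odot>\<^bsub>M\<^esub> g \<in> G (\<lambda>d. v d + w d)" by (rule shift[OF \<delta> pg(2)])
    moreover have "mon \<delta> \<odot>\<^bsub>M\<^esub> y = mon \<delta> \<odot>\<^bsub>M\<^esub> p \<oplus>\<^bsub>M\<^esub> mon \<delta> \<odot>\<^bsub>M\<^esub> g"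
      unfolding pg(3) using pg(1,2) cp cG by (intro smult_r_distr) auto
    ultimately show "mon \<delta> \<odot>\<^bsub>M\<^esub> y \<in> B (\<lambda>d. v d + w d)" unfolding B_def mem_set_add by auto
  qed
  have Bsup: "power_sub (\<lambda>d. basis_vec e d + w d) \<subseteq> B w" for w
    unfolding B_def up by (rule set_add_sub1[OF cp sG])
  obtain \<l> :: "(nat \<Rightarrow> nat) \<Rightarrow> nat" where l: "\<And>\<beta> \<gamma>. (\<And>i. \<beta> i \<le> \<gamma> i) \<Longrightarrow> \<l> \<gamma> \<le> \<l> \<beta>"
    "\<And>\<beta> t. \<l> (\<beta>(n := t)) = \<l> \<beta>"
    "\<And>w. interval_length R M (B w) (power_sub w <+>\<^bsub>M\<^esub> B w) = enat (monomial_sum dir n \<l> w)"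
    using lead_length_antitone[OF B fin Bsup] by blast
  define X where "X w k = power_sub (w(e := k)) <+>\<^bsub>M\<^esub> G w" for w k
  have sX: "submodule (X w k) R M" for w k unfolding X_def by (rule submodule_set_add[OF sp sG])
  have Xanti: "X w k' \<subseteq> X w k" if "k \<le> k'" for w k k'
    unfolding X_def by (intro set_add_mono power_sub_antimono) (use that in auto)
  have step: "interval_length R M (X w (Suc k)) (X w k) = enat (monomial_sum dir n \<l> (w(e := k)))" for w k
  proof -
    have 1: "B (w(e := k)) = X w (Suc k)" by (simp add: B_def X_def Ge)
    have "power_sub (w(e := k)) <+>\<^bsub>M\<^esub> X w (Suc k) = X w k"
    proof (rule antisym)
      show "power_sub (w(e := k)) <+>\<^bsub>M\<^esub> X w (Suc k) \<subseteq> X w k"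
        using Xanti[of k "Suc k" w] set_add_sub1[OF cp sG] unfolding X_def[of w k]
        by (intro set_add_least[OF _ _ submodule_set_add[OF sp sG]]) auto
      show "X w k \<subseteq> power_sub (w(e := k)) <+>\<^bsub>M\<^esub> X w (Suc k)"
        unfolding X_def[of w k] by (rule set_add_mono[OF order_refl]) (simp add: X_def set_add_sub2[OF sp cG])
    qed
    thus ?thesis using l(3)[of "w(e := k)"] 1 by simp
  qed
  \<comment> \<open>Variable \<open>n\<close> is the additional one of direction \<open>e\<close>.\<close>
  define h where "h w = monomial_sum (dir(n := e)) (Suc n) \<l> w" for w
  show thesis
  proof (rule that[of h])
    show "separable (\<lambda>w. of_nat (h w))"
      unfolding h_def by (rule antitone_monomial_sum_separable[OF l(1)])
    fix w
    have "interval_length R M (X w m) (X w 0) = enat (\<Sum>k<m. monomial_sum dir n \<l> (w(e := k)))" for m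
    proof (induction m)
      case 0
      then show ?case by (simp add: interval_length_self[OF sX] zero_enat_def)
    next
      case (Suc m)
      have "interval_length R M (X w (Suc m)) (X w 0)
          = interval_length R M (X w (Suc m)) (X w m) + interval_length R M (X w m) (X w 0)"
        by (rule interval_length_add[OF sX sX sX Xanti Xanti]) auto
      thus ?case unfolding step Suc by (simp add: add.commute del: fun_upd_apply)
    qed
    from this[of "Suc (w e)"]
    have "interval_length R M (X w (Suc (w e))) (X w 0) = enat (\<Sum>k\<le>w e. monomial_sum dir n \<l> (w(e := k)))"
      by (simp only: lessThan_Suc_atMost)
    also have "(\<Sum>k\<le>w e. monomial_sum dir n \<l> (w(e := k))) = (\<Sum>k\<le>w e. monomial_sum dir n \<l> (w(e := w e - k)))"
      by (rule sum.reindex_bij_witness[of _ "\<lambda>k. w e - k" "\<lambda>k. w e - k"]) auto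
    also have "\<dots> = h w"
    proof -
      have "mdeg (dir(n := e)) n = mdeg dir n"
        by (auto simp: mdeg_def fun_eq_iff intro!: sum.cong)
      hence "monomial_sum (dir(n := e)) n \<l> = monomial_sum dir n \<l>" by (simp add: monomial_sum_def fun_eq_iff)
      thus ?thesis unfolding h_def monomial_sum_Suc by (simp add: l(2))
    qed
    also have "X w 0 = power_sub (w(e := 0))"
      unfolding X_def by (rule antisym[OF set_add_least[OF order_refl Gsub sp] set_add_sub1[OF cp sG]])
    finally show "interval_length R M (power_sub (w(e := w e + 1)) <+>\<^bsub>M\<^esub> G w) (power_sub (w(e := 0))) = enat (h w)"
      by (simp add: X_def)
  qed
qed

end

section \<open>Primes in Noetherian local rings\<close>

context cring
begin

lemma wf_ideals_superset:
  assumes "noetherian_ring R"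
  shows "wf {(I', I). ideal I R \<and> ideal I' R \<and> I \<subset> I'}"
proof (rule wf_iff_no_infinite_down_chain[THEN iffD2], rule notI)
  assume "\<exists>f. \<forall>i. (f (Suc i), f i) \<in> {(I', I). ideal I R \<and> ideal I' R \<and> I \<subset> I'}"
  then obtain f :: "nat \<Rightarrow> 'a set" where "\<forall>i. (f (Suc i), f i) \<in> {(I', I). ideal I R \<and> ideal I' R \<and> I \<subset> I'}"
    by (elim exE)
  hence f: "\<And>i. ideal (f i) R" "\<And>i. f i \<subset> f (Suc i)" by auto
  have mono: "f i \<subseteq> f j" if "i \<le> j" for i j
    using that by (rule lift_Suc_mono_le[of f, rotated]) (use f(2) in blast)
  have "subset.chain {I. ideal I R} (range f)"
    unfolding subset_chain_def
  proof (intro conjI ballI)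
    fix x y assume "x \<in> range f" "y \<in> range f"
    then obtain i j where "x = f i" "y = f j" by blast
    thus "x \<subseteq> y \<or> y \<subseteq> x" using mono[of i j] mono[of j i] nat_le_linear[of i j] by auto
  qed (use f(1) in blast)
  hence "\<Union> (range f) \<in> range f"
    by (intro noetherian_ring.ideal_chain_is_trivial[OF assms]) auto
  then obtain k where "\<Union> (range f) = f k" by blast
  moreover have "f (Suc k) \<subseteq> \<Union> (range f)" by blast
  ultimately show False using f(2)[of k] by blast
qed

lemma ideal_add_principal:
  assumes I: "ideal I R" and a: "a \<in> carrier R"
  shows "ideal (I <+>\<^bsub>R\<^esub> PIdl a) R" "I \<subseteq> I <+>\<^bsub>R\<^esub> PIdl a" "a \<in> I <+>\<^bsub>R\<^esub> PIdl a"
    "\<And>K. ideal K R \<Longrightarrow> I \<subseteq> K \<Longrightarrow> a \<in> K \<Longrightarrow> I <+>\<^bsub>R\<^esub> PIdl a \<subseteq> K"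
    "\<And>x. x \<in> I <+>\<^bsub>R\<^esub> PIdl a \<Longrightarrow> \<exists>i\<in>I. \<exists>r\<in>carrier R. x = i \<oplus> r \<otimes> a"
proof -
  interpret I: ideal I R by (rule I)
  interpret P: ideal "PIdl a" R by (rule cgenideal_ideal[OF a])
  show "ideal (I <+>\<^bsub>R\<^esub> PIdl a) R" by (rule add_ideals[OF I P.is_ideal])
  show "I \<subseteq> I <+>\<^bsub>R\<^esub> PIdl a"
  proof
    fix i assume "i \<in> I"
    hence "i = i \<oplus> \<zero>" using I.Icarr by simp
    thus "i \<in> I <+>\<^bsub>R\<^esub> PIdl a" using \<open>i \<in> I\<close> P.zero_closed unfolding set_add_def' by blast
  qed
  have "a = \<zero> \<oplus> a" using a by simp
  thus "a \<in> I <+>\<^bsub>R\<^esub> PIdl a" using I.zero_closed cgenideal_self[OF a] unfolding set_add_def' by blast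
  show "I <+>\<^bsub>R\<^esub> PIdl a \<subseteq> K" if K: "ideal K R" "I \<subseteq> K" "a \<in> K" for K
  proof -
    interpret K: ideal K R by (rule K(1))
    have "PIdl a \<subseteq> K" by (rule cgenideal_minimal[OF K(1,3)])
    thus ?thesis using K(2) K.a_closed unfolding set_add_def' by auto
  qed
  show "\<exists>i\<in>I. \<exists>r\<in>carrier R. x = i \<oplus> r \<otimes> a" if "x \<in> I <+>\<^bsub>R\<^esub> PIdl a" for x
    using that unfolding set_add_def' cgenideal_def by blast
qed

text \<open>The usual descent for ideals in a Noetherian ring: a proper ideal that is not prime is strictly
contained in the ideals generated by it and either factor of a product that witnesses this.\<close>

lemma ideal_noetherian_induct [consumes 2, case_names whole prime split]:
  assumes noeth: "noetherian_ring R" and I: "ideal I R"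
    and whole: "P (carrier R)"
    and prime: "\<And>I. primeideal I R \<Longrightarrow> P I"
    and split: "\<And>I a b. ideal I R \<Longrightarrow> a \<in> carrier R \<Longrightarrow> b \<in> carrier R \<Longrightarrow> a \<otimes> b \<in> I \<Longrightarrow>
      P (I <+>\<^bsub>R\<^esub> PIdl a) \<Longrightarrow> P (I <+>\<^bsub>R\<^esub> PIdl b) \<Longrightarrow> P I"
  shows "P I"
  using wf_ideals_superset[OF noeth] I
proof (induction I rule: wf_induct_rule)
  case (less I)
  show ?case
  proof (cases "I = carrier R \<or> primeideal I R")
    case True
    thus ?thesis using whole prime by auto
  next
    case False
    then obtain a b where ab: "a \<in> carrier R" "b \<in> carrier R" "a \<otimes> b \<in> I" "a \<notin> I" "b \<notin> I"
      using ideal.primeidealCD[OF less.prems is_cring] by blast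
    have "P (I <+>\<^bsub>R\<^esub> PIdl c)" if "c \<in> carrier R" "c \<notin> I" for c
      using less.IH[of "I <+>\<^bsub>R\<^esub> PIdl c"] ideal_add_principal(1-3)[OF less.prems that(1)] that(2) less.prems by blast
    thus ?thesis using split[OF less.prems ab(1-3)] ab by blast
  qed
qed

text \<open>A finite set of primes over \<open>I\<close> below which every prime over \<open>I\<close> can be found; it contains the minimal
ones. In the inductive step a prime over \<open>I\<close> contains \<open>a\<close> or \<open>b\<close>.\<close>

lemma finitely_many_minimal_primes:
  assumes "noetherian_ring R" "ideal I R"
  shows "\<exists>Q. finite Q \<and> (\<forall>P\<in>Q. primeideal P R \<and> I \<subseteq> P) \<and>
     (\<forall>P. primeideal P R \<longrightarrow> I \<subseteq> P \<longrightarrow> (\<exists>P'\<in>Q. P' \<subseteq> P))"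
  using assms
proof (induction rule: ideal_noetherian_induct)
  case whole
  have "\<not> carrier R \<subseteq> P" if "primeideal P R" for P
    using primeideal.I_notcarr[OF that] ideal_subset_carrier[OF primeideal.axioms(1)[OF that]] by blast
  thus ?case by (intro exI[of _ "{}"]) simp
next
  case (prime I)
  thus ?case by (intro exI[of _ "{I}"]) auto
next
  case (split I a b)
  from split.IH(1) obtain Q1 where Q1: "finite Q1" "\<forall>P\<in>Q1. primeideal P R \<and> I <+>\<^bsub>R\<^esub> PIdl a \<subseteq> P"
     "\<forall>P. primeideal P R \<longrightarrow> I <+>\<^bsub>R\<^esub> PIdl a \<subseteq> P \<longrightarrow> (\<exists>P'\<in>Q1. P' \<subseteq> P)" by (elim exE conjE)
  from split.IH(2) obtain Q2 where Q2: "finite Q2" "\<forall>P\<in>Q2. primeideal P R \<and> I <+>\<^bsub>R\<^esub> PIdl b \<subseteq> P"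
     "\<forall>P. primeideal P R \<longrightarrow> I <+>\<^bsub>R\<^esub> PIdl b \<subseteq> P \<longrightarrow> (\<exists>P'\<in>Q2. P' \<subseteq> P)" by (elim exE conjE)
  note A = ideal_add_principal[OF split.hyps(1,2)] and B = ideal_add_principal[OF split.hyps(1,3)]
  have "\<exists>P'\<in>Q1 \<union> Q2. P' \<subseteq> P" if P: "primeideal P R" "I \<subseteq> P" for P
  proof -
    have "a \<in> P \<or> b \<in> P" using primeideal.I_prime[OF P(1) split.hyps(2,3)] split.hyps(4) P(2) by blast
    moreover have idP: "ideal P R" by (rule primeideal.axioms(1)[OF P(1)])
    ultimately have "I <+>\<^bsub>R\<^esub> PIdl a \<subseteq> P \<or> I <+>\<^bsub>R\<^esub> PIdl b \<subseteq> P"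
      using A(4)[OF idP P(2)] B(4)[OF idP P(2)] by blast
    thus ?thesis using Q1(3) Q2(3) P(1) by blast
  qed
  moreover have "\<forall>P\<in>Q1 \<union> Q2. primeideal P R \<and> I \<subseteq> P"
    using Q1(2) Q2(2) A(2) B(2) by blast
  ultimately show ?case using Q1(1) Q2(1) by (intro exI[of _ "Q1 \<union> Q2"]) blast
qed

text \<open>In the inductive step, \<open>(I + (a)) (I + (b)) \<subseteq> I\<close> because \<open>a b \<in> I\<close>.\<close>

lemma power_in_ideal_if_only_prime:
  assumes "noetherian_ring R" "ideal I R" and m: "ideal \<mm> R"
    and "\<And>P. primeideal P R \<Longrightarrow> I \<subseteq> P \<Longrightarrow> P = \<mm>"
  shows "\<exists>k::nat. \<mm> [^]\<^bsub>ideals_set R\<^esub> k \<subseteq> I"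
proof -
  interpret S: comm_monoid "ideals_set R" by (rule ideals_set_is_comm_monoid)
  have "(\<forall>P. primeideal P R \<longrightarrow> I \<subseteq> P \<longrightarrow> P = \<mm>) \<longrightarrow> (\<exists>k::nat. \<mm> [^]\<^bsub>ideals_set R\<^esub> k \<subseteq> I)"
    using assms(1,2)
  proof (induction rule: ideal_noetherian_induct)
    case whole
    have "\<mm> [^]\<^bsub>ideals_set R\<^esub> (0::nat) \<subseteq> carrier R" by simp
    thus ?case by blast
  next
    case (prime I)
    have "\<mm> [^]\<^bsub>ideals_set R\<^esub> (1::nat) = \<mm>" using m S.nat_pow_eone[of \<mm>] by simp
    thus ?case using prime by (metis order_refl)
  next
    case (split I a b)
    note A = ideal_add_principal[OF split.hyps(1,2)] and B = ideal_add_principal[OF split.hyps(1,3)]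
    interpret I: ideal I R by (rule split.hyps(1))
    show ?case
    proof
      assume only: "\<forall>P. primeideal P R \<longrightarrow> I \<subseteq> P \<longrightarrow> P = \<mm>"
      obtain k l :: nat where kl: "\<mm> [^]\<^bsub>ideals_set R\<^esub> k \<subseteq> I <+>\<^bsub>R\<^esub> PIdl a" "\<mm> [^]\<^bsub>ideals_set R\<^esub> l \<subseteq> I <+>\<^bsub>R\<^esub> PIdl b"
        using split.IH only A(2) B(2) by (meson order_trans)
      have "\<mm> [^]\<^bsub>ideals_set R\<^esub> (k + l) = (\<mm> [^]\<^bsub>ideals_set R\<^esub> k) \<cdot> (\<mm> [^]\<^bsub>ideals_set R\<^esub> l)"
        using S.nat_pow_mult[of \<mm> k l] m by simp
      also have "\<dots> \<subseteq> I"
      proof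
        fix s assume "s \<in> (\<mm> [^]\<^bsub>ideals_set R\<^esub> k) \<cdot> (\<mm> [^]\<^bsub>ideals_set R\<^esub> l)"
        thus "s \<in> I"
        proof (induction rule: ideal_prod.induct)
          case (prod x y)
          obtain i r where x: "i \<in> I" "r \<in> carrier R" "x = i \<oplus> r \<otimes> a" using A(5) prod kl(1) by blast
          obtain j q where y: "j \<in> I" "q \<in> carrier R" "y = j \<oplus> q \<otimes> b" using B(5) prod kl(2) by blast
          have c: "i \<in> carrier R" "j \<in> carrier R" using x y I.Icarr by auto
          have "x \<otimes> y = i \<otimes> (j \<oplus> q \<otimes> b) \<oplus> ((r \<otimes> a) \<otimes> j \<oplus> (r \<otimes> q) \<otimes> (a \<otimes> b))"
            unfolding x(3) y(3) using c x(2) y(2) split.hyps(2,3)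
            by (simp add: l_distr r_distr m_ac a_ac)
          moreover have "i \<otimes> (j \<oplus> q \<otimes> b) \<in> I" "(r \<otimes> a) \<otimes> j \<in> I" "(r \<otimes> q) \<otimes> (a \<otimes> b) \<in> I"
            using c x y split.hyps(2-4) I.I_l_closed I.I_r_closed by auto
          ultimately show ?case by (simp add: I.a_closed)
        qed (rule I.a_closed)
      qed
      finally show "\<exists>k::nat. \<mm> [^]\<^bsub>ideals_set R\<^esub> k \<subseteq> I" by blast
    qed
  qed
  thus ?thesis using assms(4) by blast
qed

lemma ideal_element_in_others:
  assumes "finite S" "\<And>Q'. Q' \<in> S \<Longrightarrow> ideal Q' R \<and> \<not> Q' \<subseteq> Q" "primeideal Q R" "ideal K R" "\<not> K \<subseteq> Q"
  shows "\<exists>z\<in>K. z \<notin> Q \<and> (\<forall>Q'\<in>S. z \<in> Q')"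
  using assms
proof (induction S rule: finite_induct)
  case empty
  thus ?case by auto
next
  case (insert Q' S)
  then obtain z where z: "z \<in> K" "z \<notin> Q" "\<forall>Q'\<in>S. z \<in> Q'" by auto
  obtain q where q: "q \<in> Q'" "q \<notin> Q" using insert.prems(1)[of Q'] by blast
  have id: "ideal Q' R" "ideal K R" using insert.prems by auto
  have c: "z \<in> carrier R" "q \<in> carrier R"
    by (rule ideal.Icarr[OF id(2) z(1)], rule ideal.Icarr[OF id(1) q(1)])
  have "z \<otimes> q \<notin> Q" using primeideal.I_prime[OF insert.prems(2) c] z(2) q(2) by metis
  moreover have "z \<otimes> q \<in> K" by (rule ideal.I_r_closed[OF id(2) z(1) c(2)])
  moreover have "z \<otimes> q \<in> Q'" by (rule ideal.I_l_closed[OF id(1) q(1) c(1)])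
  moreover have "z \<otimes> q \<in> Q''" if "Q'' \<in> S" for Q''
    using ideal.I_r_closed[of Q'' R z q] z(3) that insert.prems(1)[of Q''] c by simp
  ultimately show ?case by blast
qed

text \<open>By induction on the number of primes. Removing an inclusion-minimal prime \<open>Q\<close> leaves primes none of
which lies inside \<open>Q\<close>. If an element avoiding these lies in \<open>Q\<close>, correct it by an element outside \<open>Q\<close>
that lies in all the others.\<close>

lemma prime_avoidance:
  assumes "finite S" "\<And>Q. Q \<in> S \<Longrightarrow> primeideal Q R \<and> \<not> K \<subseteq> Q" "ideal K R"
  shows "\<exists>y\<in>K. \<forall>Q\<in>S. y \<notin> Q"
  using assms
proof (induction "card S" arbitrary: S)
  case 0
  interpret K: ideal K R by (rule assms(3))
  have "S = {}" using 0 by simp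
  thus ?case using K.zero_closed by blast
next
  case (Suc k)
  interpret K: ideal K R by (rule assms(3))
  have "S \<noteq> {}" using Suc.hyps(2) by auto
  then obtain Q where Q: "Q \<in> S" "\<And>Q'. Q' \<in> S \<Longrightarrow> Q' \<subseteq> Q \<Longrightarrow> Q = Q'"
    using finite_has_minimal[OF Suc.prems(1)] by blast
  interpret Q: primeideal Q R using Suc.prems(2)[OF Q(1)] by blast
  have "card (S - {Q}) = k" using Suc.hyps(2) Q(1) Suc.prems(1) by simp
  then obtain y where y: "y \<in> K" "\<forall>Q'\<in>S - {Q}. y \<notin> Q'"
    using Suc.hyps(1)[of "S - {Q}"] Suc.prems by blast
  show ?case
  proof (cases "y \<in> Q")
    case False
    thus ?thesis using y by blast
  next
    case True
    have "\<exists>z\<in>K. z \<notin> Q \<and> (\<forall>Q'\<in>S - {Q}. z \<in> Q')"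
      by (rule ideal_element_in_others)
         (use Suc.prems Q in \<open>auto intro: primeideal.axioms(1) Q.primeideal\<close>)
    then obtain z where z: "z \<in> K" "z \<notin> Q" "\<And>Q'. Q' \<in> S - {Q} \<Longrightarrow> z \<in> Q'" by blast
    have c: "y \<in> carrier R" "z \<in> carrier R" using y z K.Icarr by auto
    have "y \<oplus> z \<notin> Q'" if "Q' \<in> S" for Q'
    proof
      assume m: "y \<oplus> z \<in> Q'"
      interpret Q': primeideal Q' R using Suc.prems(2)[OF that] by blast
      show False
      proof (cases "Q' = Q")
        case True
        have "(\<ominus> y) \<oplus> (y \<oplus> z) \<in> Q" using m True \<open>y \<in> Q\<close> Q.a_closed Q.a_inv_closed by blast
        thus False using z(2) c by (simp add: r_neg1)
      next
        case False
        hence "y \<oplus> z \<oplus> (\<ominus> z) \<in> Q'" using m z(3) that Q'.a_closed Q'.a_inv_closed by blast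
        moreover have "y \<oplus> z \<oplus> (\<ominus> z) = y" using c by (simp add: a_assoc r_neg)
        ultimately show False using y(2) that False by auto
      qed
    qed
    thus ?thesis using K.a_closed[OF y(1) z(1)] by blast
  qed
qed

end

lemma (in local_ring) proper_ideal_subset_max:
  assumes noeth: "noetherian_ring R" and I: "ideal I R" "I \<noteq> carrier R"
  shows "I \<subseteq> \<mm>"
proof -
  let ?S = "{K. ideal K R \<and> I \<subseteq> K \<and> K \<noteq> carrier R}"
  have "I \<in> ?S" using I by auto
  then obtain K where K: "K \<in> ?S" "\<And>K'. (K', K) \<in> {(I', I). ideal I R \<and> ideal I' R \<and> I \<subset> I'} \<Longrightarrow> K' \<notin> ?S"
    using wfE_min[OF wf_ideals_superset[OF noeth], of I ?S] by blast
  have "maximalideal K R"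
  proof (rule maximalidealI)
    show "ideal K R" "carrier R \<noteq> K" using K(1) by auto
    fix L assume "ideal L R" "K \<subseteq> L" "L \<subseteq> carrier R"
    thus "L = K \<or> L = carrier R" using K(1) K(2)[of L] by blast
  qed
  hence "K = \<mm>" by (rule maximalideal_unique)
  thus ?thesis using K(1) by auto
qed

lemma (in cring) coset_mem_image_iff:
  assumes A: "ideal A R" and P: "ideal P R" "A \<subseteq> P" and x: "x \<in> carrier R"
  shows "A +> x \<in> (+>) A ` P \<longleftrightarrow> x \<in> P"
proof
  interpret A: ideal A R by (rule A)
  interpret P: ideal P R by (rule P(1))
  assume "A +> x \<in> (+>) A ` P"
  then obtain y where y: "y \<in> P" "A +> x = A +> y" by blast
  have "x \<in> A +> y" using A.a_rcos_self[OF x] y(2) by simp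
  then obtain h where "h \<in> A" "x = h \<oplus> y" unfolding a_r_coset_def' by blast
  thus "x \<in> P" using P(2) y(1) P.a_closed by blast
qed auto

lemma (in cring) primeideal_quotient_image:
  assumes A: "ideal A R" and P: "primeideal P R" "A \<subseteq> P"
  shows "primeideal ((+>) A ` P) (R Quot A)"
proof -
  interpret A: ideal A R by (rule A)
  interpret P: primeideal P R by (rule P(1))
  note iff = coset_mem_image_iff[OF A P.is_ideal P(2)]
  have carr: "X \<in> carrier (R Quot A) \<longleftrightarrow> (\<exists>x\<in>carrier R. X = A +> x)" for X
    by (auto simp: FactRing_def A_RCOSETS_def' a_r_coset_def')
  show ?thesis
  proof (rule primeidealI)
    show "ideal ((+>) A ` P) (R Quot A)" by (rule ring_ideal_imp_quot_ideal[OF A P.is_ideal])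
    show "cring (R Quot A)" by (rule A.quotient_is_cring[OF is_cring])
    obtain x where "x \<in> carrier R" "x \<notin> P" using P.I_notcarr P.Icarr by blast
    hence "A +> x \<in> carrier (R Quot A)" "A +> x \<notin> (+>) A ` P" using iff carr by auto
    thus "carrier (R Quot A) \<noteq> (+>) A ` P" by metis
    fix X Y assume X: "X \<in> carrier (R Quot A)" and Y: "Y \<in> carrier (R Quot A)"
      and XY: "X \<otimes>\<^bsub>R Quot A\<^esub> Y \<in> (+>) A ` P"
    obtain x where x: "x \<in> carrier R" "X = A +> x" using X unfolding carr by (elim bexE)
    obtain y where y: "y \<in> carrier R" "Y = A +> y" using Y unfolding carr by (elim bexE)
    note xy = x(1) y(1) x(2) y(2)
    have "X \<otimes>\<^bsub>R Quot A\<^esub> Y = A +> (x \<otimes> y)"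
      unfolding xy(3,4) FactRing_def using A.rcoset_mult_add[OF xy(1,2)] by simp
    hence "x \<otimes> y \<in> P" using XY iff xy by simp
    hence "x \<in> P \<or> y \<in> P" by (rule P.I_prime[OF x(1) y(1)])
    thus "X \<in> (+>) A ` P \<or> Y \<in> (+>) A ` P" unfolding xy(3,4) by (elim disjE) simp_all
  qed
qed

text \<open>Chains of primes over \<open>A\<close> are carried to the quotient ring by the coset map.\<close>

lemma (in cring) prime_chain_length_le_dim:
  assumes A: "ideal A R" and dim: "krull_dim (R Quot A) = enat D"
    and P: "prime_chain R k P" "A \<subseteq> P 0"
  shows "k \<le> D"
proof -
  have Pi: "primeideal (P i) R" if "i \<le> k" for i using P(1) that by (auto simp: prime_chain_def)
  have Ps: "P i \<subset> P (Suc i)" if "i < k" for i using P(1) that by (auto simp: prime_chain_def)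
  have AP: "A \<subseteq> P i" if "i \<le> k" for i
    using that by (induction i) (use P(2) Ps in \<open>auto dest!: Suc_le_lessD\<close>)
  let ?Q = "\<lambda>i. (+>) A ` P i"
  have "prime_chain (R Quot A) k ?Q"
    unfolding prime_chain_def
  proof (intro conjI allI impI)
    fix i assume "i \<le> k"
    thus "primeideal (?Q i) (R Quot A)" using primeideal_quotient_image[OF A Pi AP] by blast
  next
    fix i assume i: "i < k"
    hence id: "ideal (P i) R" "ideal (P (Suc i)) R" using Pi[of i] Pi[of "Suc i"] primeideal.axioms(1) by auto
    obtain x where x: "x \<in> P (Suc i)" "x \<notin> P i" using Ps[OF i] by blast
    have "A +> x \<notin> ?Q i"
      using coset_mem_image_iff[OF A id(1) AP] x i ideal.Icarr[OF id(2)] by auto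
    thus "?Q i \<subset> ?Q (Suc i)" using Ps[OF i] x by blast
  qed
  hence "enat k \<le> krull_dim (R Quot A)" unfolding krull_dim_def by (intro Sup_upper) blast
  thus ?thesis using dim by simp
qed

section \<open>Growth of lengths\<close>

context module
begin

definition cyclic :: "'c \<Rightarrow> 'c set" where
  "cyclic x = (\<lambda>r. r \<odot>\<^bsub>M\<^esub> x) ` carrier R"

lemma submodule_cyclic:
  assumes x: "x \<in> carrier M"
  shows "submodule (cyclic x) R M"
  unfolding submodule_iff
proof (intro conjI ballI)
  show "cyclic x \<subseteq> carrier M" using x by (auto simp: cyclic_def)
  have "\<zero>\<^bsub>M\<^esub> = \<zero> \<odot>\<^bsub>M\<^esub> x" using x by simp
  thus "\<zero>\<^bsub>M\<^esub> \<in> cyclic x" unfolding cyclic_def by blast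
next
  fix y z assume "y \<in> cyclic x" "z \<in> cyclic x"
  then obtain r s where "r \<in> carrier R" "s \<in> carrier R" "y = r \<odot>\<^bsub>M\<^esub> x" "z = s \<odot>\<^bsub>M\<^esub> x" by (auto simp: cyclic_def)
  hence "y \<oplus>\<^bsub>M\<^esub> z = (r \<oplus> s) \<odot>\<^bsub>M\<^esub> x" "r \<oplus> s \<in> carrier R" using x by (auto simp: smult_l_distr)
  thus "y \<oplus>\<^bsub>M\<^esub> z \<in> cyclic x" by (auto simp: cyclic_def)
next
  fix a y assume "a \<in> carrier R" "y \<in> cyclic x"
  then obtain r where "a \<in> carrier R" "r \<in> carrier R" "y = r \<odot>\<^bsub>M\<^esub> x" by (auto simp: cyclic_def)
  hence "a \<odot>\<^bsub>M\<^esub> y = (a \<otimes> r) \<odot>\<^bsub>M\<^esub> x" "a \<otimes> r \<in> carrier R" using x by (auto simp: smult_assoc1)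
  thus "a \<odot>\<^bsub>M\<^esub> y \<in> cyclic x" by (auto simp: cyclic_def)
qed

lemma mem_cyclic: "x \<in> carrier M \<Longrightarrow> x \<in> cyclic x"
  unfolding cyclic_def by (rule image_eqI[of _ _ \<one>]) auto

lemma module_span_insert_subset:
  assumes "S \<subseteq> carrier M" "x \<in> carrier M"
  shows "module_span R M (insert x S) \<subseteq> cyclic x <+>\<^bsub>M\<^esub> module_span R M S"
proof (rule module_span_least[OF submodule_set_add[OF submodule_cyclic[OF assms(2)] submodule_module_span[OF assms(1)]]])
  note s = submodule_cyclic[OF assms(2)] submodule_module_span[OF assms(1)]
  show "insert x S \<subseteq> cyclic x <+>\<^bsub>M\<^esub> module_span R M S"
    using set_add_sub1[OF submodule_subset_carrier[OF s(1)] s(2)] set_add_sub2[OF s(1) submodule_subset_carrier[OF s(2)]]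
      mem_cyclic[OF assms(2)] module_span_superset[of S] by blast
qed

lemma ideal_coefficients:
  assumes L: "submodule L R M" and x: "x \<in> carrier M"
  shows "ideal {r \<in> carrier R. r \<odot>\<^bsub>M\<^esub> x \<in> L} R"
  using ideal_colon[of "{x}" L] L x by simp

definition superset_rel :: "'c set \<Rightarrow> 'c set \<Rightarrow> ('c set \<times> 'c set) set" where
  "superset_rel K N = {(L', L). submodule L R M \<and> submodule L' R M \<and> K \<subseteq> L \<and> L \<subset> L' \<and> L' \<subseteq> N}"

text \<open>A strict inclusion stays strict after intersecting with \<open>B\<close> or after adding \<open>B\<close>, so the relation on
the large interval embeds into a lexicographic product.\<close>

lemma wf_superset_rel_trans:
  assumes wf: "wf (superset_rel A B)" "wf (superset_rel B C)"
    and sm: "submodule A R M" "submodule B R M" "submodule C R M" and sub: "A \<subseteq> B" "B \<subseteq> C"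
  shows "wf (superset_rel A C)"
proof (rule wf_subset[OF wf_inv_image[OF wf_lex_prod[OF wf], of "\<lambda>L. (L \<inter> B, L <+>\<^bsub>M\<^esub> B)"]], safe)
  fix L' L assume "(L', L) \<in> superset_rel A C"
  hence L: "submodule L R M" "submodule L' R M" "A \<subseteq> L" "L \<subset> L'" "L' \<subseteq> C" by (auto simp: superset_rel_def)
  have s: "submodule (L \<inter> B) R M" "submodule (L' \<inter> B) R M" "submodule (L <+>\<^bsub>M\<^esub> B) R M" "submodule (L' <+>\<^bsub>M\<^esub> B) R M"
    using submodule_Int submodule_set_add L sm by auto
  have b: "B \<subseteq> L <+>\<^bsub>M\<^esub> B" by (rule set_add_sub2[OF L(1) submodule_subset_carrier[OF sm(2)]])
  have c: "L' <+>\<^bsub>M\<^esub> B \<subseteq> C" by (rule set_add_least[OF L(5) sub(2) sm(3)])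
  have m: "L <+>\<^bsub>M\<^esub> B \<subseteq> L' <+>\<^bsub>M\<^esub> B" using L(4) by (intro set_add_mono) auto
  show "(L', L) \<in> inv_image (superset_rel A B <*lex*> superset_rel B C) (\<lambda>L. (L \<inter> B, L <+>\<^bsub>M\<^esub> B))"
  proof (cases "L \<inter> B = L' \<inter> B")
    case False
    hence "(L' \<inter> B, L \<inter> B) \<in> superset_rel A B"
      using s L sub unfolding superset_rel_def by blast
    thus ?thesis by simp
  next
    case True
    have "L <+>\<^bsub>M\<^esub> B \<noteq> L' <+>\<^bsub>M\<^esub> B"
    proof
      assume eq: "L <+>\<^bsub>M\<^esub> B = L' <+>\<^bsub>M\<^esub> B"
      have "L' \<subseteq> (L <+>\<^bsub>M\<^esub> B) \<inter> L'" using eq set_add_sub1[OF submodule_subset_carrier[OF L(2)] sm(2)] by auto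
      also have "\<dots> \<subseteq> L <+>\<^bsub>M\<^esub> (B \<inter> L')" by (rule modular_law[OF L(1,2) submodule_subset_carrier[OF sm(2)]]) (use L in auto)
      also have "\<dots> \<subseteq> L" by (rule set_add_least[OF order_refl _ L(1)]) (use True in auto)
      finally show False using L(4) by auto
    qed
    hence "(L' <+>\<^bsub>M\<^esub> B, L <+>\<^bsub>M\<^esub> B) \<in> superset_rel B C"
      using s b c m unfolding superset_rel_def by blast
    thus ?thesis using True by simp
  qed
qed

lemma mem_add_cyclic:
  assumes K: "submodule K R M" and x: "x \<in> carrier M" and L: "submodule L R M" "K \<subseteq> L"
    and z: "z \<in> cyclic x <+>\<^bsub>M\<^esub> K"
  obtains r where "r \<in> carrier R" "z \<in> L \<longleftrightarrow> r \<odot>\<^bsub>M\<^esub> x \<in> L" "z \<in> K \<longleftrightarrow> r \<odot>\<^bsub>M\<^esub> x \<in> K"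
    "\<And>L'. submodule L' R M \<Longrightarrow> K \<subseteq> L' \<Longrightarrow> z \<in> L' \<longleftrightarrow> r \<odot>\<^bsub>M\<^esub> x \<in> L'"
proof -
  obtain r k where r: "r \<in> carrier R" and k: "k \<in> K" and zz: "z = r \<odot>\<^bsub>M\<^esub> x \<oplus>\<^bsub>M\<^esub> k"
    using z by (auto simp: mem_set_add cyclic_def)
  have c: "r \<odot>\<^bsub>M\<^esub> x \<in> carrier M" "k \<in> carrier M" using r x k submodule_subset_carrier[OF K] by auto
  have iff: "z \<in> L' \<longleftrightarrow> r \<odot>\<^bsub>M\<^esub> x \<in> L'" if L': "submodule L' R M" "K \<subseteq> L'" for L'
  proof
    assume "z \<in> L'"
    hence "z \<ominus>\<^bsub>M\<^esub> k \<in> L'" using k L'(2) by (intro submodule_minus[OF L'(1)]) auto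
    thus "r \<odot>\<^bsub>M\<^esub> x \<in> L'" using c by (simp add: zz add_minus_right)
  next
    assume "r \<odot>\<^bsub>M\<^esub> x \<in> L'"
    thus "z \<in> L'" unfolding zz using k L'(2) by (intro submodule_add[OF L'(1)]) auto
  qed
  show thesis by (rule that[OF r iff[OF L] iff[OF K order_refl] iff])
qed

text \<open>A submodule between \<open>K\<close> and \<open>R x + K\<close> is determined by the ideal of its coefficients at \<open>x\<close>.\<close>

lemma wf_superset_rel_cyclic:
  assumes noeth: "noetherian_ring R" and K: "submodule K R M" and x: "x \<in> carrier M"
  shows "wf (superset_rel K (cyclic x <+>\<^bsub>M\<^esub> K))"
proof (rule wf_subset[OF wf_inv_image[OF R.wf_ideals_superset[OF noeth], of "\<lambda>L. {r \<in> carrier R. r \<odot>\<^bsub>M\<^esub> x \<in> L}"]], safe)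
  fix L' L assume "(L', L) \<in> superset_rel K (cyclic x <+>\<^bsub>M\<^esub> K)"
  hence L: "submodule L R M" "submodule L' R M" "K \<subseteq> L" "L \<subset> L'" "L' \<subseteq> cyclic x <+>\<^bsub>M\<^esub> K" by (auto simp: superset_rel_def)
  obtain z where z: "z \<in> L'" "z \<notin> L" using L(4) by blast
  hence zc: "z \<in> cyclic x <+>\<^bsub>M\<^esub> K" using L(5) by blast
  obtain r where r: "r \<in> carrier R" "\<And>L'. submodule L' R M \<Longrightarrow> K \<subseteq> L' \<Longrightarrow> z \<in> L' \<longleftrightarrow> r \<odot>\<^bsub>M\<^esub> x \<in> L'"
    using mem_add_cyclic[OF K x L(1,3) zc] by blast
  have "r \<odot>\<^bsub>M\<^esub> x \<in> L'" "r \<odot>\<^bsub>M\<^esub> x \<notin> L" using r(2)[OF L(1,3)] r(2)[OF L(2)] z L(3,4) by auto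
  hence "{r \<in> carrier R. r \<odot>\<^bsub>M\<^esub> x \<in> L} \<subset> {r \<in> carrier R. r \<odot>\<^bsub>M\<^esub> x \<in> L'}" using r(1) L(4) by blast
  thus "(L', L) \<in> inv_image {(I', I). ideal I R \<and> ideal I' R \<and> I \<subset> I'} (\<lambda>L. {r \<in> carrier R. r \<odot>\<^bsub>M\<^esub> x \<in> L})"
    using ideal_coefficients[OF L(1) x] ideal_coefficients[OF L(2) x] by simp
qed

text \<open>A finitely generated module over a Noetherian ring is Noetherian, by adding one generator at a time.\<close>

lemma wf_submodules_superset:
  assumes noeth: "noetherian_ring R" and fg: "finitely_generated_module R M"
  shows "wf {(L', L). submodule L R M \<and> submodule L' R M \<and> L \<subset> L'}"
proof -
  obtain S where S: "S \<subseteq> carrier M" "finite S" "carrier M = module_span R M S"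
    using fg unfolding finitely_generated_module_def by blast
  have "wf (superset_rel {\<zero>\<^bsub>M\<^esub>} (module_span R M S))"
    using S(2,1)
  proof (induction S rule: finite_induct)
    case empty
    have "module_span R M {} \<subseteq> {\<zero>\<^bsub>M\<^esub>}" by (rule module_span_least[OF submodule_zero]) simp
    hence "superset_rel {\<zero>\<^bsub>M\<^esub>} (module_span R M {}) = {}" unfolding superset_rel_def by blast
    thus ?case by simp
  next
    case (insert x S)
    hence c: "x \<in> carrier M" "S \<subseteq> carrier M" by auto
    let ?N = "module_span R M S"
    have sN: "submodule ?N R M" by (rule submodule_module_span[OF c(2)])
    have "wf (superset_rel {\<zero>\<^bsub>M\<^esub>} (cyclic x <+>\<^bsub>M\<^esub> ?N))"
    proof (rule wf_superset_rel_trans[OF insert.IH[OF c(2)] wf_superset_rel_cyclic[OF noeth sN c(1)]])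
      show "submodule (cyclic x <+>\<^bsub>M\<^esub> ?N) R M" by (rule submodule_set_add[OF submodule_cyclic[OF c(1)] sN])
      show "?N \<subseteq> cyclic x <+>\<^bsub>M\<^esub> ?N" by (rule set_add_sub2[OF submodule_cyclic[OF c(1)] submodule_subset_carrier[OF sN]])
      show "{\<zero>\<^bsub>M\<^esub>} \<subseteq> ?N" using sN unfolding submodule_iff by blast
    qed (rule submodule_zero, rule sN)
    thus ?case
      by (rule wf_subset) (use module_span_insert_subset[OF c(2,1)] in \<open>auto simp: superset_rel_def\<close>)
  qed
  thus ?thesis
    by (rule wf_subset) (auto simp: superset_rel_def S(3)[symmetric] submodule_iff)
qed

text \<open>A submodule strictly between would have as its coefficient ideal at \<open>x\<close> a proper ideal that is
strictly larger than the maximal ideal.\<close>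

lemma interval_length_cyclic_le_1:
  assumes max: "maximalideal \<mm> R" and K: "submodule K R M" and x: "x \<in> carrier M"
    and mx: "\<And>r. r \<in> \<mm> \<Longrightarrow> r \<odot>\<^bsub>M\<^esub> x \<in> K"
  shows "interval_length R M K (cyclic x <+>\<^bsub>M\<^esub> K) \<le> 1"
proof (rule ccontr)
  let ?N = "cyclic x <+>\<^bsub>M\<^esub> K"
  have "enat 2 = eSuc 1" by (simp add: one_enat_def eSuc_enat numeral_2_eq_2)
  moreover assume "\<not> interval_length R M K ?N \<le> 1"
  ultimately have le: "enat 2 \<le> interval_length R M K ?N" by (metis ileI1 not_le)
  have KN: "K \<subseteq> ?N" by (rule set_add_sub2[OF submodule_cyclic[OF x] submodule_subset_carrier[OF K]])
  have P: "submodule K R M \<and> K \<subseteq> K \<and> K \<subseteq> ?N" using K KN by simp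
  obtain C where C: "\<forall>i\<le>2::nat. submodule (C i) R M \<and> K \<subseteq> C i \<and> C i \<subseteq> ?N" "\<forall>i<2. C i \<subset> C (Suc i)"
    using le unfolding interval_length_def
      enat_le_chain_length_iff[of "\<lambda>C. submodule C R M \<and> K \<subseteq> C \<and> C \<subseteq> ?N", OF P]
    by (elim exE conjE)
  define L where "L = C 1"
  have L: "submodule L R M" "K \<subseteq> L" and up: "\<exists>z\<in>?N. z \<notin> L" and down: "\<exists>z\<in>L. z \<notin> K" and LN: "L \<subseteq> ?N"
  proof -
    have "C 0 \<subset> C 1" "C 1 \<subset> C 2" "K \<subseteq> C 0" "C 2 \<subseteq> ?N" "submodule (C 1) R M" "C 1 \<subseteq> ?N"
      using C(1)[rule_format, of 0] C(1)[rule_format, of 1] C(1)[rule_format, of 2]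
        C(2)[rule_format, of 0] C(2)[rule_format, of 1] by (auto simp: numeral_2_eq_2)
    thus "submodule L R M" "K \<subseteq> L" "\<exists>z\<in>?N. z \<notin> L" "\<exists>z\<in>L. z \<notin> K" "L \<subseteq> ?N" unfolding L_def by blast+
  qed
  let ?A = "{r \<in> carrier R. r \<odot>\<^bsub>M\<^esub> x \<in> L}"
  have idA: "ideal ?A R" by (rule ideal_coefficients[OF L(1) x])
  have "\<mm> \<subseteq> ?A"
    using mx L(2) ideal_subset_carrier[OF maximalideal.axioms(1)[OF max]] by blast
  hence "?A = \<mm> \<or> ?A = carrier R" by (intro maximalideal.I_maximal[OF max idA]) auto
  thus False
  proof
    assume A: "?A = \<mm>"
    obtain z where z: "z \<in> L" "z \<notin> K" using down by blast
    hence zN: "z \<in> ?N" using LN by blast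
    obtain r where "r \<in> carrier R" "z \<in> L \<longleftrightarrow> r \<odot>\<^bsub>M\<^esub> x \<in> L" "z \<in> K \<longleftrightarrow> r \<odot>\<^bsub>M\<^esub> x \<in> K"
      using mem_add_cyclic[OF K x L zN] by blast
    thus False using A mx z by blast
  next
    assume A: "?A = carrier R"
    obtain z where z: "z \<in> ?N" "z \<notin> L" using up by blast
    obtain r where "r \<in> carrier R" "z \<in> L \<longleftrightarrow> r \<odot>\<^bsub>M\<^esub> x \<in> L"
      using mem_add_cyclic[OF K x L z(1)] by blast
    thus False using A z by blast
  qed
qed

lemma finite_length_mod_maximal:
  assumes max: "maximalideal \<mm> R" and fg: "finitely_generated_module R M"
  shows "interval_length R M (ideal_smult R M \<mm> (carrier M)) (carrier M) < \<infinity>"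
proof -
  let ?K = "ideal_smult R M \<mm> (carrier M)"
  have mc: "\<mm> \<subseteq> carrier R" by (rule ideal_subset_carrier[OF maximalideal.axioms(1)[OF max]])
  have sK: "submodule ?K R M" by (rule submodule_ideal_smult[OF mc order_refl])
  obtain S where S: "S \<subseteq> carrier M" "finite S" "carrier M = module_span R M S"
    using fg unfolding finitely_generated_module_def by blast
  have "interval_length R M ?K (module_span R M S <+>\<^bsub>M\<^esub> ?K) < \<infinity>"
    using S(2,1)
  proof (induction S rule: finite_induct)
    case empty
    have "module_span R M {} \<subseteq> ?K" by (rule module_span_least[OF sK]) simp
    hence "module_span R M {} <+>\<^bsub>M\<^esub> ?K \<subseteq> ?K" by (rule set_add_least[OF _ order_refl sK])
    hence "interval_length R M ?K (module_span R M {} <+>\<^bsub>M\<^esub> ?K) \<le> interval_length R M ?K ?K"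
      by (rule interval_length_mono[OF order_refl])
    thus ?case by (simp add: interval_length_self[OF sK])
  next
    case (insert x S)
    hence c: "x \<in> carrier M" "S \<subseteq> carrier M" by auto
    let ?N = "module_span R M S <+>\<^bsub>M\<^esub> ?K"
    have sS: "submodule (module_span R M S) R M" by (rule submodule_module_span[OF c(2)])
    have sN: "submodule ?N R M" by (rule submodule_set_add[OF sS sK])
    have KN: "?K \<subseteq> ?N" by (rule set_add_sub2[OF sS submodule_subset_carrier[OF sK]])
    have sC: "submodule (cyclic x) R M" by (rule submodule_cyclic[OF c(1)])
    have "module_span R M (insert x S) <+>\<^bsub>M\<^esub> ?K \<subseteq> (cyclic x <+>\<^bsub>M\<^esub> module_span R M S) <+>\<^bsub>M\<^esub> ?K"
      by (rule set_add_mono[OF module_span_insert_subset[OF c(2,1)] order_refl])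
    also have "\<dots> = cyclic x <+>\<^bsub>M\<^esub> ?N"
      by (rule set_add_assoc[OF submodule_subset_carrier[OF sC] submodule_subset_carrier[OF sS] submodule_subset_carrier[OF sK]])
    finally have "interval_length R M ?K (module_span R M (insert x S) <+>\<^bsub>M\<^esub> ?K)
        \<le> interval_length R M ?K (cyclic x <+>\<^bsub>M\<^esub> ?N)"
      by (rule interval_length_mono[OF order_refl])
    also have "\<dots> = interval_length R M ?K ?N + interval_length R M ?N (cyclic x <+>\<^bsub>M\<^esub> ?N)"
      by (rule interval_length_add[OF sK sN submodule_set_add[OF sC sN] KN set_add_sub2[OF sC submodule_subset_carrier[OF sN]]])
    also have "\<dots> < \<infinity>"
    proof -
      have "r \<odot>\<^bsub>M\<^esub> x \<in> ?N" if "r \<in> \<mm>" for r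
        by (rule subsetD[OF KN ideal_smultI[OF that c(1)]])
      hence "interval_length R M ?N (cyclic x <+>\<^bsub>M\<^esub> ?N) \<le> 1"
        by (rule interval_length_cyclic_le_1[OF max sN c(1)])
      hence "interval_length R M ?N (cyclic x <+>\<^bsub>M\<^esub> ?N) < \<infinity>"
        by (rule le_less_trans) simp
      thus ?thesis using insert.IH[OF c(2)] by (intro enat_add_finite)
    qed
    finally show ?case .
  qed
  moreover have "module_span R M S <+>\<^bsub>M\<^esub> ?K = carrier M"
    unfolding S(3)[symmetric]
    by (rule antisym[OF set_add_least[OF order_refl submodule_subset_carrier[OF sK] carrier_is_submodule] set_add_sub1[OF order_refl sK]])
  ultimately show ?thesis by simp
qed

end

context ideal_powers
begin

definition single :: "'t \<Rightarrow> nat \<Rightarrow> 't \<Rightarrow> nat" where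
  "single e k = (\<lambda>d. if d = e then k else 0)"

lemma multi_power_single: "multi_power R I (single e k) = I e [^]\<^bsub>ideals_set R\<^esub> k"
proof (induction k)
  case 0
  have "single e 0 = (\<lambda>_. 0)" by (auto simp: single_def)
  thus ?case using R.multi_power_zero[OF ideal_I] by simp
next
  case (Suc k)
  have "single e (Suc k) = (\<lambda>d. single e k d + basis_vec e d)" by (auto simp: single_def basis_vec_def)
  thus ?case by (simp add: R.multi_power_add[OF ideal_I] R.multi_power_basis_vec[OF ideal_I] Suc)
qed

lemma power_sub_single_Suc: "power_sub (single e (Suc k)) = ideal_smult R M (I e) (power_sub (single e k))"
proof -
  have "single e (Suc k) = (\<lambda>d. basis_vec e d + single e k d)" by (auto simp: single_def basis_vec_def)
  thus ?thesis using power_sub_add[of "basis_vec e" "single e k"] by (simp add: R.multi_power_basis_vec[OF ideal_I])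
qed

text \<open>The quotient of consecutive powers has finite length by the lexicographic filtration.\<close>

lemma finite_length_power_sub_single:
  assumes fin: "interval_length R M (power_sub (basis_vec e)) (carrier M) < \<infinity>"
  shows "interval_length R M (power_sub (single e k)) (carrier M) < \<infinity>"
proof (induction k)
  case 0
  have "single e 0 = (\<lambda>_. 0)" by (auto simp: single_def)
  thus ?case by (simp add: power_sub_zero interval_length_self[OF carrier_is_submodule])
next
  case (Suc k)
  define B where "B w = power_sub (\<lambda>d. basis_vec e d + w d)" for w
  have "stable B"
    unfolding stable_def
  proof (intro conjI allI ballI)
    show "submodule (B w) R M" for w unfolding B_def by (rule submodule_power_sub)
    fix v w \<delta> y assume "\<delta> \<in> of_deg v" "y \<in> B w"
    hence "mon \<delta> \<odot>\<^bsub>M\<^esub> y \<in> power_sub (\<lambda>d. v d + (basis_vec e d + w d))"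
      unfolding B_def by (rule smult_power_sub)
    thus "mon \<delta> \<odot>\<^bsub>M\<^esub> y \<in> B (\<lambda>d. v d + w d)" by (simp add: B_def ac_simps)
  qed
  hence "\<exists>\<l>. \<forall>w. interval_length R M (B w) (power_sub w <+>\<^bsub>M\<^esub> B w) = enat (monomial_sum dir n \<l> w)"
    by (rule lead_length_antitone[OF _ fin]) (simp add: B_def, blast)
  then obtain \<l> where l: "\<And>w. interval_length R M (B w) (power_sub w <+>\<^bsub>M\<^esub> B w) = enat (monomial_sum dir n \<l> w)"
    by (elim exE) simp
  have Bs: "B (single e k) = power_sub (single e (Suc k))"
    unfolding B_def by (rule arg_cong[of _ _ power_sub]) (auto simp: single_def basis_vec_def)
  have sub: "power_sub (single e (Suc k)) \<subseteq> power_sub (single e k)"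
    by (rule power_sub_antimono) (simp add: single_def)
  have "power_sub (single e k) \<subseteq> power_sub (single e k) <+>\<^bsub>M\<^esub> B (single e k)"
    unfolding Bs by (rule set_add_sub1[OF submodule_subset_carrier[OF submodule_power_sub] submodule_power_sub])
  from interval_length_mono[OF order_refl this, of R M "B (single e k)"]
  have "interval_length R M (power_sub (single e (Suc k))) (power_sub (single e k)) < \<infinity>"
    unfolding l unfolding Bs by (rule le_less_trans) simp
  moreover have "interval_length R M (power_sub (single e (Suc k))) (carrier M) =
      interval_length R M (power_sub (single e (Suc k))) (power_sub (single e k)) + interval_length R M (power_sub (single e k)) (carrier M)"
    by (rule interval_length_add[OF submodule_power_sub submodule_power_sub carrier_is_submodule sub submodule_subset_carrier[OF submodule_power_sub]])
  ultimately show ?case using enat_add_finite Suc by simp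
qed

text \<open>With \<open>f(k)\<close> and \<open>g(k)\<close> the lengths of \<open>M / (I\<^sub>e\<^sup>k M + X)\<close> and \<open>M / (I\<^sub>e\<^sup>k M + y M + X)\<close>, multiplication by
\<open>y\<close> shows \<open>f(k + 1) \<le> f(k) + g(k + 1)\<close>. Summation raises the exponent of the bound by one.\<close>

lemma growth_step:
  assumes X: "submodule X R M" and y: "y \<in> I e"
    and bound: "\<And>k. interval_length R M (power_sub (single e k) <+>\<^bsub>M\<^esub> (smult_image y (carrier M) <+>\<^bsub>M\<^esub> X)) (carrier M) \<le> enat (C * (k + 1) ^ t)"
  shows "interval_length R M (power_sub (single e k) <+>\<^bsub>M\<^esub> X) (carrier M) \<le> enat (C * (k + 1) ^ (t + 1))"
proof (induction k)
  note sp = submodule_power_sub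
  case 0
  have "single e 0 = (\<lambda>_. 0)" by (auto simp: single_def)
  hence "carrier M \<subseteq> power_sub (single e 0) <+>\<^bsub>M\<^esub> X"
    using set_add_sub1[OF order_refl X] by (simp add: power_sub_zero)
  hence "interval_length R M (power_sub (single e 0) <+>\<^bsub>M\<^esub> X) (carrier M) \<le> interval_length R M (carrier M) (carrier M)"
    by (rule interval_length_mono) simp
  thus ?case by (simp add: interval_length_self[OF carrier_is_submodule])
next
  note sp = submodule_power_sub
  case (Suc k)
  have yc: "y \<in> carrier R" using y ideal_subset_carrier[OF ideal_I] by blast
  let ?Y = "smult_image y (carrier M)"
  let ?P = "power_sub (single e (Suc k)) <+>\<^bsub>M\<^esub> X"
  have sY: "submodule ?Y R M" by (rule submodule_smult_image[OF yc carrier_is_submodule])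
  have sP: "submodule ?P R M" by (rule submodule_set_add[OF sp X])
  have sYP: "submodule (?Y <+>\<^bsub>M\<^esub> ?P) R M" by (rule submodule_set_add[OF sY sP])
  have "interval_length R M ?P (carrier M) = interval_length R M ?P (?Y <+>\<^bsub>M\<^esub> ?P) + interval_length R M (?Y <+>\<^bsub>M\<^esub> ?P) (carrier M)"
    by (rule interval_length_add[OF sP sYP carrier_is_submodule set_add_sub2[OF sY submodule_subset_carrier[OF sP]] submodule_subset_carrier[OF sYP]])
  also have "\<dots> \<le> enat (C * (k + 1) ^ (t + 1)) + enat (C * (Suc k + 1) ^ t)"
  proof (rule add_mono)
    have "power_sub (single e k) <+>\<^bsub>M\<^esub> X \<subseteq> smult_preimage y ?P"
    proof (rule set_add_least[OF _ _ submodule_smult_preimage[OF yc sP]])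
      show "power_sub (single e k) \<subseteq> smult_preimage y ?P"
      proof
        fix x assume x: "x \<in> power_sub (single e k)"
        hence "y \<odot>\<^bsub>M\<^esub> x \<in> power_sub (single e (Suc k))"
          unfolding power_sub_single_Suc by (rule ideal_smultI[OF y])
        hence "y \<odot>\<^bsub>M\<^esub> x \<in> ?P" by (rule subsetD[OF set_add_sub1[OF submodule_subset_carrier[OF sp] X]])
        thus "x \<in> smult_preimage y ?P" using x submodule_subset_carrier[OF sp] by (auto simp: smult_preimage_def)
      qed
      show "X \<subseteq> smult_preimage y ?P"
        using submodule_smult[OF X yc] set_add_sub2[OF sp submodule_subset_carrier[OF X]] submodule_subset_carrier[OF X]
        unfolding smult_preimage_def by blast
    qed
    hence "interval_length R M (smult_preimage y ?P) (carrier M) \<le> interval_length R M (power_sub (single e k) <+>\<^bsub>M\<^esub> X) (carrier M)"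
      by (rule interval_length_mono) simp
    thus "interval_length R M ?P (?Y <+>\<^bsub>M\<^esub> ?P) \<le> enat (C * (k + 1) ^ (t + 1))"
      unfolding interval_length_smult_image[OF yc sP] using Suc by (rule order_trans)
    have "power_sub (single e (Suc k)) <+>\<^bsub>M\<^esub> (?Y <+>\<^bsub>M\<^esub> X) \<subseteq> ?Y <+>\<^bsub>M\<^esub> ?P"
      using set_add_sub1[OF submodule_subset_carrier[OF sp] X, of "single e (Suc k)"] set_add_sub2[OF sp submodule_subset_carrier[OF X], of "single e (Suc k)"]
        set_add_sub1[OF submodule_subset_carrier[OF sY] sP] set_add_sub2[OF sY submodule_subset_carrier[OF sP]]
      by (intro set_add_least sYP) auto
    hence "interval_length R M (?Y <+>\<^bsub>M\<^esub> ?P) (carrier M) \<le> interval_length R M (power_sub (single e (Suc k)) <+>\<^bsub>M\<^esub> (?Y <+>\<^bsub>M\<^esub> X)) (carrier M)"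
      by (rule interval_length_mono) simp
    thus "interval_length R M (?Y <+>\<^bsub>M\<^esub> ?P) (carrier M) \<le> enat (C * (Suc k + 1) ^ t)"
      using bound[of "Suc k"] by (rule order_trans)
  qed
  also have "\<dots> \<le> enat (C * (Suc k + 1) ^ (t + 1))"
  proof -
    have "C * (k + 1) ^ (t + 1) = (C * (k + 1)) * (k + 1) ^ t" by (simp add: algebra_simps)
    also have "\<dots> \<le> (C * (k + 1)) * (Suc k + 1) ^ t" by (intro mult_left_mono power_mono) auto
    finally have "C * (k + 1) ^ (t + 1) + C * (Suc k + 1) ^ t \<le> (C * (k + 1)) * (Suc k + 1) ^ t + C * (Suc k + 1) ^ t" by simp
    also have "\<dots> = C * (Suc k + 1) ^ (t + 1)" by (simp add: algebra_simps)
    finally show ?thesis by simp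
  qed
  finally show ?case .
qed

text \<open>By induction on a bound \<open>t\<close> for the lengths of chains of primes over \<open>A\<close>. If \<open>t = 0\<close>, the maximal ideal
is the only possible prime over \<open>A\<close> and some power of it lies in \<open>A\<close>. Otherwise choose, by prime avoidance, an
element \<open>y\<close> of the maximal ideal outside all other minimal primes of \<open>A\<close>; adding \<open>y\<close> to \<open>A\<close> lowers the
bound on chains, because a prime containing \<open>y\<close> is never minimal over \<open>A\<close> unless it is maximal.\<close>

theorem length_growth_le_dimension:
  assumes noeth: "noetherian_ring R" and loc: "local_ring R (I e)" and fg: "finitely_generated_module R M"
    and A: "ideal A R" and chains: "\<And>k P. prime_chain R k P \<Longrightarrow> A \<subseteq> P 0 \<Longrightarrow> k \<le> t"
  shows "\<exists>C. \<forall>k. interval_length R M (power_sub (single e k) <+>\<^bsub>M\<^esub> ideal_smult R M A (carrier M)) (carrier M) \<le> enat (C * (k + 1) ^ t)"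
  using A chains
proof (induction t arbitrary: A)
  have m: "maximalideal (I e) R" by (rule local_ring.maximalideal_max[OF loc])
  have primem: "primeideal (I e) R" by (rule R.maximalideal_prime[OF m])
  have le_m: "P \<subseteq> I e" if "primeideal P R" for P
    using local_ring.proper_ideal_subset_max[OF loc noeth primeideal.axioms(1)[OF that]] primeideal.I_notcarr[OF that] by blast
  note sp = submodule_power_sub
  have sX: "submodule (ideal_smult R M A (carrier M)) R M" if "ideal A R" for A
    by (rule submodule_ideal_smult[OF ideal_subset_carrier[OF that] order_refl])
  {
    case 0
    have "P = I e" if P: "primeideal P R" "A \<subseteq> P" for P
    proof (rule ccontr)
      assume "P \<noteq> I e"
      hence "prime_chain R 1 (\<lambda>i. if i = 0 then P else I e)"
        unfolding prime_chain_def using P primem le_m[OF P(1)] by auto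
      from 0(2)[OF this] P(2) show False by simp
    qed
    from R.power_in_ideal_if_only_prime[OF noeth 0(1) ideal_I this]
    obtain k0 :: nat where k0: "I e [^]\<^bsub>ideals_set R\<^esub> k0 \<subseteq> A" by blast
    have sub: "power_sub (single e k0) \<subseteq> ideal_smult R M A (carrier M)"
      unfolding power_sub_def multi_power_single by (rule ideal_smult_mono[OF k0 order_refl ideal_subset_carrier[OF 0(1)] order_refl])
    have "power_sub (basis_vec e) = ideal_smult R M (I e) (carrier M)"
      unfolding power_sub_def R.multi_power_basis_vec[OF ideal_I] ..
    hence "interval_length R M (power_sub (single e k0)) (carrier M) < \<infinity>"
      using finite_length_mod_maximal[OF m fg] by (intro finite_length_power_sub_single) simp
    then obtain C where C: "interval_length R M (power_sub (single e k0)) (carrier M) = enat C" by auto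
    have "interval_length R M (power_sub (single e k) <+>\<^bsub>M\<^esub> ideal_smult R M A (carrier M)) (carrier M) \<le> enat C" for k
      unfolding C[symmetric]
      by (rule interval_length_mono[OF order_trans[OF sub set_add_sub2[OF sp submodule_subset_carrier[OF sX[OF 0(1)]]]] order_refl])
    thus ?case by (intro exI[of _ C]) simp
  next
    case (Suc t)
    obtain Q where Q: "finite Q" "\<And>P. P \<in> Q \<Longrightarrow> primeideal P R \<and> A \<subseteq> P"
      "\<And>P. primeideal P R \<Longrightarrow> A \<subseteq> P \<Longrightarrow> \<exists>P'\<in>Q. P' \<subseteq> P"
      using R.finitely_many_minimal_primes[OF noeth Suc.prems(1)] by blast
    \<comment> \<open>Primes other than the maximal ideal do not contain it, so \<open>y\<close> can avoid them.\<close>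
    have "\<exists>y\<in>I e. \<forall>P\<in>{P \<in> Q. P \<noteq> I e}. y \<notin> P"
      by (rule R.prime_avoidance) (use Q(1,2) le_m ideal_I in auto)
    then obtain y where y: "y \<in> I e" "\<And>P. P \<in> Q \<Longrightarrow> P \<noteq> I e \<Longrightarrow> y \<notin> P" by blast
    have yc: "y \<in> carrier R" using y(1) ideal_subset_carrier[OF ideal_I] by blast
    define A' where "A' = A <+>\<^bsub>R\<^esub> PIdl\<^bsub>R\<^esub> y"
    note A' = R.ideal_add_principal[OF Suc.prems(1) yc, folded A'_def]
    have chain: "k \<le> t" if P: "prime_chain R k P" "A' \<subseteq> P 0" for k P
    proof -
      have P0: "primeideal (P 0) R" using P(1) by (simp add: prime_chain_def)
      obtain Q0 where Q0: "Q0 \<in> Q" "Q0 \<subseteq> P 0" using Q(3)[OF P0] A'(2) P(2) by blast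
      show ?thesis
      proof (cases "Q0 = I e")
        case True
        have "k = 0"
        proof (rule ccontr)
          assume "k \<noteq> 0"
          hence "P 0 \<subset> P 1" "primeideal (P 1) R" using P(1) by (auto simp: prime_chain_def)
          thus False using le_m[of "P 1"] Q0(2) True by auto
        qed
        thus ?thesis by simp
      next
        case False
        hence "Q0 \<subset> P 0" using y(2)[OF Q0(1)] Q0(2) A'(3) P(2) by blast
        \<comment> \<open>Prolonging the chain below by \<open>Q0\<close> uses the bound for \<open>A\<close>.\<close>
        hence "prime_chain R (Suc k) (\<lambda>i. case i of 0 \<Rightarrow> Q0 | Suc j \<Rightarrow> P j)"
          using P(1) Q(2)[OF Q0(1)] unfolding prime_chain_def by (auto split: nat.splits)
        from Suc.prems(2)[OF this] Q(2)[OF Q0(1)] show ?thesis by simp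
      qed
    qed
    obtain C where C: "\<And>k. interval_length R M (power_sub (single e k) <+>\<^bsub>M\<^esub> ideal_smult R M A' (carrier M)) (carrier M) \<le> enat (C * (k + 1) ^ t)"
      using Suc.IH[of A'] A'(1) chain by blast
    let ?X = "ideal_smult R M A (carrier M)" and ?Y = "smult_image y (carrier M)"
    have sX': "submodule ?X R M" by (rule sX[OF Suc.prems(1)])
    have sY: "submodule ?Y R M" by (rule submodule_smult_image[OF yc carrier_is_submodule])
    have sub: "ideal_smult R M A' (carrier M) \<subseteq> ?Y <+>\<^bsub>M\<^esub> ?X"
    proof (rule ideal_smult_least[OF submodule_set_add[OF sY sX']])
      fix c x assume "c \<in> A'" and x: "x \<in> carrier M"
      then obtain i r where c: "i \<in> A" "r \<in> carrier R" "c = i \<oplus>\<^bsub>R\<^esub> r \<otimes>\<^bsub>R\<^esub> y" using A'(5) by blast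
      have ic: "i \<in> carrier R" using c(1) ideal_subset_carrier[OF Suc.prems(1)] by blast
      have "c \<odot>\<^bsub>M\<^esub> x = i \<odot>\<^bsub>M\<^esub> x \<oplus>\<^bsub>M\<^esub> (r \<otimes>\<^bsub>R\<^esub> y) \<odot>\<^bsub>M\<^esub> x"
        unfolding c(3) using ic c(2) yc x by (intro smult_l_distr) auto
      also have "(r \<otimes>\<^bsub>R\<^esub> y) \<odot>\<^bsub>M\<^esub> x = y \<odot>\<^bsub>M\<^esub> (r \<odot>\<^bsub>M\<^esub> x)"
        using c(2) yc x by (simp add: R.m_comm[of r y] smult_assoc1)
      also have "i \<odot>\<^bsub>M\<^esub> x \<oplus>\<^bsub>M\<^esub> y \<odot>\<^bsub>M\<^esub> (r \<odot>\<^bsub>M\<^esub> x) = y \<odot>\<^bsub>M\<^esub> (r \<odot>\<^bsub>M\<^esub> x) \<oplus>\<^bsub>M\<^esub> i \<odot>\<^bsub>M\<^esub> x"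
        using ic c(2) yc x by (simp add: M.a_comm)
      finally show "c \<odot>\<^bsub>M\<^esub> x \<in> ?Y <+>\<^bsub>M\<^esub> ?X"
        using ideal_smultI[OF c(1) x] c(2) x unfolding mem_set_add smult_image_def by blast
    qed
    have "interval_length R M (power_sub (single e k) <+>\<^bsub>M\<^esub> (?Y <+>\<^bsub>M\<^esub> ?X)) (carrier M) \<le> enat (C * (k + 1) ^ t)" for k
      by (rule order_trans[OF interval_length_mono[OF set_add_mono[OF order_refl sub] order_refl] C])
    from growth_step[OF sX' y(1) this] show ?case by (intro exI[of _ C]) simp
  }
qed

end

section \<open>Hilbert functions of the ideal powers\<close>

locale local_ideal_powers = ideal_powers R M "case_option \<mm> J" n a dir + R: local_ring R \<mm>
  for R :: "('a, 'r) ring_scheme" and M :: "('a, 'b, 'm) module_scheme" and \<mm> :: "'a set"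
    and J :: "'s::finite \<Rightarrow> 'a set" and n :: nat and a :: "nat \<Rightarrow> 'a" and dir :: "nat \<Rightarrow> 's option" +
  assumes noeth: "noetherian_ring R" and fg: "finitely_generated_module R M"
begin

text \<open>The submodule \<open>\<mm>\<^sup>k J\<^sup>u M\<close>.\<close>

abbreviation pw :: "nat \<Rightarrow> ('s \<Rightarrow> nat) \<Rightarrow> 'b set" where
  "pw k u \<equiv> power_sub (case_option k u)"

lemma ideal_J: "ideal (J l) R" and ideal_m: "ideal \<mm> R"
  using ideal_I[of "Some l"] ideal_I[of None] by auto

lemmas sp = submodule_power_sub
lemmas cp = submodule_subset_carrier[OF submodule_power_sub]

lemma pw_antimono: "k \<le> k' \<Longrightarrow> (\<And>l. u l \<le> u' l) \<Longrightarrow> pw k' u' \<subseteq> pw k u"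
  by (rule power_sub_antimono) (simp split: option.split)

lemma pw_eq: "pw k u = ideal_smult R M (\<mm> [^]\<^bsub>ideals_set R\<^esub> k) (ideal_smult R M (multi_power R J u) (carrier M))"
  unfolding power_sub_def R.multi_power_option[OF ideal_J ideal_m]
  by (rule ideal_smult_prod[OF R.ideal_nat_pow[OF ideal_m] R.ideal_multi_power[OF ideal_J] carrier_is_submodule])

lemma pw_0: "pw 0 u = ideal_smult R M (multi_power R J u) (carrier M)"
proof -
  have "submodule (ideal_smult R M (multi_power R J u) (carrier M)) R M"
    by (rule submodule_ideal_smult[OF ideal_subset_carrier[OF R.ideal_multi_power[OF ideal_J]] order_refl])
  thus ?thesis unfolding pw_eq by (simp add: ideal_smult_one)
qed

definition hilb :: "('s \<Rightarrow> nat) \<Rightarrow> nat \<Rightarrow> ('s \<Rightarrow> nat) \<Rightarrow> enat" where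
  "hilb v r u = interval_length R M (pw (r + 1) u <+>\<^bsub>M\<^esub> pw 0 (\<lambda>l. u l + v l)) (pw 0 u)"

lemma hilbert_fun_eq: "hilbert_fun R \<mm> J M v r u = hilb v r u"
proof -
  have "pw (r + 1) u <+>\<^bsub>M\<^esub> pw 0 (\<lambda>l. u l + v l) \<subseteq> pw 0 u"
    by (rule set_add_least[OF _ _ sp]) (rule pw_antimono; simp)+
  from module_length_quotient_module[OF sp submodule_set_add[OF sp sp] this]
  show ?thesis unfolding hilbert_fun_def hilb_def Let_def pw_eq[of "r + 1"] pw_0 by simp
qed

lemma finite_length_mod_m: "interval_length R M (power_sub (basis_vec None)) (carrier M) < \<infinity>"
proof -
  have "power_sub (basis_vec None) = ideal_smult R M \<mm> (carrier M)"
    unfolding power_sub_def R.multi_power_basis_vec[OF ideal_I] by simp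
  thus ?thesis using finite_length_mod_maximal[OF R.maximalideal_max fg] by simp
qed

lemma upd_None: "w(None := x) = case_option x (\<lambda>l. w (Some l))"
  by (auto simp: fun_eq_iff split: option.split)

lemma separable_hilb:
  "\<exists>h. separable (\<lambda>w. of_nat (h w)) \<and> (\<forall>r u. hilb v r u = enat (h (case_option r u)))"
proof -
  let ?G = "\<lambda>w. pw 0 (\<lambda>l. w (Some l) + v l)"
  have "\<exists>h. separable (\<lambda>w. of_nat (h w)) \<and> (\<forall>w. interval_length R M (power_sub (w(None := w None + 1)) <+>\<^bsub>M\<^esub> ?G w)
      (power_sub (w(None := 0))) = enat (h w))"
  proof (rule separable_hilbert_function[of ?G None])
    fix v' w \<delta> y assume "\<delta> \<in> of_deg v'" "y \<in> ?G w"
    hence "mon \<delta> \<odot>\<^bsub>M\<^esub> y \<in> power_sub (\<lambda>d. v' d + case_option 0 (\<lambda>l. w (Some l) + v l) d)" by (rule smult_power_sub)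
    also have "\<dots> \<subseteq> pw 0 (\<lambda>l. v' (Some l) + w (Some l) + v l)"
      by (rule power_sub_antimono) (simp split: option.split)
    finally show "mon \<delta> \<odot>\<^bsub>M\<^esub> y \<in> pw 0 (\<lambda>l. v' (Some l) + w (Some l) + v l)" .
  next
    show "?G w \<subseteq> power_sub (w(None := 0))" for w unfolding upd_None by (rule pw_antimono) auto
  qed (use sp finite_length_mod_m in auto)
  then obtain h where h: "separable (\<lambda>w. of_nat (h w))" "\<And>w. interval_length R M (power_sub (w(None := w None + 1)) <+>\<^bsub>M\<^esub> ?G w)
      (power_sub (w(None := 0))) = enat (h w)" by blast
  have "hilb v r u = enat (h (case_option r u))" for r u
    using h(2)[of "case_option r u"] unfolding upd_None by (simp add: hilb_def)
  with h(1) show ?thesis by blast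
qed

text \<open>The family that is factored out in addition is zero here.\<close>

lemma separable_hilb0:
  "\<exists>h. separable (\<lambda>w. of_nat (h w)) \<and> (\<forall>r u. interval_length R M (pw (r + 1) u) (pw 0 u) = enat (h (case_option r u)))"
proof -
  let ?G = "\<lambda>w :: 's option \<Rightarrow> nat. {\<zero>\<^bsub>M\<^esub>}"
  have "\<exists>h. separable (\<lambda>w. of_nat (h w)) \<and> (\<forall>w. interval_length R M (power_sub (w(None := w None + 1)) <+>\<^bsub>M\<^esub> ?G w)
      (power_sub (w(None := 0))) = enat (h w))"
  proof (rule separable_hilbert_function[of ?G None])
    show "{\<zero>\<^bsub>M\<^esub>} \<subseteq> power_sub (w(None := 0))" for w using sp unfolding submodule_iff by blast
  qed (use submodule_zero finite_length_mod_m in auto)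
  then obtain h where h: "separable (\<lambda>w. of_nat (h w))" "\<And>w. interval_length R M (power_sub (w(None := w None + 1)) <+>\<^bsub>M\<^esub> ?G w)
      (power_sub (w(None := 0))) = enat (h w)" by blast
  have z: "pw k u <+>\<^bsub>M\<^esub> {\<zero>\<^bsub>M\<^esub>} = pw k u" for k u
    by (rule antisym[OF set_add_least[OF order_refl _ sp] set_add_sub1[OF cp submodule_zero]])
       (use sp in \<open>auto simp: submodule_iff\<close>)
  have "interval_length R M (pw (r + 1) u) (pw 0 u) = enat (h (case_option r u))" for r u
    using h(2)[of "case_option r u"] unfolding upd_None by (simp add: z)
  with h(1) show ?thesis by blast
qed

text \<open>The family of intersections of \<open>\<mm>\<^sup>k J\<^sup>u M\<close> with \<open>J\<^sup>u\<^sup>+\<^sup>v M\<close> is generated by its components of bounded degree,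
and a component whose degree in direction \<open>\<mm>\<close> is at most \<open>c\<close> still lies in a power of \<open>J\<close> times \<open>M\<close>
shifted by \<open>v\<close>. The point is that \<open>c\<close> depends neither on \<open>k\<close> nor on \<open>u\<close>.\<close>

theorem artin_rees:
  "\<exists>c. \<forall>k u. pw (k + c) u \<inter> pw 0 (\<lambda>l. u l + v l) \<subseteq> pw k (\<lambda>l. u l + v l)"
proof -
  define F where "F w = power_sub w \<inter> pw 0 (\<lambda>l. w (Some l) + v l)" for w
  have "stable F"
    unfolding stable_def
  proof (intro conjI allI ballI)
    show "submodule (F w) R M" for w unfolding F_def by (rule submodule_Int[OF sp sp])
    fix v' w \<delta> y assume \<delta>: "\<delta> \<in> of_deg v'" and y: "y \<in> F w"
    have "mon \<delta> \<odot>\<^bsub>M\<^esub> y \<in> power_sub (\<lambda>d. v' d + w d)"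
      by (rule smult_power_sub[OF \<delta>]) (use y in \<open>simp add: F_def\<close>)
    moreover have "mon \<delta> \<odot>\<^bsub>M\<^esub> y \<in> power_sub (\<lambda>d. v' d + case_option 0 (\<lambda>l. w (Some l) + v l) d)"
      by (rule smult_power_sub[OF \<delta>]) (use y in \<open>simp add: F_def\<close>)
    hence "mon \<delta> \<odot>\<^bsub>M\<^esub> y \<in> pw 0 (\<lambda>l. v' (Some l) + w (Some l) + v l)"
      by (rule rev_subsetD) (rule power_sub_antimono, simp split: option.split)
    ultimately show "mon \<delta> \<odot>\<^bsub>M\<^esub> y \<in> F (\<lambda>d. v' d + w d)" by (simp add: F_def)
  qed
  from stable_generated_in_bounded_degree[OF wf_submodules_superset[OF noeth fg] this]
  obtain N where N: "\<And>w C. submodule C R M \<Longrightarrow>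
     (\<And>v v' \<delta> \<beta> f. \<delta> \<in> of_deg v' \<Longrightarrow> \<beta> \<in> of_deg v \<Longrightarrow> \<forall>i. \<beta> i \<le> N \<Longrightarrow> w = (\<lambda>d. v' d + v d) \<Longrightarrow> f \<in> F v \<Longrightarrow>
        mon \<delta> \<odot>\<^bsub>M\<^esub> f \<in> C) \<Longrightarrow> F w \<subseteq> C" unfolding F_def by blast
  \<comment> \<open>A monomial in \<open>n\<close> variables with exponents at most \<open>N\<close> has degree at most \<open>n * N\<close> in direction \<open>\<mm>\<close>.\<close>
  have "pw (k + n * N) u \<inter> pw 0 (\<lambda>l. u l + v l) \<subseteq> pw k (\<lambda>l. u l + v l)" for k u
  proof -
    have "F (case_option (k + n * N) u) \<subseteq> pw k (\<lambda>l. u l + v l)"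
    proof (rule N[OF sp])
      fix x x' \<delta> \<beta> f
      assume \<delta>: "\<delta> \<in> of_deg x'" and \<beta>: "\<beta> \<in> of_deg x" "\<forall>i. \<beta> i \<le> N"
        and w: "case_option (k + n * N) u = (\<lambda>d. x' d + x d)" and f: "f \<in> F x"
      have "x None = (\<Sum>i | i < n \<and> dir i = None. \<beta> i)" using \<beta>(1) by (auto simp: of_deg_def mdeg_def)
      also have "\<dots> \<le> (\<Sum>i<n. \<beta> i)" by (rule sum_mono2) auto
      also have "\<dots> \<le> (\<Sum>i<n. N)" by (rule sum_mono) (use \<beta>(2) in auto)
      finally have xN: "x None \<le> n * N" by simp
      have "k + n * N = x' None + x None" using fun_cong[OF w, of None] by simp
      hence k: "k \<le> x' None" using xN by simp
      have u: "u l = x' (Some l) + x (Some l)" for l using fun_cong[OF w, of "Some l"] by simp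
      have "mon \<delta> \<odot>\<^bsub>M\<^esub> f \<in> power_sub (\<lambda>d. x' d + case_option 0 (\<lambda>l. x (Some l) + v l) d)"
        by (rule smult_power_sub[OF \<delta>]) (use f in \<open>simp add: F_def\<close>)
      thus "mon \<delta> \<odot>\<^bsub>M\<^esub> f \<in> pw k (\<lambda>l. u l + v l)"
        by (rule rev_subsetD) (rule power_sub_antimono, simp add: k u split: option.split)
    qed
    thus ?thesis by (simp add: F_def)
  qed
  thus ?thesis by blast
qed

text \<open>Descend from \<open>M\<close> to \<open>J\<^sup>u M\<close> one unit vector at a time, each step costing the same constant.\<close>

lemma artin_rees_linear: "\<exists>c. \<forall>k u. pw (k + c * vsize u) (\<lambda>_. 0) \<inter> pw 0 u \<subseteq> pw k u"
proof -
  obtain c where c: "\<And>l k u. pw (k + c l) u \<inter> pw 0 (\<lambda>i. u i + basis_vec l i) \<subseteq> pw k (\<lambda>i. u i + basis_vec l i)"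
    using artin_rees[of "basis_vec _"] by metis
  define C where "C = (\<Sum>l\<in>UNIV. c l)"
  have cC: "c l \<le> C" for l unfolding C_def by (rule member_le_sum) auto
  have "pw (k + C * vsize u) (\<lambda>_. 0) \<inter> pw 0 u \<subseteq> pw k u" for k u
  proof (induction "vsize u" arbitrary: u k)
    case 0
    hence u: "u = (\<lambda>_. 0)" by (auto simp: vsize_def fun_eq_iff)
    have "pw (k + C * vsize u) (\<lambda>_. 0) \<subseteq> pw k u" by (rule pw_antimono) (simp_all add: u)
    thus ?case by blast
  next
    case (Suc m)
    hence "\<exists>l. u l \<noteq> 0" unfolding vsize_def by (metis nat.distinct(1) sum.neutral)
    then obtain l where l: "u l \<noteq> 0" by blast
    define x where "x = u(l := u l - 1)"
    have u: "u = x(l := x l + 1)" and u': "u = (\<lambda>i. x i + basis_vec l i)" using l by (auto simp: x_def basis_vec_def)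
    have size: "vsize u = vsize x + 1" unfolding u by (rule vsize_upd)
    have "pw (k + C * vsize u) (\<lambda>_. 0) \<inter> pw 0 u \<subseteq> pw ((k + C) + C * vsize x) (\<lambda>_. 0) \<inter> pw 0 x \<inter> pw 0 u"
    proof -
      have "k + C * vsize u = (k + C) + C * vsize x" by (simp add: size)
      moreover have "pw 0 u \<subseteq> pw 0 x" by (rule pw_antimono) (auto simp: x_def)
      ultimately show ?thesis by (simp only:) blast
    qed
    also have "\<dots> \<subseteq> pw (k + C) x \<inter> pw 0 u" using Suc.hyps(1)[of x "k + C"] Suc.hyps(2) size by auto
    also have "\<dots> \<subseteq> pw (k + c l) x \<inter> pw 0 u" using pw_antimono[of "k + c l" "k + C" x x] cC by auto
    also have "\<dots> \<subseteq> pw k u" using c[of k l x] unfolding u'[symmetric] .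
    finally show ?case .
  qed
  thus ?thesis by blast
qed

lemma single_None: "pw k (\<lambda>_. 0) = power_sub (single None k)"
  by (rule arg_cong[of _ _ power_sub]) (auto simp: single_def split: option.split)

lemma length_growth:
  assumes "module_dim R M = enat D"
  shows "\<exists>C. \<forall>k. interval_length R M (pw k (\<lambda>_. 0)) (carrier M) \<le> enat (C * (k + 1) ^ D)"
proof -
  \<comment> \<open>The growth bound is applied to \<open>A = Ann M\<close>, for which \<open>A M = 0\<close>.\<close>
  let ?A = "annihilator R M"
  have A: "?A = {c \<in> carrier R. \<forall>y\<in>carrier M. c \<odot>\<^bsub>M\<^esub> y \<in> {\<zero>\<^bsub>M\<^esub>}}" by (auto simp: annihilator_def)
  have idA: "ideal ?A R" unfolding A by (rule ideal_colon[OF order_refl submodule_zero])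
  have loc: "local_ring R (case_option \<mm> J None)" using R.local_ring_axioms by simp
  have "ideal_smult R M ?A (carrier M) \<subseteq> {\<zero>\<^bsub>M\<^esub>}"
    by (rule ideal_smult_least[OF submodule_zero]) (auto simp: annihilator_def)
  hence z: "pw k (\<lambda>_. 0) <+>\<^bsub>M\<^esub> ideal_smult R M ?A (carrier M) \<subseteq> pw k (\<lambda>_. 0)" for k
    by (intro set_add_least[OF order_refl _ sp]) (use sp[of "case_option k (\<lambda>_. 0)"] in \<open>auto simp: submodule_iff\<close>)
  have chains: "k \<le> D" if "prime_chain R k P" "?A \<subseteq> P 0" for k P
    using R.prime_chain_length_le_dim[OF idA _ that] assms by (simp add: module_dim_def)
  obtain C where C: "\<And>k. interval_length R M (pw k (\<lambda>_. 0) <+>\<^bsub>M\<^esub> ideal_smult R M ?A (carrier M)) (carrier M) \<le> enat (C * (k + 1) ^ D)"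
    using length_growth_le_dimension[OF noeth loc fg idA, of D] chains unfolding single_None by blast
  have "interval_length R M (pw k (\<lambda>_. 0)) (carrier M) \<le> enat (C * (k + 1) ^ D)" for k
    by (rule order_trans[OF interval_length_mono[OF z order_refl] C])
  thus ?thesis by blast
qed

text \<open>By linear Artin-Rees and the second isomorphism theorem the quotient is bounded by \<open>M / \<mm>\<^sup>k M\<close> for
\<open>k = r + 1 + c |u|\<close>.\<close>

lemma hilb0_bound:
  assumes "module_dim R M = enat D"
  shows "\<exists>C c. \<forall>r u. interval_length R M (pw (r + 1) u) (pw 0 u) \<le> enat (C * (r + 2 + c * vsize u) ^ D)"
proof -
  obtain C where C: "\<And>k. interval_length R M (pw k (\<lambda>_. 0)) (carrier M) \<le> enat (C * (k + 1) ^ D)"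
    using length_growth[OF assms] by blast
  obtain c where c: "\<And>k u. pw (k + c * vsize u) (\<lambda>_. 0) \<inter> pw 0 u \<subseteq> pw k u"
    using artin_rees_linear by blast
  have "interval_length R M (pw (r + 1) u) (pw 0 u) \<le> enat (C * (r + 2 + c * vsize u) ^ D)" for r u
  proof -
    let ?B = "pw (r + 1 + c * vsize u) (\<lambda>_. 0)"
    have "interval_length R M (pw (r + 1) u) (pw 0 u) \<le> interval_length R M (pw 0 u \<inter> ?B) (pw 0 u)"
      by (rule interval_length_mono) (use c[of "r + 1" u] in auto)
    also have "\<dots> = interval_length R M ?B (pw 0 u <+>\<^bsub>M\<^esub> ?B)" by (rule interval_length_diamond[OF sp sp])
    also have "\<dots> \<le> interval_length R M ?B (carrier M)"
      by (rule interval_length_mono[OF order_refl submodule_subset_carrier[OF submodule_set_add[OF sp sp]]])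
    also have "\<dots> \<le> enat (C * (r + 1 + c * vsize u + 1) ^ D)" by (rule C)
    finally show ?thesis by (simp add: add.commute add.left_commute)
  qed
  thus ?thesis by blast
qed

lemma hilb0_eventually_poly:
  assumes "module_dim R M = enat D"
  shows "\<exists>p. eventually_poly (\<lambda>r u. interval_length R M (pw (r + 1) u) (pw 0 u)) D p"
proof -
  obtain h where h: "separable (\<lambda>w. of_nat (h w))" "\<And>r u. interval_length R M (pw (r + 1) u) (pw 0 u) = enat (h (case_option r u))"
    using separable_hilb0 by blast
  obtain C c where C: "\<And>r u. enat (h (case_option r u)) \<le> enat (C * (r + 2 + c * vsize u) ^ D)"
    using hilb0_bound[OF assms] unfolding h(2) by blast
  show ?thesis unfolding h(2)
  proof (rule separable_eventually_poly[OF h(1)])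
    fix r :: nat and u :: "'s \<Rightarrow> nat"
    let ?q = "smult (of_nat C) ([:2, of_nat (r + c * vsize u):] ^ D) :: rat poly"
    have "has_top ?q (1 * D) (of_nat C * of_nat (r + c * vsize u) ^ D)"
      by (intro has_top_smult has_top_power has_top_linear)
    hence d: "degree ?q \<le> D" by (simp add: has_top_def)
    have "(of_nat (h (case_option (n * r) (\<lambda>l. n * u l))) :: rat) \<le> poly ?q (of_nat n)" for n
    proof -
      have "h (case_option (n * r) (\<lambda>l. n * u l)) \<le> C * (n * r + 2 + c * vsize (\<lambda>l. n * u l)) ^ D" using C by simp
      also have "vsize (\<lambda>l. n * u l) = n * vsize u" by (simp add: vsize_def sum_distrib_left)
      finally have "(of_nat (h (case_option (n * r) (\<lambda>l. n * u l))) :: rat) \<le> of_nat (C * (n * r + 2 + c * (n * vsize u)) ^ D)"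
        by (rule of_nat_mono)
      thus ?thesis by (simp add: algebra_simps)
    qed
    thus "\<exists>(q1 :: rat poly) (q2 :: rat poly) N. degree q1 \<le> D \<and> degree q2 \<le> D \<and>
        (\<forall>n\<ge>N. poly q1 (of_nat n) \<le> of_nat (h (case_option (n * r) (\<lambda>l. n * u l))) \<and>
              of_nat (h (case_option (n * r) (\<lambda>l. n * u l))) \<le> poly q2 (of_nat n))"
      using d by (intro exI[of _ "0 :: rat poly"] exI[of _ ?q] exI[of _ 0]) auto
  qed
qed

text \<open>The difference of \<open>F r u\<close> and \<open>hilb v r u\<close> is the length of \<open>J\<^sup>u\<^sup>+\<^sup>v M\<close> modulo the submodule induced by
\<open>\<mm>\<^sup>r\<^sup>+\<^sup>1 J\<^sup>u M\<close>, which Artin-Rees compares with \<open>\<mm>\<^sup>r\<^sup>+\<^sup>1 J\<^sup>u\<^sup>+\<^sup>v M\<close>.\<close>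

lemma hilb_sandwich:
  fixes v :: "'s \<Rightarrow> nat"
  defines "F \<equiv> \<lambda>r u. interval_length R M (pw (r + 1) u) (pw 0 u)"
  assumes c: "\<And>k u. pw (k + c) u \<inter> pw 0 (\<lambda>l. u l + v l) \<subseteq> pw k (\<lambda>l. u l + v l)"
  shows "F r u \<le> F r (\<lambda>l. u l + v l) + hilb v r u"
    and "r \<ge> c \<Longrightarrow> F (r - c) (\<lambda>l. u l + v l) + hilb v r u \<le> F r u"
proof -
  let ?P = "pw (r + 1) u" and ?X = "pw 0 (\<lambda>l. u l + v l)"
  have sub: "?P <+>\<^bsub>M\<^esub> ?X \<subseteq> pw 0 u"
    by (rule set_add_least[OF _ _ sp]) (rule pw_antimono; simp)+
  have comm: "?X <+>\<^bsub>M\<^esub> ?P = ?P <+>\<^bsub>M\<^esub> ?X"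
    by (rule set_add_comm[OF cp cp])
  have "F r u = interval_length R M ?P (?P <+>\<^bsub>M\<^esub> ?X) + hilb v r u"
    unfolding F_def hilb_def
    by (rule interval_length_add[OF sp submodule_set_add[OF sp sp] sp set_add_sub1[OF cp sp] sub])
  also have "interval_length R M ?P (?P <+>\<^bsub>M\<^esub> ?X) = interval_length R M (?X \<inter> ?P) ?X"
    unfolding interval_length_diamond[OF sp sp] comm ..
  finally have eq: "F r u = interval_length R M (?X \<inter> ?P) ?X + hilb v r u" .
  have "pw (r + 1) (\<lambda>l. u l + v l) \<subseteq> ?X \<inter> ?P"
    by (intro Int_greatest pw_antimono) auto
  thus "F r u \<le> F r (\<lambda>l. u l + v l) + hilb v r u"
    unfolding eq unfolding F_def by (intro add_mono interval_length_mono) auto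
  assume r: "r \<ge> c"
  have "?X \<inter> ?P \<subseteq> pw (r - c + 1) (\<lambda>l. u l + v l)"
    using c[of "r - c + 1" u] r by (auto simp: Int_commute)
  thus "F (r - c) (\<lambda>l. u l + v l) + hilb v r u \<le> F r u"
    unfolding eq unfolding F_def by (intro add_mono interval_length_mono) auto
qed

text \<open>The piece above \<open>J\<^sup>u\<^sup>+\<^sup>v M\<close> is \<open>hilb v r u\<close>. The other one is the quotient of \<open>X = J\<^sup>u\<^sup>+\<^sup>v M\<close> by
\<open>X \<inter> (P + Y) = Y + (P \<inter> X)\<close> with \<open>P = \<mm>\<^sup>r\<^sup>+\<^sup>1 J\<^sup>u M\<close> and \<open>Y = J\<^sup>u\<^sup>+\<^sup>v\<^sup>+\<^sup>v' M\<close>, and Artin-Rees controls \<open>P \<inter> X\<close>.\<close>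

lemma hilb_two_step:
  assumes c: "\<And>k u. pw (k + c) u \<inter> pw 0 (\<lambda>l. u l + v l) \<subseteq> pw k (\<lambda>l. u l + v l)"
  shows "hilb (\<lambda>l. v l + v' l) r u \<le> hilb v r u + hilb v' r (\<lambda>l. u l + v l)"
    and "r \<ge> c \<Longrightarrow> hilb v r u + hilb v' (r - c) (\<lambda>l. u l + v l) \<le> hilb (\<lambda>l. v l + v' l) r u"
proof -
  let ?P = "pw (r + 1) u" and ?X = "pw 0 (\<lambda>l. u l + v l)" and ?Y = "pw 0 (\<lambda>l. u l + v l + v' l)"
  have YX: "?Y \<subseteq> ?X" by (rule pw_antimono) auto
  have sPX: "submodule (?P <+>\<^bsub>M\<^esub> ?X) R M" "submodule (?P <+>\<^bsub>M\<^esub> ?Y) R M" by (rule submodule_set_add[OF sp sp])+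
  have sub: "?P <+>\<^bsub>M\<^esub> ?X \<subseteq> pw 0 u"
    by (rule set_add_least[OF _ _ sp]) (rule pw_antimono; simp)+
  have PX: "?X <+>\<^bsub>M\<^esub> (?P <+>\<^bsub>M\<^esub> ?Y) = ?P <+>\<^bsub>M\<^esub> ?X"
  proof (rule antisym)
    show "?X <+>\<^bsub>M\<^esub> (?P <+>\<^bsub>M\<^esub> ?Y) \<subseteq> ?P <+>\<^bsub>M\<^esub> ?X"
      by (rule set_add_least[OF set_add_sub2[OF sp cp] set_add_mono[OF order_refl YX] sPX(1)])
    have "?P \<subseteq> ?P <+>\<^bsub>M\<^esub> ?Y" by (rule set_add_sub1[OF cp sp])
    moreover have "?P <+>\<^bsub>M\<^esub> ?Y \<subseteq> ?X <+>\<^bsub>M\<^esub> (?P <+>\<^bsub>M\<^esub> ?Y)" by (rule set_add_sub2[OF sp submodule_subset_carrier[OF sPX(2)]])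
    moreover have "?X \<subseteq> ?X <+>\<^bsub>M\<^esub> (?P <+>\<^bsub>M\<^esub> ?Y)" by (rule set_add_sub1[OF cp sPX(2)])
    ultimately show "?P <+>\<^bsub>M\<^esub> ?X \<subseteq> ?X <+>\<^bsub>M\<^esub> (?P <+>\<^bsub>M\<^esub> ?Y)"
      by (intro set_add_least[OF _ _ submodule_set_add[OF sp sPX(2)]]) auto
  qed
  have "hilb (\<lambda>l. v l + v' l) r u = interval_length R M (?P <+>\<^bsub>M\<^esub> ?Y) (?P <+>\<^bsub>M\<^esub> ?X) + hilb v r u"
    unfolding hilb_def add.assoc[symmetric]
    by (rule interval_length_add[OF sPX(2,1) sp set_add_mono[OF order_refl YX] sub])
  also have "interval_length R M (?P <+>\<^bsub>M\<^esub> ?Y) (?P <+>\<^bsub>M\<^esub> ?X) = interval_length R M (?X \<inter> (?P <+>\<^bsub>M\<^esub> ?Y)) ?X"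
    unfolding interval_length_diamond[OF sp sPX(2)] PX ..
  finally have eq: "hilb (\<lambda>l. v l + v' l) r u = hilb v r u + interval_length R M (?X \<inter> (?P <+>\<^bsub>M\<^esub> ?Y)) ?X"
    by (simp add: add.commute)
  have "pw (r + 1) (\<lambda>l. u l + v l) <+>\<^bsub>M\<^esub> ?Y \<subseteq> ?X \<inter> (?P <+>\<^bsub>M\<^esub> ?Y)"
  proof (rule Int_greatest)
    show "pw (r + 1) (\<lambda>l. u l + v l) <+>\<^bsub>M\<^esub> ?Y \<subseteq> ?X"
      by (rule set_add_least[OF _ YX sp]) (rule pw_antimono; simp)
    show "pw (r + 1) (\<lambda>l. u l + v l) <+>\<^bsub>M\<^esub> ?Y \<subseteq> ?P <+>\<^bsub>M\<^esub> ?Y"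
      by (rule set_add_mono[OF _ order_refl]) (rule pw_antimono; simp)
  qed
  thus "hilb (\<lambda>l. v l + v' l) r u \<le> hilb v r u + hilb v' r (\<lambda>l. u l + v l)"
    unfolding eq unfolding hilb_def by (intro add_mono interval_length_mono) auto
  assume r: "r \<ge> c"
  have "?X \<inter> (?P <+>\<^bsub>M\<^esub> ?Y) = (?Y <+>\<^bsub>M\<^esub> ?P) \<inter> ?X"
    using set_add_comm[OF cp cp] by (simp add: Int_commute)
  also have "\<dots> \<subseteq> ?Y <+>\<^bsub>M\<^esub> (?P \<inter> ?X)" by (rule modular_law[OF sp sp cp YX])
  also have "\<dots> \<subseteq> ?Y <+>\<^bsub>M\<^esub> pw (r - c + 1) (\<lambda>l. u l + v l)"
    using c[of "r - c + 1" u] r by (intro set_add_mono[OF order_refl]) simp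
  also have "\<dots> = pw (r - c + 1) (\<lambda>l. u l + v l) <+>\<^bsub>M\<^esub> ?Y" by (rule set_add_comm[OF cp cp])
  finally show "hilb v r u + hilb v' (r - c) (\<lambda>l. u l + v l) \<le> hilb (\<lambda>l. v l + v' l) r u"
    unfolding eq unfolding hilb_def by (intro add_mono interval_length_mono) auto
qed

text \<open>Both bounds of the sandwich are differences of polynomials of degree at most \<open>D\<close> with the same form
of degree \<open>D\<close>.\<close>

lemma hilb_eventually_poly:
  assumes dim: "module_dim R M = enat D" "D \<ge> 1"
  shows "\<exists>p. eventually_poly (hilb v) (D - 1) p"
proof -
  let ?F = "\<lambda>r u. interval_length R M (pw (r + 1) u) (pw 0 u)"
  obtain p where p: "eventually_poly ?F D p" using hilb0_eventually_poly[OF dim(1)] by blast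
  obtain h where h: "separable (\<lambda>w. of_nat (h w))" "\<And>r u. hilb v r u = enat (h (case_option r u))"
    using separable_hilb[of v] by blast
  obtain c where c: "\<And>k u. pw (k + c) u \<inter> pw 0 (\<lambda>l. u l + v l) \<subseteq> pw k (\<lambda>l. u l + v l)"
    using artin_rees by blast
  have "\<exists>p. eventually_poly (\<lambda>r u. enat (h (case_option r u))) (D - 1) p"
  proof (rule separable_eventually_poly[OF h(1)])
    fix r :: nat and u :: "'s \<Rightarrow> nat" assume ru: "r > 0" "\<And>l. u l > 0"
    let ?q = "\<lambda>c v. ray_poly p D (- of_nat c) r (\<lambda>l. of_nat (v l)) u"
    have top: "has_top (?q c v) D (hom_component p D r u)" for c v by (rule has_top_ray_poly)
    have deg: "degree (?q 0 (\<lambda>_. 0) - ?q c v) \<le> D - 1" for c v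
      using has_top_diff[OF top[of 0 "\<lambda>_. 0"] top[of c v]] dim(2) by (intro degree_le_pred) auto
    obtain N0 where N0: "\<And>n. n \<ge> N0 \<Longrightarrow> \<exists>h. ?F (n * r - 0) (\<lambda>l. n * u l + 0) = enat h \<and> of_nat h = poly (?q 0 (\<lambda>_. 0)) (of_nat n)"
      using eventually_poly_on_ray[where v = "\<lambda>_. 0" and c = 0 and u = u, OF p ru] by blast
    obtain N1 where N1: "\<And>n. n \<ge> N1 \<Longrightarrow> \<exists>h. ?F (n * r - 0) (\<lambda>l. n * u l + v l) = enat h \<and> of_nat h = poly (?q 0 v) (of_nat n)"
      using eventually_poly_on_ray[where v = v and c = 0 and u = u, OF p ru] by blast
    obtain N2 where N2: "\<And>n. n \<ge> N2 \<Longrightarrow> \<exists>h. ?F (n * r - c) (\<lambda>l. n * u l + v l) = enat h \<and> of_nat h = poly (?q c v) (of_nat n)"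
      using eventually_poly_on_ray[where v = v and c = c and u = u, OF p ru] by blast
    have "poly (?q 0 (\<lambda>_. 0) - ?q 0 v) (of_nat n) \<le> of_nat (h (case_option (n * r) (\<lambda>l. n * u l))) \<and>
       of_nat (h (case_option (n * r) (\<lambda>l. n * u l))) \<le> poly (?q 0 (\<lambda>_. 0) - ?q c v) (of_nat n)"
      if n: "n \<ge> N0 + N1 + N2 + c" for n
    proof -
      obtain h0 where h0: "?F (n * r) (\<lambda>l. n * u l) = enat h0" "of_nat h0 = poly (?q 0 (\<lambda>_. 0)) (of_nat n)"
        using N0[of n] n by auto
      obtain h1 where h1: "?F (n * r) (\<lambda>l. n * u l + v l) = enat h1" "of_nat h1 = poly (?q 0 v) (of_nat n)"
        using N1[of n] n by auto
      obtain h2 where h2: "?F (n * r - c) (\<lambda>l. n * u l + v l) = enat h2" "of_nat h2 = poly (?q c v) (of_nat n)"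
        using N2[of n] n by auto
      have "n \<le> n * r" using ru(1) by simp
      hence "c \<le> n * r" using n by linarith
      from hilb_sandwich[OF c, of "n * r" "\<lambda>l. n * u l"] this
      have le: "h0 \<le> h1 + h (case_option (n * r) (\<lambda>l. n * u l))" "h2 + h (case_option (n * r) (\<lambda>l. n * u l)) \<le> h0"
        unfolding h0(1) h1(1) h2(1) h(2) by simp_all
      show ?thesis
        using of_nat_mono[OF le(1), where ?'a = rat] of_nat_mono[OF le(2), where ?'a = rat]
        unfolding poly_diff h0(2)[symmetric] h1(2)[symmetric] h2(2)[symmetric] by simp
    qed
    thus "\<exists>(q1 :: rat poly) (q2 :: rat poly) N. degree q1 \<le> D - 1 \<and> degree q2 \<le> D - 1 \<and>
        (\<forall>n\<ge>N. poly q1 (of_nat n) \<le> of_nat (h (case_option (n * r) (\<lambda>l. n * u l))) \<and>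
              of_nat (h (case_option (n * r) (\<lambda>l. n * u l))) \<le> poly q2 (of_nat n))"
      using deg by blast
  qed
  moreover have "hilb v = (\<lambda>r u. enat (h (case_option r u)))" using h(2) by (intro ext)
  ultimately show ?thesis by simp
qed

lemma leading_form_add:
  assumes p: "eventually_poly (hilb v) k p" and p': "eventually_poly (hilb v') k p'"
    and q: "eventually_poly (hilb (\<lambda>l. v l + v' l)) k q"
    and ru: "r > 0" "\<And>l. u l > 0"
  shows "hom_component q k r u = hom_component p k r u + hom_component p' k r u"
proof -
  obtain c where c: "\<And>k u. pw (k + c) u \<inter> pw 0 (\<lambda>l. u l + v l) \<subseteq> pw k (\<lambda>l. u l + v l)"
    using artin_rees by blast
  let ?q = "\<lambda>p c v. ray_poly p k (- of_nat c) r (\<lambda>l. of_nat (v l)) u"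
  have top: "degree (?q p c v) \<le> k" "coeff (?q p c v) k = hom_component p k r u" for p c v
    using has_top_ray_poly[of p k "- of_nat c" r "\<lambda>l. of_nat (v l)" u] by (auto simp: has_top_def)
  obtain N0 where N0: "\<And>n. n \<ge> N0 \<Longrightarrow> \<exists>h. hilb (\<lambda>l. v l + v' l) (n * r - 0) (\<lambda>l. n * u l + 0) = enat h \<and> of_nat h = poly (?q q 0 (\<lambda>_. 0)) (of_nat n)"
    using eventually_poly_on_ray[where v = "\<lambda>_. 0" and c = 0 and u = u, OF q ru] by blast
  obtain N1 where N1: "\<And>n. n \<ge> N1 \<Longrightarrow> \<exists>h. hilb v (n * r - 0) (\<lambda>l. n * u l + 0) = enat h \<and> of_nat h = poly (?q p 0 (\<lambda>_. 0)) (of_nat n)"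
    using eventually_poly_on_ray[where v = "\<lambda>_. 0" and c = 0 and u = u, OF p ru] by blast
  obtain N2 where N2: "\<And>n. n \<ge> N2 \<Longrightarrow> \<exists>h. hilb v' (n * r - 0) (\<lambda>l. n * u l + v l) = enat h \<and> of_nat h = poly (?q p' 0 v) (of_nat n)"
    using eventually_poly_on_ray[where v = v and c = 0 and u = u, OF p' ru] by blast
  obtain N3 where N3: "\<And>n. n \<ge> N3 \<Longrightarrow> \<exists>h. hilb v' (n * r - c) (\<lambda>l. n * u l + v l) = enat h \<and> of_nat h = poly (?q p' c v) (of_nat n)"
    using eventually_poly_on_ray[where v = v and c = c and u = u, OF p' ru] by blast
  have le: "poly (?q p 0 (\<lambda>_. 0) + ?q p' c v) (of_nat n) \<le> poly (?q q 0 (\<lambda>_. 0)) (of_nat n) \<and>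
      poly (?q q 0 (\<lambda>_. 0)) (of_nat n) \<le> poly (?q p 0 (\<lambda>_. 0) + ?q p' 0 v) (of_nat n)"
    if n: "n \<ge> N0 + N1 + N2 + N3 + c" for n
  proof -
    obtain h0 where h0: "hilb (\<lambda>l. v l + v' l) (n * r) (\<lambda>l. n * u l) = enat h0" "of_nat h0 = poly (?q q 0 (\<lambda>_. 0)) (of_nat n)"
      using N0[of n] n by auto
    obtain h1 where h1: "hilb v (n * r) (\<lambda>l. n * u l) = enat h1" "of_nat h1 = poly (?q p 0 (\<lambda>_. 0)) (of_nat n)"
      using N1[of n] n by auto
    obtain h2 where h2: "hilb v' (n * r) (\<lambda>l. n * u l + v l) = enat h2" "of_nat h2 = poly (?q p' 0 v) (of_nat n)"
      using N2[of n] n by auto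
    obtain h3 where h3: "hilb v' (n * r - c) (\<lambda>l. n * u l + v l) = enat h3" "of_nat h3 = poly (?q p' c v) (of_nat n)"
      using N3[of n] n by auto
    have "n \<le> n * r" using ru(1) by simp
    hence "c \<le> n * r" using n by linarith
    from hilb_two_step[OF c, where v' = v' and r = "n * r" and u = "\<lambda>l. n * u l"] this
    have le: "h0 \<le> h1 + h2" "h1 + h3 \<le> h0"
      unfolding h0(1) h1(1) h2(1) h3(1) by simp_all
    show ?thesis
      using of_nat_mono[OF le(1), where ?'a = rat] of_nat_mono[OF le(2), where ?'a = rat]
      unfolding poly_add h0(2)[symmetric] h1(2)[symmetric] h2(2)[symmetric] h3(2)[symmetric] by simp
  qed
  have "coeff (?q p 0 (\<lambda>_. 0) + ?q p' c v) k \<le> coeff (?q q 0 (\<lambda>_. 0)) k"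
    by (rule coeff_mono_if_eventually_le[OF degree_add_le[OF top(1) top(1)] top(1)]) (use le in blast)
  moreover have "coeff (?q q 0 (\<lambda>_. 0)) k \<le> coeff (?q p 0 (\<lambda>_. 0) + ?q p' 0 v) k"
    by (rule coeff_mono_if_eventually_le[OF top(1) degree_add_le[OF top(1) top(1)]]) (use le in blast)
  ultimately show ?thesis unfolding coeff_add top(2) by simp
qed

text \<open>By induction on \<open>A\<close>, adding one unit vector at a time to the shift; the shift 0 gives the zero
function.\<close>

lemma leading_form_sum:
  assumes dim: "module_dim R M = enat D" "D \<ge> 1"
    and p: "\<And>j. eventually_poly (hilb (basis_vec j)) (D - 1) (p j)"
    and q: "eventually_poly (hilb (\<lambda>l. if l \<in> A then 1 else 0)) (D - 1) q"
    and ru: "r > 0" "\<And>l. u l > 0"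
  shows "hom_component q (D - 1) r u = (\<Sum>j\<in>A. hom_component (p j) (D - 1) r u)"
proof -
  have "finite A" by simp
  thus ?thesis using q
  proof (induction A arbitrary: q rule: finite_induct)
    case empty
    have "hilb (\<lambda>_. 0) r u = 0" for r u
    proof -
      have "pw 0 u \<subseteq> pw (r + 1) u <+>\<^bsub>M\<^esub> pw 0 u" by (rule set_add_sub2[OF sp cp])
      from interval_length_mono[OF this order_refl, of R M "pw 0 u"]
      show ?thesis by (simp add: hilb_def interval_length_self[OF sp])
    qed
    hence "eventually_poly (hilb (\<lambda>_. 0)) (D - 1) (\<lambda>_ _. 0)"
      by (simp add: eventually_poly_def hom_component_def zero_enat_def)
    from leading_form_unique[where u = u, OF _ this ru] empty show ?case by (simp add: hom_component_def)
  next
    case (insert j A)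
    obtain q' where q': "eventually_poly (hilb (\<lambda>l. if l \<in> A then 1 else 0)) (D - 1) q'"
      using hilb_eventually_poly[OF dim] by blast
    have "(\<lambda>l. if l \<in> insert j A then 1 else 0) = (\<lambda>l. (if l \<in> A then 1 else 0) + basis_vec j l)"
      using insert.hyps(2) by (auto simp: basis_vec_def)
    hence "eventually_poly (hilb (\<lambda>l. (if l \<in> A then 1 else 0) + basis_vec j l)) (D - 1) q"
      using insert.prems by simp
    from leading_form_add[where u = u, OF q' p this ru] insert.IH[OF q'] insert.hyps show ?case by simp
  qed
qed

end

text \<open>Generators of the different ideals are listed together with the index of their ideal.\<close>

lemma (in cring) finite_generators:
  fixes I :: "'t::finite \<Rightarrow> 'a set"
  assumes "noetherian_ring R" "\<And>d. ideal (I d) R"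
  obtains n :: nat and a :: "nat \<Rightarrow> 'a" and dir :: "nat \<Rightarrow> 't" where "\<And>i. i < n \<Longrightarrow> a i \<in> carrier R" "\<And>d. I d = genideal R {a i | i. i < n \<and> dir i = d}"
proof -
  have "\<exists>A\<subseteq>carrier R. finite A \<and> I d = genideal R A" for d
    by (rule noetherian_ring.finetely_gen[OF assms])
  then obtain A where A: "\<And>d. A d \<subseteq> carrier R" "\<And>d. finite (A d)" "\<And>d. I d = genideal R (A d)" by metis
  have "finite (Sigma UNIV A)" using A(2) by (intro finite_SigmaI) auto
  then obtain xs where xs: "set xs = Sigma UNIV A" using finite_list by blast
  show thesis
  proof (rule that[of "length xs" "\<lambda>i. snd (xs ! i)" "\<lambda>i. fst (xs ! i)"])
    fix i assume "i < length xs"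
    hence "xs ! i \<in> Sigma UNIV A" using xs nth_mem by blast
    hence "snd (xs ! i) \<in> A (fst (xs ! i))" by auto
    thus "snd (xs ! i) \<in> carrier R" using A(1) by blast
  next
    fix d
    have "{snd (xs ! i) |i. i < length xs \<and> fst (xs ! i) = d} = snd ` {x \<in> set xs. fst x = d}"
      unfolding set_conv_nth by blast
    also have "\<dots> = A d" unfolding xs by force
    finally show "I d = genideal R {snd (xs ! i) |i. i < length xs \<and> fst (xs ! i) = d}" using A(3) by simp
  qed
qed

theorem proposition3p9:
  fixes R :: "('a, 'r) ring_scheme" and \<mm> :: "'a set"
    and M :: "('a, 'b, 'm) module_scheme"
    and J :: "'s::finite \<Rightarrow> 'a set"
    and D i :: nat and \<alpha> :: "'s \<Rightarrow> nat"
  assumes "noetherian_ring R" and "local_ring R \<mm>"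
    and "module R M" and "finitely_generated_module R M" and "carrier M \<noteq> {\<zero>\<^bsub>M\<^esub>}"
    and "module_dim R M = enat D" and "D \<ge> 1"
    and "\<And>l. ideal (J l) R" and "\<And>l. J l \<noteq> carrier R"
    and "\<And>l. module_height R M (J l) > 0"
    and "1 \<le> i" and "i \<le> D" and "vsize \<alpha> = i - 1"
  shows "diagonal_mm R \<mm> J M i \<alpha> =
           (\<Sum>j\<in>UNIV. directional_mm R \<mm> J M j (\<alpha>(j := \<alpha> j + 1)))"
proof -
  interpret R: local_ring R \<mm> by (rule assms(2))
  have "ideal (case_option \<mm> J d) R" for d
    using assms(8) maximalideal.axioms(1)[OF R.maximalideal_max] by (cases d) auto
  then obtain n :: nat and a :: "nat \<Rightarrow> 'a" and dir :: "nat \<Rightarrow> 's option" where gen: "\<And>i. i < n \<Longrightarrow> a i \<in> carrier R"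
    "\<And>d. case_option \<mm> J d = genideal R {a i | i. i < n \<and> dir i = d}"
    using R.finite_generators[OF assms(1), of "case_option \<mm> J"] by blast
  interpret local_ideal_powers R M \<mm> J n a dir
    by (intro local_ideal_powers.intro ideal_powers.intro ideal_powers_axioms.intro local_ideal_powers_axioms.intro
        assms(1-4) gen)
  have H: "hilbert_fun R \<mm> J M v = hilb v" for v by (intro ext hilbert_fun_eq)
  have "\<forall>j. \<exists>p. eventually_poly (hilb (basis_vec j)) (D - 1) p"
    by (intro allI hilb_eventually_poly[OF assms(6,7)])
  then obtain p where "\<forall>j. eventually_poly (hilb (basis_vec j)) (D - 1) (p j)"
    by (rule choice[THEN exE])
  hence p: "eventually_poly (hilb (basis_vec j)) (D - 1) (p j)" for j by blast
  obtain q where q: "eventually_poly (hilb (\<lambda>_. 1)) (D - 1) q"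
    using hilb_eventually_poly[OF assms(6,7)] by blast
  have "hom_component q (D - 1) r u = (\<Sum>j\<in>UNIV. hom_component (p j) (D - 1) r u)"
    if "r > 0" "\<And>l. u l > 0" for r u
    using leading_form_sum[OF assms(6,7) p, of UNIV q r u] q that by simp
  thus ?thesis
    using p q by (intro diagonal_mm_eq_sum_directional_mm[OF assms(6,7), where p = q and q = p] assms(11-13)) (simp_all add: H)
qed

end
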